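(* Let $n,g\in\mathbb{N}$, $\mathbf{f}=(f_1,\dots,f_g)\in\mathbb{N}^g$ with $\sum_{i=1}^g f_i=n$, and let $p$ be a prime. Let $w=\prod_{i=1}^r\left(\mathbf{0}^{L_i-L_{i-1}}\mathbf{1}^{M_i-M_{i-1}}\right)\in\mathcal{D}_{2n}$ be a Dyck word and let $\mathcal{A}=(\mathcal{A}_1,\dots,\mathcal{A}_r)\in\mathcal{P}_w$ be a set partition of $[g]$ compatible with $w$. Let $t_i=\sum_{k=1}^i|\mathcal{A}_k|$ for $0\le i\le r$, and let $a^{(i)}_1<\dots<a^{(i)}_{t_i-t_{i-1}}$ be the elements of $\mathcal{A}_i$. Then $$D^{\mathbf{f}}_{w,\mathcal{A}}(p,t)=\prod_{i=1}^r\binom{L_i-M_{i-1}}{L_i-M_i}_{p^{-1}}\ \prod_{i=1}^r I^{\mathrm{wo}}_{t_i-t_{i-1}}(\mathbf{y}^{(i)})\ \cdot\ \prod_{i=1}^{r-1}I^{\circ}_{M_i-M_{i-1}}(p^{-1};x_{M_{i-1}+1},\dots,x_{M_i})\ \cdot\ I_{n-M_{r-1}}(p^{-1};x_{M_{r-1}+1},\dots,x_n),$$ where $\mathbf{y}^{(i)}=(y^{(i)}_{\mathcal{I}})_{\varnothing\ne\mathcal{I}\subseteq[t_i-t_{i-1}]}$ and $$x_j=p^{j(2n+L_i-j)}t^{2L_i+j}\quad\text{for } M_{i-1}<j\le M_i,$$ $$y^{(i)}_{\mathcal{I}}=p^{(2n-M_{i-1}+\varepsilon^{(i)}(\mathcal{I}))M_{i-1}}\,t^{2\varepsilon^{(i)}(\mathcal{I})+M_{i-1}}\quad\text{for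 }\varnothing\neq\mathcal{I}\subseteq[t_i-t_{i-1}],$$ with $\varepsilon^{(i)}(\mathcal{I})=L_{i-1}+\sum_{j\in\mathcal{I}}f_{a^{(i)}_j}$.
   Context: Notation: $[m]=\{1,\dots,m\}$; $\mathbb{N}=\{1,2,\dots\}$, $\mathbb{N}_0=\mathbb{N}\cup\{0\}$. The variable $t$ stands for $p^{-s}$; infinite sums are formal power series in $t$. **Gaussian coefficients.** $\binom{a}{b}_Y=\prod_{i=a-b+1}^a(1-Y^i)/\prod_{i=1}^b(1-Y^i)$. For $I=\{i_1<\dots<i_m\}\subseteq[h-1]$, $\binom{h}{I}_Y=\binom{h}{i_m}_Y\binom{i_m}{i_{m-1}}_Y\cdots\binom{i_2}{i_1}_Y$ (equal to $1$ for $I=\varnothing$). **Igusa functions.** For $h\in\mathbb{N}$, $$I_h(Y;X_1,\dots,X_h)=\frac{1}{1-X_h}\sum_{I\subseteq[h-1]}\binom{h}{I}_Y\prod_{i\in I}\frac{X_i}{1-X_i},\qquad I_h^\circ=X_h\,I_h.$$ For variables $\mathbf{X}=(X_{\mathcal{I}})_{\varnothing\ne\mathcal{I}\subseteq[h]}$, $$I_h^{\mathrm{wo}}(\mathbf{X})=\frac{1}{1-X_{[h]}}\sum_{y\in P_h}\prod_{\mathcal{I}\in y}\frac{X_{\mathcal{I}}}{1-X_{\mathcal{I}}},$$ where $P_h$ is the set of all chains $y=(\mathcal{I}_1\subsetneq\dots\subsetneq\mathcal{I}_\ell)$ of non-empty proper subsets of $[h]$, including the empty chain. **Dyck words and pairs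 of partitions.** A Dyck word of length $2n$ is a word in the letters $\mathbf{0},\mathbf{1}$, each occurring $n$ times, no initial segment of which contains more $\mathbf{1}$'s than $\mathbf{0}$'s; $\mathcal{D}_{2n}$ is the set of these. Each is uniquely of the form $\prod_{i=1}^r\mathbf{0}^{L_i-L_{i-1}}\mathbf{1}^{M_i-M_{i-1}}$ with $0=L_0<L_1<\dots<L_r=n$, $0=M_0<M_1<\dots<M_r=n$, $L_i\ge M_i$. For partitions $\lambda=(\lambda_1\ge\dots\ge\lambda_n\ge0)$, $\mu=(\mu_1\ge\dots\ge\mu_n\ge 0)$ write $\mu\le\lambda$ if $\mu_i\le\lambda_i$ for all $i$. Then there are unique $r$ and $0=L_0<\dots<L_r=n$, $0=M_0<\dots<M_r=n$ with $\lambda_{L_i}\ge\mu_{M_{i-1}+1}$ for $i\in[r]$ and $\mu_{M_i}>\lambda_{L_i+1}$ for $i\in[r-1]$; set $w(\mu,\lambda)=\prod_{i=1}^r\mathbf{0}^{L_i-L_{i-1}}\mathbf{1}^{M_i-M_{i-1}}\in\mathcal{D}_{2n}$. Let $\alpha(\lambda,\mu;p)$ be the number of subgroups isomorphic to $\prod_i\mathbb{Z}/p^{\mu_i}$ in the group $\prod_i\mathbb{Z}/p^{\lambda_i}$. **Weak orderings.** $\mathrm{WO}_g=\{(\sigma,J)\in S_g\times 2^{[g-1]}\mid \mathrm{Des}(\sigma)\subseteq J\}$, where $\mathrm{Des}(\sigma)=\{i\in[g-1]\mid\sigma(i)>\sigma(i+1)\}$. **Admissible tuples.** Put $C_i=\sum_{j=1}^i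 f_j$. $\mathrm{Adm}_{\mathbf{1},\mathbf{f}}$ is the set of $\ell\in\mathbb{N}_0^n$ with $\ell_{C_{i-1}+1}=\dots=\ell_{C_i}$ for all $i\in[g]$. For such $\ell$, $v_\ell=(\sigma_\ell,J_\ell)\in\mathrm{WO}_g$ is the unique weak ordering with $\ell_{C_{\sigma_\ell(1)}}\ge\dots\ge\ell_{C_{\sigma_\ell(g)}}$ and $J_\ell=\{j\in[g-1]\mid\ell_{C_{\sigma_\ell(j)}}>\ell_{C_{\sigma_\ell(j+1)}}\}$. Let $\lambda(\ell)$ be the partition obtained by sorting the entries of $\ell$ in non-ascending order. **Compatibility.** A set partition of $[g]$ is an ordered tuple $\mathcal{A}=(\mathcal{A}_1,\dots,\mathcal{A}_s)$ of pairwise disjoint non-empty subsets with union $[g]$. For $w=\prod_{i=1}^r\mathbf{0}^{L_i-L_{i-1}}\mathbf{1}^{M_i-M_{i-1}}$, it is compatible with $w$ if $s=r$ and $\sum_{j\in\mathcal{A}_i}f_j=L_i-L_{i-1}$ for all $i\in[r]$; $\mathcal{P}_w$ is the set of these. A weak ordering $v=(\sigma_v,J_v)\in\mathrm{WO}_g$ is compatible with $w$ if there is a (necessarily unique) sequence $0=t_0<t_1<\dots<t_r=g$ with $\{t_1,\dots,t_{r-1}\}\subseteq J_v$ such that the sets $\mathcal{A}_k=\{\sigma_v(t_{k-1}+1),\dots,\sigma_v(t_k)\}$ form a set partition compatible with $w$; this set partition is denoted $\mathcal{A}(w,v)$. **The functions.** For $v\in\mathrm{WO}_g$, $$D^{\mathbf{f}}_{w,v}(p,t)=\sum_{\substack{\ell\in\mathrm{Adm}_{\mathbf{1},\mathbf{f}}\\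 v_\ell=v}}\ \sum_{\substack{\mu\le\lambda(\ell)\\ w(\mu,\lambda(\ell))=w}}\alpha(\lambda(\ell),\mu;p)\,(p^{2n}t)^{\sum_i\mu_i}\,t^{2\sum_i\ell_i},$$ and $D^{\mathbf{f}}_{w,\mathcal{A}}(p,t)=\sum_{v}D^{\mathbf{f}}_{w,v}(p,t)$, the sum being over all $v\in\mathrm{WO}_g$ compatible with $w$ with $\mathcal{A}(w,v)=\mathcal{A}$. *)

theory Defs
  imports
    "HOL-Algebra.Product_Groups"
    "HOL-Analysis.Infinite_Sum"
    "HOL-Combinatorics.Permutations"
    "HOL-Computational_Algebra.Formal_Power_Series"
    "HOL-Library.Disjoint_Sets"
begin

text \<open>Tuples of fixed length are lists; their components are addressed from 1.\<close>

abbreviation nth_from_one :: "'a list \<Rightarrow> nat \<Rightarrow> 'a"  (infixl \<open>!\<^sub>1\<close> 100)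
  where "xs !\<^sub>1 i \<equiv> xs ! (i - 1)"


section \<open>Gaussian coefficients and Igusa functions\<close>

definition gauss_binomial :: "nat \<Rightarrow> nat \<Rightarrow> 'a::field \<Rightarrow> 'a"
  where "gauss_binomial a b Y = (\<Prod>i=a-b+1..a. 1 - Y ^ i) / (\<Prod>i=1..b. 1 - Y ^ i)"

definition gauss_multinomial :: "nat \<Rightarrow> nat set \<Rightarrow> 'a::field \<Rightarrow> 'a"
  where "gauss_multinomial h I Y =
    (let is = sorted_list_of_set I @ [h]
     in \<Prod>k=1..card I. gauss_binomial (is !\<^sub>1 (k + 1)) (is !\<^sub>1 k) Y)"

text \<open>The rational functions below are evaluated at power series \<open>X\<close> without constant term,
  so that all denominators are units.\<close>

definition igusa :: "nat \<Rightarrow> 'a::field \<Rightarrow> (nat \<Rightarrow> 'a fps) \<Rightarrow> 'a fps"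
  where "igusa h Y X =
    1 / (1 - X h) *
    (\<Sum>I\<in>Pow {1..h-1}. fps_const (gauss_multinomial h I Y) * (\<Prod>i\<in>I. X i / (1 - X i)))"

definition igusa_circ :: "nat \<Rightarrow> 'a::field \<Rightarrow> (nat \<Rightarrow> 'a fps) \<Rightarrow> 'a fps"
  where "igusa_circ h Y X = X h * igusa h Y X"

definition igusa_wo :: "nat \<Rightarrow> (nat set \<Rightarrow> 'a::field fps) \<Rightarrow> 'a fps"
  where "igusa_wo h X =
    1 / (1 - X {1..h}) *
    (\<Sum>y\<in>chains {I. I \<noteq> {} \<and> I \<subset> {1..h}}. \<Prod>I\<in>y. X I / (1 - X I))"


section \<open>Dyck words and pairs of partitions\<close>

datatype letter = LZero | LOne

definition dyck_words :: "nat \<Rightarrow> letter list set"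
  where "dyck_words n =
    {w. count_list w LZero = n \<and> count_list w LOne = n \<and>
        (\<forall>k. count_list (take k w) LOne \<le> count_list (take k w) LZero)}"

definition cuts :: "nat \<Rightarrow> nat \<Rightarrow> (nat \<Rightarrow> nat) \<Rightarrow> bool"
  where "cuts n r L \<longleftrightarrow> L 0 = 0 \<and> L r = n \<and> (\<forall>i\<in>{1..r}. L (i - 1) < L i)"

definition block_word :: "nat \<Rightarrow> (nat \<Rightarrow> nat) \<Rightarrow> (nat \<Rightarrow> nat) \<Rightarrow> letter list"
  where "block_word r L M =
    concat (map (\<lambda>i. replicate (L i - L (i - 1)) LZero @ replicate (M i - M (i - 1)) LOne)
                [1..<r+1])"

definition partitions :: "nat \<Rightarrow> nat list set"
  where "partitions n = {la. length la = n \<and> sorted_wrt (\<ge>) la}"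

definition pair_word :: "nat \<Rightarrow> nat list \<Rightarrow> nat list \<Rightarrow> letter list"
  where "pair_word n mu la =
    (THE w. \<exists>r L M. cuts n r L \<and> cuts n r M \<and>
       (\<forall>i\<in>{1..r}. la !\<^sub>1 (L i) \<ge> mu !\<^sub>1 (M (i - 1) + 1)) \<and>
       (\<forall>i\<in>{1..<r}. mu !\<^sub>1 (M i) > la !\<^sub>1 (L i + 1)) \<and>
       w = block_word r L M)"

definition p_group :: "nat \<Rightarrow> nat list \<Rightarrow> (nat \<Rightarrow> int) monoid"
  where "p_group p la =
    product_group {1..length la} (\<lambda>i. integer_mod_group (p ^ (la !\<^sub>1 i)))"

definition num_subgroups :: "nat list \<Rightarrow> nat list \<Rightarrow> nat \<Rightarrow> nat"
  where "num_subgroups la mu p =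
    card {H. subgroup H (p_group p la) \<and> (p_group p la)\<lparr>carrier := H\<rparr> \<cong> p_group p mu}"


section \<open>Weak orderings and admissible tuples\<close>

definition Des :: "nat \<Rightarrow> (nat \<Rightarrow> nat) \<Rightarrow> nat set"
  where "Des g \<sigma> = {i\<in>{1..g-1}. \<sigma> i > \<sigma> (i + 1)}"

definition weak_orderings :: "nat \<Rightarrow> ((nat \<Rightarrow> nat) \<times> nat set) set"
  where "weak_orderings g = {(\<sigma>, J). \<sigma> permutes {1..g} \<and> J \<subseteq> {1..g-1} \<and> Des g \<sigma> \<subseteq> J}"

definition psum :: "(nat \<Rightarrow> nat) \<Rightarrow> nat \<Rightarrow> nat"
  where "psum f i = (\<Sum>j=1..i. f j)"

definition admissible :: "nat \<Rightarrow> nat \<Rightarrow> (nat \<Rightarrow> nat) \<Rightarrow> nat list set"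
  where "admissible n g f =
    {l. length l = n \<and>
        (\<forall>i\<in>{1..g}. \<forall>k\<in>{psum f (i - 1) + 1..psum f i}. l !\<^sub>1 k = l !\<^sub>1 (psum f i))}"

definition weak_ordering_of ::
    "nat \<Rightarrow> (nat \<Rightarrow> nat) \<Rightarrow> nat list \<Rightarrow> (nat \<Rightarrow> nat) \<times> nat set"
  where "weak_ordering_of g f l =
    (THE v. v \<in> weak_orderings g \<and>
       (case v of (\<sigma>, J) \<Rightarrow>
          (\<forall>j\<in>{1..g-1}. l !\<^sub>1 (psum f (\<sigma> j)) \<ge> l !\<^sub>1 (psum f (\<sigma> (j + 1)))) \<and>
          J = {j\<in>{1..g-1}. l !\<^sub>1 (psum f (\<sigma> j)) > l !\<^sub>1 (psum f (\<sigma> (j + 1)))}))"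

definition sort_desc :: "nat list \<Rightarrow> nat list"
  where "sort_desc l = rev (sort l)"


section \<open>Compatibility\<close>

definition ordered_set_partitions :: "nat \<Rightarrow> nat set list set"
  where "ordered_set_partitions g = {A. distinct A \<and> partition_on {1..g} (set A)}"

definition compatible_partitions ::
    "nat \<Rightarrow> nat \<Rightarrow> (nat \<Rightarrow> nat) \<Rightarrow> letter list \<Rightarrow> nat set list set"
  where "compatible_partitions n g f w =
    {A \<in> ordered_set_partitions g.
       \<exists>r L M. cuts n r L \<and> cuts n r M \<and> w = block_word r L M \<and> length A = r \<and>
         (\<forall>i\<in>{1..r}. (\<Sum>j\<in>A !\<^sub>1 i. f j) = L i - L (i - 1))}"

definition is_induced_partition ::
    "nat \<Rightarrow> nat \<Rightarrow> (nat \<Rightarrow> nat) \<Rightarrow> letter list \<Rightarrow> (nat \<Rightarrow> nat) \<times> nat set \<Rightarrow> nat set list \<Rightarrow> bool"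
  where "is_induced_partition n g f w v A \<longleftrightarrow>
    (case v of (\<sigma>, J) \<Rightarrow>
       \<exists>r t. cuts g r t \<and> t ` {1..<r} \<subseteq> J \<and>
         A = map (\<lambda>k. \<sigma> ` {t (k - 1) + 1..t k}) [1..<r+1] \<and>
         A \<in> compatible_partitions n g f w)"

definition compatible_weak_ordering ::
    "nat \<Rightarrow> nat \<Rightarrow> (nat \<Rightarrow> nat) \<Rightarrow> letter list \<Rightarrow> (nat \<Rightarrow> nat) \<times> nat set \<Rightarrow> bool"
  where "compatible_weak_ordering n g f w v \<longleftrightarrow> (\<exists>A. is_induced_partition n g f w v A)"

definition induced_partition ::
    "nat \<Rightarrow> nat \<Rightarrow> (nat \<Rightarrow> nat) \<Rightarrow> letter list \<Rightarrow> (nat \<Rightarrow> nat) \<times> nat set \<Rightarrow> nat set list"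
  where "induced_partition n g f w v = (THE A. is_induced_partition n g f w v A)"


section \<open>The generating functions\<close>

definition D_term :: "nat \<Rightarrow> letter list \<Rightarrow> nat \<Rightarrow> nat list \<Rightarrow> rat fps"
  where "D_term n w p l =
    (\<Sum>mu | mu \<in> partitions n \<and> (\<forall>i\<in>{1..n}. mu !\<^sub>1 i \<le> sort_desc l !\<^sub>1 i) \<and>
           pair_word n mu (sort_desc l) = w.
       of_nat (num_subgroups (sort_desc l) mu p) *
       (of_nat p ^ (2 * n) * fps_X) ^ (\<Sum>i=1..n. mu !\<^sub>1 i) *
       fps_X ^ (2 * (\<Sum>i=1..n. l !\<^sub>1 i)))"

text \<open>The infinite sum is taken in the metric topology of \<^typ>\<open>rat fps\<close>, which is the
  \<open>t\<close>-adic one; it converges by \<open>D_term_summable\<close> below.\<close>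

definition D_wv ::
    "nat \<Rightarrow> nat \<Rightarrow> (nat \<Rightarrow> nat) \<Rightarrow> letter list \<Rightarrow> (nat \<Rightarrow> nat) \<times> nat set \<Rightarrow> nat \<Rightarrow> rat fps"
  where "D_wv n g f w v p =
    (\<Sum>\<^sub>\<infinity>l\<in>{l \<in> admissible n g f. weak_ordering_of g f l = v}. D_term n w p l)"

definition D_wA ::
    "nat \<Rightarrow> nat \<Rightarrow> (nat \<Rightarrow> nat) \<Rightarrow> letter list \<Rightarrow> nat set list \<Rightarrow> nat \<Rightarrow> rat fps"
  where "D_wA n g f w A p =
    (\<Sum>v | v \<in> weak_orderings g \<and> compatible_weak_ordering n g f w v \<and>
          induced_partition n g f w v = A.
       D_wv n g f w v p)"

lemma fps_summable_if_locally_finite: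
  fixes F :: "'i \<Rightarrow> 'a::comm_ring_1 fps"
  assumes fin: "\<And>k. finite {a\<in>A. \<exists>j\<le>k. fps_nth (F a) j \<noteq> 0}"
  shows "F summable_on A"
proof -
  define S where "S = Abs_fps (\<lambda>k. \<Sum>a\<in>{a\<in>A. \<exists>j\<le>k. fps_nth (F a) j \<noteq> 0}. fps_nth (F a) k)"
  have "(F has_sum S) A"
    unfolding has_sum_def tendsto_fps_iff
  proof (intro allI)
    fix k
    define B where "B = {a\<in>A. \<exists>j\<le>k. fps_nth (F a) j \<noteq> 0}"
    have B: "finite B" "B \<subseteq> A" using fin by (auto simp: B_def)
    have "fps_nth (sum F X) k = fps_nth S k" if "finite X" "B \<subseteq> X" "X \<subseteq> A" for X
      using that by (auto simp: fps_sum_nth S_def B_def intro!: sum.mono_neutral_right)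
    thus "\<forall>\<^sub>F X in finite_subsets_at_top A. fps_nth (sum F X) k = fps_nth S k"
      unfolding eventually_finite_subsets_at_top using B by blast
  qed
  thus ?thesis by (auto simp: summable_on_def)
qed

lemma D_term_summable:
  assumes "U \<subseteq> admissible n g f"
  shows "D_term n w p summable_on U"
proof (rule fps_summable_if_locally_finite)
  fix k
  have low: "fps_nth (D_term n w p l) j = 0" if "j < 2 * (\<Sum>i=1..n. l !\<^sub>1 i)" for l j
    using that by (auto simp: D_term_def fps_sum_nth fps_X_power_mult_right_nth intro!: sum.neutral)
  have "{a\<in>U. \<exists>j\<le>k. fps_nth (D_term n w p a) j \<noteq> 0} \<subseteq> {l. set l \<subseteq> {..k} \<and> length l = n}"
  proof safe
    fix l j x
    assume l: "l \<in> U" and j: "j \<le> k" "fps_nth (D_term n w p l) j \<noteq> 0" and x: "x \<in> set l"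
    have len: "length l = n" using l assms by (auto simp: admissible_def)
    obtain m where m: "m < n" "l ! m = x" using x len by (auto simp: in_set_conv_nth)
    have "l !\<^sub>1 (m + 1) \<le> (\<Sum>i=1..n. l !\<^sub>1 i)"
      using m by (intro member_le_sum) auto
    with m low[of j l] j show "x \<le> k" by (force simp: not_less)
  qed (use assms in \<open>auto simp: admissible_def\<close>)
  thus "finite {a\<in>U. \<exists>j\<le>k. fps_nth (D_term n w p a) j \<noteq> 0}"
    by (rule finite_subset) (simp add: finite_lists_length_eq)
qed

end

theory Submission
  imports Defs
    "HOL-Library.Product_Order"
    "HOL-Number_Theory.Cong"
begin

text \<open>Record a pair \<open>(l, \<mu>)\<close> level by level: at level \<open>j \<ge> 1\<close> take the state \<open>(S, b)\<close>, where \<open>S\<close> is the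
  set of those \<open>k\<close> for which the entries of \<open>l\<close> in the \<open>k\<close>-th block are at least \<open>j\<close>, and \<open>b\<close> is the
  number of parts of \<open>\<mu>\<close> that are at least \<open>j\<close>. The states decrease with \<open>j\<close>, so the pair amounts to a
  finite chain of states with positive multiplicities. Counting monomorphisms between finite abelian
  \<open>p\<close>-groups shows that the summand of the pair is a product of powers of state weights (one factor per
  level, the exponents being the multiplicities) times a coefficient which depends only on the set of
  second components in the chain. Summing over the multiplicities replaces each weight \<open>W\<close> by
  \<open>W / (1 - W)\<close>.

  Prescribing the Dyck word and the set partition means that the chain runs through hooks joining
  \<open>(P (i - 1), M (i - 1))\<close> to \<open>(P i, M i)\<close>, with \<open>P i\<close> the union of the first \<open>i\<close> blocks of the set
  partition, and contains the points \<open>(P i, M i)\<close> with \<open>0 < i < r\<close>. Hence the sum over chains is a product over the hooks. In a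
  hook the set grows first, through an arbitrary chain of subsets, which gives the weak order Igusa
  function; then the number grows through an arbitrary subset of an interval, which gives the Igusa
  function. The coefficient splits into the Gaussian binomial and multinomial coefficients.\<close>

section \<open>Counting subgroups of a given type\<close>

text \<open>Everything rests on additivity over levels. The number \<open>min (mu k) (e q)\<close>
  counts the levels reached by both entries, so the exponent of \<open>p\<close> in a count of
  monomorphisms is a sum over levels: the state \<open>(S, b)\<close> contributes
  \<open>b * sum f S\<close> for the ambient group, and \<open>b * b\<close> is subtracted for the
  automorphisms of the subgroup. Together with \<open>(p ^ (2 * n) * t) ^ b\<close> and
  \<open>t ^ (2 * sum f S)\<close> this yields the weight
  \<open>p ^ (b * (2 * n + sum f S - b)) * t ^ (2 * sum f S + b)\<close>. The \<open>x j\<close> of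
  the theorem are its values at the states \<open>(P i, j)\<close>, the \<open>y i I\<close> its
  values at sets between \<open>P (i - 1)\<close> and \<open>P i\<close> with
  \<open>b = M (i - 1)\<close>. The points \<open>(P i, M i)\<close> with \<open>0 < i < r\<close>
  are forced because the word demands a strict drop from the part of \<open>mu\<close> at
  \<open>M i\<close> to the entries of \<open>l\<close> outside \<open>P i\<close>. The last point
  \<open>(P r, n)\<close> and the corners of the hooks are optional. A forced state of weight
  \<open>W\<close> contributes \<open>W / (1 - W)\<close>, whence \<open>igusa_circ\<close>; an
  optional one contributes \<open>1 + W / (1 - W) = 1 / (1 - W)\<close>, the prefactor of
  \<open>igusa\<close> and \<open>igusa_wo\<close>. The Dyck condition \<open>M i \<le> L i\<close>
  makes the exponents \<open>L i + 1 - k\<close> in the coefficient positive.\<close>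

definition ext_mon :: "('a, 'c) monoid_scheme \<Rightarrow> ('b, 'd) monoid_scheme \<Rightarrow> ('a \<Rightarrow> 'b) set"
  where "ext_mon G H = mon G H \<inter> extensional (carrier G)"

lemma ext_monI:
  assumes "h \<in> hom G H" "inj_on h (carrier G)" "h \<in> extensional (carrier G)"
  shows "h \<in> ext_mon G H"
  using assms by (auto simp: ext_mon_def mon_def)

lemma ext_monD:
  assumes "h \<in> ext_mon G H"
  shows "h \<in> hom G H" "inj_on h (carrier G)" "h \<in> extensional (carrier G)"
    "h \<in> carrier G \<rightarrow>\<^sub>E carrier H"
  using assms by (auto simp: ext_mon_def mon_def hom_def PiE_def)

text \<open>Extensionality is what makes counting meaningful: otherwise the values off the carrier
  would be free and one monomorphism would be represented by many functions.\<close>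

lemma finite_ext_mon:
  assumes "finite (carrier G)" "finite (carrier H)"
  shows "finite (ext_mon G H)"
  by (rule finite_subset[of _ "carrier G \<rightarrow>\<^sub>E carrier H"])
    (use assms in \<open>auto intro!: finite_PiE dest: ext_monD(4)\<close>)

lemma hom_restrict:
  assumes "h \<in> hom G H" "group G"
  shows "restrict h (carrier G) \<in> hom G H"
  using assms by (auto simp: hom_def group.is_monoid monoid.m_closed)

lemma ext_mon_compose:
  assumes "group G" "k \<in> hom G H" "inj_on k (carrier G)" "h \<in> hom H K" "inj_on h (carrier H)"
  shows "compose (carrier G) h k \<in> ext_mon G K"
proof (rule ext_monI)
  show "compose (carrier G) h k \<in> hom G K"
    using hom_restrict[OF hom_compose[OF assms(2,4)] assms(1)] by (simp add: compose_def o_def)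
  have "k ` carrier G \<subseteq> carrier H" using assms(2) by (auto simp: hom_def)
  thus "inj_on (compose (carrier G) h k) (carrier G)"
    using assms(3,5) by (auto simp: compose_def inj_on_def image_subset_iff)
qed simp

lemma card_ext_mon_iso:
  assumes "group A" "group A'" "A \<cong> A'"
  shows "card (ext_mon A B) = card (ext_mon A' B)"
proof -
  obtain h where h: "h \<in> iso A A'" using assms(3) by (auto simp: is_iso_def)
  define k where "k = inv_into (carrier A) h"
  have k: "k \<in> iso A' A" using group.iso_set_sym[OF assms(1) h] by (simp add: k_def)
  have hb: "h \<in> hom A A'" "inj_on h (carrier A)" "h ` carrier A = carrier A'"
    using h by (auto simp: iso_def bij_betw_def)
  have kb: "k \<in> hom A' A" "inj_on k (carrier A')" "k ` carrier A' = carrier A"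
    using k by (auto simp: iso_def bij_betw_def)
  have kh: "k (h x) = x" if "x \<in> carrier A" for x
    using that hb by (simp add: k_def)
  have hk: "h (k x) = x" if "x \<in> carrier A'" for x
    using that hb by (simp add: k_def f_inv_into_f)
  have "bij_betw (\<lambda>u. compose (carrier A') u k) (ext_mon A B) (ext_mon A' B)"
  proof (rule bij_betwI[where g = "\<lambda>u. compose (carrier A) u h"])
    show "(\<lambda>u. compose (carrier A') u k) \<in> ext_mon A B \<rightarrow> ext_mon A' B"
      using ext_mon_compose[OF assms(2) kb(1,2)] ext_monD by blast
    show "(\<lambda>u. compose (carrier A) u h) \<in> ext_mon A' B \<rightarrow> ext_mon A B"
      using ext_mon_compose[OF assms(1) hb(1,2)] ext_monD by blast
    show "compose (carrier A) (compose (carrier A') u k) h = u" if "u \<in> ext_mon A B" for u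
      using ext_monD(3)[OF that] hb(3) kh
      by (auto simp: compose_def fun_eq_iff extensional_def)
    show "compose (carrier A') (compose (carrier A) u h) k = u" if "u \<in> ext_mon A' B" for u
      using ext_monD(3)[OF that] kb(3) hk
      by (auto simp: compose_def fun_eq_iff extensional_def)
  qed
  thus ?thesis by (rule bij_betw_same_card)
qed

text \<open>Monomorphisms are sorted by their image. Once one isomorphism of \<open>A\<close> onto a
  subgroup \<open>H\<close> is fixed, every monomorphism with image \<open>H\<close> differs from it
  by an automorphism of \<open>A\<close>; as \<open>A\<close> is finite, \<open>ext_mon A A\<close>
  consists of the automorphisms.\<close>

lemma card_ext_mon_eq_subgroups:
  assumes A: "group A" and B: "group B" and fin: "finite (carrier B)" "finite (carrier A)"
  shows "card (ext_mon A B) =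
    card {H. subgroup H B \<and> B\<lparr>carrier := H\<rparr> \<cong> A} * card (ext_mon A A)"
proof -
  define S where "S = {H. subgroup H B \<and> B\<lparr>carrier := H\<rparr> \<cong> A}"
  define T where "T H = {u \<in> ext_mon A B. u ` carrier A = H}" for H
  have finS: "finite S"
    by (rule finite_subset[of _ "Pow (carrier B)"]) (use fin in \<open>auto simp: S_def dest: subgroup.subset\<close>)
  have img: "u ` carrier A \<in> S" if u: "u \<in> ext_mon A B" for u
  proof -
    have h: "u \<in> hom A B" using ext_monD[OF u] by auto
    have sg: "subgroup (u ` carrier A) B"
      using group_hom.img_is_subgroup[of A B u] A B h by (simp add: group_hom_def group_hom_axioms_def)
    have "u \<in> iso A (B\<lparr>carrier := u ` carrier A\<rparr>)"
      using h ext_monD(2)[OF u] by (auto simp: iso_def hom_def bij_betw_def)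
    hence "B\<lparr>carrier := u ` carrier A\<rparr> \<cong> A"
      using A group.iso_sym is_iso_def by blast
    thus ?thesis using sg by (simp add: S_def)
  qed
  have cardT: "card (T H) = card (ext_mon A A)" if H: "H \<in> S" for H
  proof -
    have sg: "subgroup H B" using H by (simp add: S_def)
    define BH where "BH = B\<lparr>carrier := H\<rparr>"
    have gBH: "group BH" using sg B by (simp add: BH_def subgroup.subgroup_is_group)
    have "BH \<cong> A" using H by (simp add: S_def BH_def)
    hence "A \<cong> BH" using gBH group.iso_sym by blast
    then obtain h where h: "h \<in> iso A BH" by (auto simp: is_iso_def)
    have hb: "h \<in> hom A BH" "inj_on h (carrier A)" "h ` carrier A = H"
      using h by (auto simp: iso_def bij_betw_def BH_def)
    have HB: "H \<subseteq> carrier B" using sg by (rule subgroup.subset)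
    have hB: "h \<in> hom A B" using hb(1) HB by (auto simp: hom_def BH_def)
    define k where "k = inv_into (carrier A) h"
    have k: "k \<in> iso BH A" using group.iso_set_sym[OF A h] by (simp add: k_def)
    have kb: "k \<in> hom BH A" "inj_on k H" "k ` H = carrier A"
      using k by (auto simp: iso_def bij_betw_def BH_def)
    have kh: "k (h x) = x" if "x \<in> carrier A" for x
      using that hb by (simp add: k_def)
    have hk: "h (k x) = x" if "x \<in> H" for x
      using that hb by (simp add: k_def f_inv_into_f)
    have "bij_betw (\<lambda>u. compose (carrier A) h u) (ext_mon A A) (T H)"
    proof (rule bij_betwI[where g = "\<lambda>u. compose (carrier A) k u"])
      show "(\<lambda>u. compose (carrier A) h u) \<in> ext_mon A A \<rightarrow> T H"
      proof
        fix u assume u: "u \<in> ext_mon A A"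
        have "u ` carrier A \<subseteq> carrier A" "inj_on u (carrier A)"
          using ext_monD[OF u] by (auto simp: hom_def)
        hence "u ` carrier A = carrier A" using fin(2) by (simp add: endo_inj_surj)
        hence "compose (carrier A) h u ` carrier A = H"
          using hb(3) by (metis compose_def image_restrict_eq image_image)
        thus "compose (carrier A) h u \<in> T H"
          unfolding T_def using ext_mon_compose[OF A ext_monD(1,2)[OF u] hB hb(2)] by simp
      qed
      show "(\<lambda>u. compose (carrier A) k u) \<in> T H \<rightarrow> ext_mon A A"
      proof
        fix u assume u: "u \<in> T H"
        hence "u \<in> hom A BH" "inj_on u (carrier A)"
          using ext_monD[of u A B] by (auto simp: T_def hom_def BH_def)
        thus "compose (carrier A) k u \<in> ext_mon A A"
          using ext_mon_compose[OF A, of u BH k A] kb by (simp add: BH_def)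
      qed
      show "compose (carrier A) k (compose (carrier A) h u) = u" if u: "u \<in> ext_mon A A" for u
        using ext_monD(1,3)[OF u] kh
        by (auto simp: compose_def fun_eq_iff extensional_def hom_def)
      show "compose (carrier A) h (compose (carrier A) k u) = u" if u: "u \<in> T H" for u
        using u ext_monD(1,3)[of u A B] hk
        by (auto simp: T_def compose_def fun_eq_iff extensional_def hom_def)
    qed
    thus ?thesis by (metis bij_betw_same_card)
  qed
  have "ext_mon A B = (\<Union>H\<in>S. T H)" using img by (auto simp: T_def)
  also have "card \<dots> = (\<Sum>H\<in>S. card (T H))"
    by (rule card_UN_disjoint)
      (use finS finite_ext_mon[OF fin(2,1)] in \<open>auto simp: T_def\<close>)
  also have "\<dots> = card S * card (ext_mon A A)" using cardT by simp
  finally show ?thesis by (simp add: S_def)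
qed

section \<open>Extending a monomorphism over a cyclic factor\<close>

definition torsion :: "('a, 'c) monoid_scheme \<Rightarrow> nat \<Rightarrow> 'a set"
  where "torsion G k = {x \<in> carrier G. x [^]\<^bsub>G\<^esub> k = \<one>\<^bsub>G\<^esub>}"

lemma (in group) nat_pow_mod:
  assumes "x \<in> carrier G" "x [^] (N::nat) = \<one>"
  shows "x [^] (k mod N) = x [^] k"
proof -
  have "x [^] k = x [^] (N * (k div N) + k mod N)" by simp
  also have "\<dots> = (x [^] N) [^] (k div N) \<otimes> x [^] (k mod N)"
    using assms(1) by (simp add: nat_pow_mult nat_pow_pow)
  also have "\<dots> = x [^] (k mod N)" using assms by simp
  finally show ?thesis by simp
qed

text \<open>Every nontrivial subgroup of a cyclic group of order \<open>p ^ m\<close> contains its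
  unique subgroup of order \<open>p\<close>: the gcd of \<open>c\<close> and \<open>p ^ m\<close> is
  \<open>p ^ s\<close> with \<open>s < m\<close>, so multiples of \<open>c\<close> reach
  \<open>p ^ s\<close> and then \<open>p ^ (m - 1)\<close>. This is why a test at the last power
  suffices.\<close>

lemma cong_prime_power_multiple:
  fixes c p m :: nat
  assumes "prime p" "0 < c" "c < p ^ m"
  obtains d where "[c * d = p ^ (m - 1)] (mod p ^ m)"
proof -
  obtain s where s: "s \<le> m" "gcd c (p ^ m) = p ^ s"
    using assms(1) divides_primepow_nat[of p "gcd c (p ^ m)" m] by auto
  have "s \<noteq> m"
  proof
    assume "s = m"
    hence "p ^ m dvd c" using s by (metis gcd_dvd1)
    thus False using assms(2,3) by (simp add: nat_dvd_not_less)
  qed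
  hence sm: "s \<le> m - 1" using s by simp
  obtain d where "[c * d = p ^ s] (mod p ^ m)"
    using cong_solve_nat[of c "p ^ m"] s assms(2) by auto
  hence "[c * d * p ^ (m - 1 - s) = p ^ s * p ^ (m - 1 - s)] (mod p ^ m)"
    by (rule cong_mult) simp
  moreover have "p ^ s * p ^ (m - 1 - s) = p ^ (m - 1)"
    using sm s \<open>s \<noteq> m\<close> by (simp flip: power_add)
  ultimately show ?thesis using that[of "d * p ^ (m - 1 - s)"] by (simp add: mult.assoc)
qed

text \<open>A generator of a cyclic factor may go to any element \<open>y\<close> of the right order no nontrivial
  power of which lies in the image of the first factor; it suffices to look at the last such power.\<close>

definition cyclic_extensions ::
    "('a, 'c) monoid_scheme \<Rightarrow> ('b, 'd) monoid_scheme \<Rightarrow> nat \<Rightarrow> nat \<Rightarrow> ('a \<Rightarrow> 'b) \<Rightarrow> 'b set"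
  where "cyclic_extensions A B p m h =
    {y \<in> torsion B (p ^ m). m > 0 \<longrightarrow> y [^]\<^bsub>B\<^esub> (p ^ (m - 1)) \<notin> h ` carrier A}"

text \<open>The elements to be discarded are counted. Put \<open>q = p ^ (m - 1)\<close>. If the
  \<open>q\<close>-th power of \<open>y\<close> is \<open>h a\<close>, then \<open>a\<close> is
  killed by \<open>p\<close>, so by \<open>div\<close> it has a \<open>q\<close>-th root in
  \<open>A\<close>, and \<open>y\<close> is the image of that root times an element killed by
  \<open>q\<close>. Choosing one root for each \<open>a\<close> makes this a bijection with pairs of
  torsion elements. Integers are used because of the difference.\<close>

lemma card_cyclic_extensions:
  assumes A: "comm_group A" and B: "comm_group B" and finB: "finite (carrier B)"
    and h: "h \<in> ext_mon A B"
    and div: "\<And>a. 0 < m \<Longrightarrow> a \<in> torsion A p \<Longrightarrow> \<exists>b\<in>carrier A. a = b [^]\<^bsub>A\<^esub> (p ^ (m - 1))"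
  shows "int (card (cyclic_extensions A B p m h)) =
    (if m = 0 then 1
     else int (card (torsion B (p ^ m))) - int (card (torsion B (p ^ (m - 1)))) * int (card (torsion A p)))"
proof (cases "m = 0")
  case True
  interpret B: comm_group B by (rule B)
  have "cyclic_extensions A B p m h = {\<one>\<^bsub>B\<^esub>}"
    using True by (auto simp: cyclic_extensions_def torsion_def)
  thus ?thesis using True by simp
next
  case False
  interpret A: comm_group A by (rule A)
  interpret B: comm_group B by (rule B)
  interpret h: group_hom A B h
    using ext_monD(1)[OF h] by unfold_locales
  define q where "q = p ^ (m - 1)"
  have pm: "p ^ m = q * p" using False by (cases m) (auto simp: q_def)
  define root where "root a = (SOME b. b \<in> carrier A \<and> a = b [^]\<^bsub>A\<^esub> q)" for a
  have root: "root a \<in> carrier A" "root a [^]\<^bsub>A\<^esub> q = a" if "a \<in> torsion A p" for a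
  proof -
    have "\<exists>b. b \<in> carrier A \<and> a = b [^]\<^bsub>A\<^esub> q" using div[OF _ that] False by (auto simp: q_def)
    from someI_ex[OF this] show "root a \<in> carrier A" "root a [^]\<^bsub>A\<^esub> q = a"
      by (auto simp: root_def)
  qed
  define Bad where "Bad = {y \<in> torsion B (p ^ m). y [^]\<^bsub>B\<^esub> q \<in> h ` carrier A}"
  have inj: "a = a'" if "a \<in> carrier A" "a' \<in> carrier A" "h a = h a'" for a a'
    using ext_monD(2)[OF h] that by (auto simp: inj_on_def)
  have hroot: "h (root a) [^]\<^bsub>B\<^esub> q = h a" if "a \<in> torsion A p" for a
    using root[OF that] by (metis h.hom_nat_pow)
  have hp: "h a [^]\<^bsub>B\<^esub> p = \<one>\<^bsub>B\<^esub>" if "a \<in> torsion A p" for a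
    using that h.hom_nat_pow[of a p] by (auto simp: torsion_def)
  have q1: "y [^]\<^bsub>B\<^esub> q = \<one>\<^bsub>B\<^esub>" "y \<in> carrier B" if "y \<in> torsion B q" for y
    using that by (auto simp: torsion_def)
  have "bij_betw (\<lambda>(a, y). h (root a) \<otimes>\<^bsub>B\<^esub> y) (torsion A p \<times> torsion B q) Bad"
    unfolding bij_betw_def
  proof
    show "inj_on (\<lambda>(a, y). h (root a) \<otimes>\<^bsub>B\<^esub> y) (torsion A p \<times> torsion B q)"
    proof (rule inj_onI, clarify)
      fix a y a' y'
      assume a: "a \<in> torsion A p" "a' \<in> torsion A p" and y: "y \<in> torsion B q" "y' \<in> torsion B q"
        and eq: "h (root a) \<otimes>\<^bsub>B\<^esub> y = h (root a') \<otimes>\<^bsub>B\<^esub> y'"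
      have ac: "a \<in> carrier A" "a' \<in> carrier A" using a by (auto simp: torsion_def)
      have "(h (root a) \<otimes>\<^bsub>B\<^esub> y) [^]\<^bsub>B\<^esub> q = (h (root a') \<otimes>\<^bsub>B\<^esub> y') [^]\<^bsub>B\<^esub> q"
        using eq by simp
      hence "h a = h a'"
        using q1[OF y(1)] q1[OF y(2)] hroot[OF a(1)] hroot[OF a(2)] root(1)[OF a(1)] root(1)[OF a(2)] ac
        by (simp add: B.nat_pow_distrib)
      hence "a = a'" using inj ac by blast
      thus "a = a' \<and> y = y'" using eq root(1)[OF a(1)] q1[OF y(1)] q1[OF y(2)] by simp
    qed
    show "(\<lambda>(a, y). h (root a) \<otimes>\<^bsub>B\<^esub> y) ` (torsion A p \<times> torsion B q) = Bad"
    proof (intro equalityI subsetI)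
      fix z assume "z \<in> (\<lambda>(a, y). h (root a) \<otimes>\<^bsub>B\<^esub> y) ` (torsion A p \<times> torsion B q)"
      then obtain a y where a: "a \<in> torsion A p" and y: "y \<in> torsion B q"
        and z: "z = h (root a) \<otimes>\<^bsub>B\<^esub> y" by auto
      have c: "h (root a) \<in> carrier B" "y \<in> carrier B" "a \<in> carrier A"
        using root(1)[OF a] a q1[OF y] by (auto simp: torsion_def)
      have zq: "z [^]\<^bsub>B\<^esub> q = h a"
        using c q1[OF y] hroot[OF a] by (simp add: z B.nat_pow_distrib)
      hence "z [^]\<^bsub>B\<^esub> (q * p) = \<one>\<^bsub>B\<^esub>"
        using hp[OF a] c by (simp add: z flip: B.nat_pow_pow)
      thus "z \<in> Bad" using zq c by (auto simp: Bad_def torsion_def pm z)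
    next
      fix z assume z: "z \<in> Bad"
      hence zc: "z \<in> carrier B" and z1: "z [^]\<^bsub>B\<^esub> (q * p) = \<one>\<^bsub>B\<^esub>" by (auto simp: Bad_def torsion_def pm)
      obtain a where a: "a \<in> carrier A" "z [^]\<^bsub>B\<^esub> q = h a" using z by (auto simp: Bad_def)
      have "h (a [^]\<^bsub>A\<^esub> p) = h \<one>\<^bsub>A\<^esub>"
        using a z1 zc by (simp add: h.hom_nat_pow flip: B.nat_pow_pow)
      hence aT: "a \<in> torsion A p" using inj[of "a [^]\<^bsub>A\<^esub> p" "\<one>\<^bsub>A\<^esub>"] a by (auto simp: torsion_def)
      define y where "y = inv\<^bsub>B\<^esub> h (root a) \<otimes>\<^bsub>B\<^esub> z"
      have c: "h (root a) \<in> carrier B" using root(1)[OF aT] by simp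
      have "y [^]\<^bsub>B\<^esub> q = inv\<^bsub>B\<^esub> h a \<otimes>\<^bsub>B\<^esub> h a"
        using c zc a hroot[OF aT] by (simp add: y_def B.nat_pow_distrib B.nat_pow_inv)
      hence "y \<in> torsion B q" using c zc a by (simp add: torsion_def y_def)
      moreover have "z = h (root a) \<otimes>\<^bsub>B\<^esub> y"
        using c zc by (simp add: y_def flip: B.m_assoc)
      ultimately show "z \<in> (\<lambda>(a, y). h (root a) \<otimes>\<^bsub>B\<^esub> y) ` (torsion A p \<times> torsion B q)"
        using aT by auto
    qed
  qed
  hence "card Bad = card (torsion A p) * card (torsion B q)"
    by (metis bij_betw_same_card card_cartesian_product)
  moreover have "torsion B (p ^ m) = cyclic_extensions A B p m h \<union> Bad"
    "cyclic_extensions A B p m h \<inter> Bad = {}"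
    using False by (auto simp: cyclic_extensions_def Bad_def q_def)
  moreover have "finite (torsion B (p ^ m))" using finB by (simp add: torsion_def)
  ultimately have "card (torsion B (p ^ m)) = card (cyclic_extensions A B p m h) + card (torsion A p) * card (torsion B q)"
    by (metis card_Un_disjoint finite_Un)
  hence "int (card (torsion B (p ^ m))) = int (card (cyclic_extensions A B p m h)) + int (card (torsion A p)) * int (card (torsion B q))"
    by (metis of_nat_add of_nat_mult)
  thus ?thesis using False by (simp add: q_def)
qed

text \<open>A homomorphism on the product is a pair: its restriction to \<open>A\<close> and the
  image \<open>y\<close> of the generator. It is injective exactly if the restriction is and
  \<open>y\<close> lies in \<open>cyclic_extensions\<close>; the number of such \<open>y\<close> is
  the same for every restriction, so the counts multiply.\<close>

lemma card_ext_mon_DirProd_cyclic: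
  fixes A :: "('a, 'c) monoid_scheme" and B :: "('b, 'd) monoid_scheme"
  assumes A: "comm_group A" and B: "comm_group B" and finA: "finite (carrier A)" and finB: "finite (carrier B)"
    and p: "prime p"
    and div: "\<And>a. 0 < m \<Longrightarrow> a \<in> torsion A p \<Longrightarrow> \<exists>b\<in>carrier A. a = b [^]\<^bsub>A\<^esub> (p ^ (m - 1))"
  shows "int (card (ext_mon (A \<times>\<times> integer_mod_group (p ^ m)) B)) =
    int (card (ext_mon A B)) * (if m = 0 then 1
     else int (card (torsion B (p ^ m))) - int (card (torsion B (p ^ (m - 1)))) * int (card (torsion A p)))"
proof -
  interpret A: comm_group A by (rule A)
  interpret B: comm_group B by (rule B)
  define N where "N = p ^ m"
  define C where "C = integer_mod_group N"
  have Npos: "N > 0" using p by (simp add: N_def prime_gt_0_nat)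
  have carC: "carrier C = {0..<int N}" using Npos by (simp add: C_def carrier_integer_mod_group)
  interpret C: group C by (simp add: C_def)
  interpret AC: group "A \<times>\<times> C" by (rule DirProd_group) unfold_locales
  \<comment> \<open>The generator is written \<open>1 mod int N\<close> because for
    \<open>m = 0\<close> the modulus is 1 and the carrier contains only 0.\<close>
  define F where "F u = (\<lambda>a\<in>carrier A. u (a, 0::int), u (\<one>\<^bsub>A\<^esub>, 1 mod int N))" for u :: "'a \<times> int \<Rightarrow> 'b"
  define G where "G = (\<lambda>(h, y). \<lambda>(a, c)\<in>carrier (A \<times>\<times> C). h a \<otimes>\<^bsub>B\<^esub> y [^]\<^bsub>B\<^esub> nat c)"
  have pow_u: "u (\<one>\<^bsub>A\<^esub>, 1 mod int N) [^]\<^bsub>B\<^esub> k = u (\<one>\<^bsub>A\<^esub>, int k mod int N)"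
    if "u \<in> hom (A \<times>\<times> C) B" for u k
  proof -
    interpret u: group_hom "A \<times>\<times> C" B u using that by unfold_locales
    show ?thesis
    proof (induction k)
      case 0
      show ?case using u.hom_one by (simp add: C_def)
    next
      case (Suc k)
      have "u (\<one>\<^bsub>A\<^esub>, 1 mod int N) [^]\<^bsub>B\<^esub> Suc k = u ((\<one>\<^bsub>A\<^esub>, int k mod int N) \<otimes>\<^bsub>A \<times>\<times> C\<^esub> (\<one>\<^bsub>A\<^esub>, 1 mod int N))"
        using Npos by (subst u.hom_mult) (auto simp: Suc.IH carC)
      also have "(\<one>\<^bsub>A\<^esub>, int k mod int N) \<otimes>\<^bsub>A \<times>\<times> C\<^esub> (\<one>\<^bsub>A\<^esub>, 1 mod int N) = (\<one>\<^bsub>A\<^esub>, int (Suc k) mod int N)"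
        by (simp add: C_def mod_simps add.commute)
      finally show ?case .
    qed
  qed
  have "bij_betw F (ext_mon (A \<times>\<times> C) B) (Sigma (ext_mon A B) (cyclic_extensions A B p m))"
  proof (rule bij_betwI[where g = G])
    show "F \<in> ext_mon (A \<times>\<times> C) B \<rightarrow> Sigma (ext_mon A B) (cyclic_extensions A B p m)"
    proof
      fix u assume u: "u \<in> ext_mon (A \<times>\<times> C) B"
      note uh = ext_monD(1)[OF u]
      interpret u: group_hom "A \<times>\<times> C" B u using uh by unfold_locales
      define h where "h = (\<lambda>a\<in>carrier A. u (a, 0))"
      define y where "y = u (\<one>\<^bsub>A\<^esub>, 1 mod int N)"
      have inj: "z = z'" if "z \<in> carrier (A \<times>\<times> C)" "z' \<in> carrier (A \<times>\<times> C)" "u z = u z'" for z z'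
        using inj_onD[OF ext_monD(2)[OF u]] that by blast
      have zero: "(0::int) \<in> carrier C" using Npos by (simp add: carC)
      have "h \<in> ext_mon A B"
      proof (rule ext_monI)
        show "h \<in> hom A B"
        proof (rule homI)
          fix a b assume ab: "a \<in> carrier A" "b \<in> carrier A"
          have "u ((a, 0) \<otimes>\<^bsub>A \<times>\<times> C\<^esub> (b, 0)) = u (a, 0) \<otimes>\<^bsub>B\<^esub> u (b, 0)"
            using ab zero by (intro u.hom_mult) auto
          thus "h (a \<otimes>\<^bsub>A\<^esub> b) = h a \<otimes>\<^bsub>B\<^esub> h b" using ab by (simp add: h_def C_def)
        qed (use zero u.hom_closed in \<open>simp add: h_def\<close>)
        show "inj_on h (carrier A)"
          using inj zero by (auto simp: inj_on_def h_def)
      qed (simp add: h_def)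
      moreover have "y \<in> cyclic_extensions A B p m h"
      proof -
        have yc: "y \<in> carrier B" using Npos unfolding y_def by (intro u.hom_closed) (simp add: carC)
        have "y [^]\<^bsub>B\<^esub> N = \<one>\<^bsub>B\<^esub>"
          using pow_u[OF uh, of N] u.hom_one by (simp add: y_def C_def)
        moreover have "y [^]\<^bsub>B\<^esub> (p ^ (m - 1)) \<notin> h ` carrier A" if "m > 0"
        proof
          have lt: "p ^ (m - 1) < N" using that prime_gt_1_nat[OF p] by (simp add: N_def power_strict_increasing)
          assume "y [^]\<^bsub>B\<^esub> (p ^ (m - 1)) \<in> h ` carrier A"
          then obtain a where a: "a \<in> carrier A" "u (\<one>\<^bsub>A\<^esub>, int (p ^ (m - 1))) = u (a, 0)"
            using pow_u[OF uh, of "p ^ (m - 1)"] lt by (auto simp: y_def h_def simp del: of_nat_power)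
          hence "int (p ^ (m - 1)) = 0"
            using inj[OF _ _ a(2)] lt zero by (auto simp: carC simp del: of_nat_power)
          thus False using p by (simp add: prime_gt_0_nat)
        qed
        ultimately show ?thesis using yc by (simp add: cyclic_extensions_def torsion_def N_def)
      qed
      ultimately show "F u \<in> Sigma (ext_mon A B) (cyclic_extensions A B p m)"
        by (simp add: F_def h_def y_def)
    qed
    show "G \<in> Sigma (ext_mon A B) (cyclic_extensions A B p m) \<rightarrow> ext_mon (A \<times>\<times> C) B"
    proof clarify
      fix h y assume h: "h \<in> ext_mon A B" and y: "y \<in> cyclic_extensions A B p m h"
      interpret h: group_hom A B h using ext_monD(1)[OF h] by unfold_locales
      have yc: "y \<in> carrier B" and yN: "y [^]\<^bsub>B\<^esub> N = \<one>\<^bsub>B\<^esub>"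
        and yq: "m > 0 \<Longrightarrow> y [^]\<^bsub>B\<^esub> (p ^ (m - 1)) \<notin> h ` carrier A"
        using y by (auto simp: cyclic_extensions_def torsion_def N_def)
      have Ghom: "G (h, y) \<in> hom (A \<times>\<times> C) B"
      proof (rule homI, clarsimp simp: G_def h.hom_closed yc)
        fix z z' assume z: "z \<in> carrier (A \<times>\<times> C)" "z' \<in> carrier (A \<times>\<times> C)"
        obtain a c a' c' where zz: "z = (a, c)" "z' = (a', c')" by (metis surj_pair)
        have c: "a \<in> carrier A" "a' \<in> carrier A" "0 \<le> c" "0 \<le> c'" "c < N" "c' < N"
          using z by (auto simp: zz carC)
        have "nat ((c + c') mod int N) = (nat c + nat c') mod N"
          using c by (simp add: nat_mod_distrib nat_add_distrib)
        hence "y [^]\<^bsub>B\<^esub> nat ((c + c') mod int N) = y [^]\<^bsub>B\<^esub> nat c \<otimes>\<^bsub>B\<^esub> y [^]\<^bsub>B\<^esub> nat c'"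
          using B.nat_pow_mod[OF yc yN] yc by (simp add: B.nat_pow_mult)
        moreover have "(c + c') mod int N \<in> carrier C" using Npos by (simp add: carC)
        ultimately show "G (h, y) (z \<otimes>\<^bsub>A \<times>\<times> C\<^esub> z') = G (h, y) z \<otimes>\<^bsub>B\<^esub> G (h, y) z'"
          using z c yc by (simp add: G_def zz C_def B.m_ac)
      qed
      interpret Gh: group_hom "A \<times>\<times> C" B "G (h, y)" using Ghom by unfold_locales
      have "inj_on (G (h, y)) (carrier (A \<times>\<times> C))"
        unfolding Gh.inj_on_one_iff
      proof (intro allI impI)
        fix z assume z: "z \<in> carrier (A \<times>\<times> C)" "G (h, y) z = \<one>\<^bsub>B\<^esub>"
        obtain a c where zz: "z = (a, c)" by (metis surj_pair)
        have c: "a \<in> carrier A" "0 \<le> c" "c < int N" using z by (auto simp: zz carC)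
        have eq: "h a \<otimes>\<^bsub>B\<^esub> y [^]\<^bsub>B\<^esub> nat c = \<one>\<^bsub>B\<^esub>" using z by (auto simp: G_def zz)
        have c0: "c = 0"
        proof (rule ccontr)
          assume "c \<noteq> 0"
          hence cp: "0 < nat c" "nat c < p ^ m" using c by (simp_all add: nat_less_iff N_def)
          hence m: "m > 0" by (cases m) auto
          \<comment> \<open>A kernel element with \<open>c \<noteq> 0\<close> puts the
            \<open>c\<close>-th power of \<open>y\<close> into the image of \<open>h\<close>; its
            \<open>d\<close>-th power is then the last nontrivial power of \<open>y\<close>, which
            is excluded from the image.\<close>
          obtain d where d: "[nat c * d = p ^ (m - 1)] (mod p ^ m)"
            using cong_prime_power_multiple[OF p cp] .
          have "y [^]\<^bsub>B\<^esub> nat c = inv\<^bsub>B\<^esub> h a" using eq c yc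
            by (metis B.inv_equality B.m_comm B.nat_pow_closed h.hom_closed)
          hence yi: "y [^]\<^bsub>B\<^esub> nat c = h (inv\<^bsub>A\<^esub> a)" using c by simp
          have "y [^]\<^bsub>B\<^esub> (p ^ (m - 1)) = y [^]\<^bsub>B\<^esub> (nat c * d)"
            using B.nat_pow_mod[OF yc yN] d unfolding cong_def N_def by metis
          also have "\<dots> = h ((inv\<^bsub>A\<^esub> a) [^]\<^bsub>A\<^esub> d)"
            using yi yc c by (simp add: h.hom_nat_pow flip: B.nat_pow_pow)
          finally show False using yq[OF m] c by auto
        qed
        hence "h a = h \<one>\<^bsub>A\<^esub>" using eq c by simp
        hence "a = \<one>\<^bsub>A\<^esub>" using ext_monD(2)[OF h] c by (meson A.one_closed inj_onD)
        thus "z = \<one>\<^bsub>A \<times>\<times> C\<^esub>" using c0 by (simp add: zz C_def)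
      qed
      thus "G (h, y) \<in> ext_mon (A \<times>\<times> C) B"
        using Ghom by (intro ext_monI) (auto simp: G_def)
    qed
    show "G (F u) = u" if "u \<in> ext_mon (A \<times>\<times> C) B" for u
    proof
      fix z
      note uh = ext_monD(1)[OF that]
      interpret u: group_hom "A \<times>\<times> C" B u using uh by unfold_locales
      show "G (F u) z = u z"
      proof (cases "z \<in> carrier (A \<times>\<times> C)")
        case True
        obtain a c where zz: "z = (a, c)" by (metis surj_pair)
        have c: "a \<in> carrier A" "0 \<le> c" "c < int N" using True by (auto simp: zz carC)
        have "G (F u) z = u (a, 0) \<otimes>\<^bsub>B\<^esub> u (\<one>\<^bsub>A\<^esub>, c)"
          using True c pow_u[OF uh, of "nat c"] by (simp add: G_def F_def zz)
        also have "\<dots> = u ((a, 0) \<otimes>\<^bsub>A \<times>\<times> C\<^esub> (\<one>\<^bsub>A\<^esub>, c))"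
          using c by (subst u.hom_mult) (auto simp: carC)
        also have "\<dots> = u z" using c by (simp add: zz C_def)
        finally show ?thesis .
      next
        case False
        thus ?thesis using ext_monD(3)[OF that] by (cases z) (auto simp: G_def F_def extensional_def)
      qed
    qed
    show "F (G z) = z" if z: "z \<in> Sigma (ext_mon A B) (cyclic_extensions A B p m)" for z
    proof -
      obtain h y where zz: "z = (h, y)" by (metis surj_pair)
      have h: "h \<in> ext_mon A B" and y: "y \<in> cyclic_extensions A B p m h" using z zz by auto
      interpret h: group_hom A B h using ext_monD(1)[OF h] by unfold_locales
      have yc: "y \<in> carrier B" and yN: "y [^]\<^bsub>B\<^esub> N = \<one>\<^bsub>B\<^esub>"
        using y by (auto simp: cyclic_extensions_def torsion_def N_def)
      have zero: "(0::int) \<in> carrier C" and one: "1 mod int N \<in> carrier C" using Npos by (auto simp: carC)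
      have "nat (1 mod int N) = 1 mod N" by (simp add: nat_mod_distrib)
      hence "y [^]\<^bsub>B\<^esub> nat (1 mod int N) = y"
        using B.nat_pow_mod[OF yc yN, of 1] yc by simp
      thus "F (G z) = z"
        using zero one yc ext_monD(3)[OF h]
        by (auto simp: F_def G_def zz extensional_def fun_eq_iff)
    qed
  qed
  hence "card (ext_mon (A \<times>\<times> C) B) = card (Sigma (ext_mon A B) (cyclic_extensions A B p m))"
    by (rule bij_betw_same_card)
  also have "\<dots> = (\<Sum>h\<in>ext_mon A B. card (cyclic_extensions A B p m h))"
    using finite_ext_mon[OF finA finB] finB
    by (intro card_SigmaI) (auto simp: cyclic_extensions_def torsion_def)
  finally have "int (card (ext_mon (A \<times>\<times> C) B)) = (\<Sum>h\<in>ext_mon A B. int (card (cyclic_extensions A B p m h)))"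
    by simp
  thus ?thesis
    using card_cyclic_extensions[OF A B finB _ div] by (simp add: C_def N_def)
qed

section \<open>The groups \<open>p_group\<close>: torsion and monomorphisms\<close>

lemma comm_group_p_group: "comm_group (p_group p la)"
proof -
  have "group (p_group p la)" by (simp add: p_group_def)
  moreover have "x \<otimes>\<^bsub>p_group p la\<^esub> y = y \<otimes>\<^bsub>p_group p la\<^esub> x" for x y
    by (simp add: p_group_def add.commute)
  ultimately show ?thesis by (simp add: group.group_comm_groupI)
qed

lemma finite_carrier_p_group:
  assumes "p > 0"
  shows "finite (carrier (p_group p la))"
  using assms by (auto simp: p_group_def carrier_integer_mod_group intro!: finite_PiE)

lemma carrier_p_group:
  assumes "p > 0"
  shows "carrier (p_group p la) = (\<Pi>\<^sub>E i\<in>{1..length la}. {0..<int (p ^ (la !\<^sub>1 i))})"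
  using assms by (simp add: p_group_def carrier_integer_mod_group)

lemma one_p_group: "\<one>\<^bsub>p_group p la\<^esub> = (\<lambda>i\<in>{1..length la}. 0)"
  by (simp add: p_group_def)

lemma mult_p_group:
  "x \<otimes>\<^bsub>p_group p la\<^esub> y = (\<lambda>i\<in>{1..length la}. (x i + y i) mod int (p ^ (la !\<^sub>1 i)))"
  by (simp add: p_group_def)

lemma pow_p_group:
  assumes "p > 0" "x \<in> carrier (p_group p la)"
  shows "x [^]\<^bsub>p_group p la\<^esub> (k::nat) = (\<lambda>i\<in>{1..length la}. int k * x i mod int (p ^ (la !\<^sub>1 i)))"
proof (induction k)
  case 0
  show ?case by (simp add: one_p_group)
next
  case (Suc k)
  show ?case
    by (auto simp: Suc mult_p_group fun_eq_iff algebra_simps mod_simps simp del: of_nat_power)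
qed

lemma p_group_snoc:
  assumes "p > 0"
  shows "p_group p (mu @ [m]) \<cong> p_group p mu \<times>\<times> integer_mod_group (p ^ m)"
proof -
  define n where "n = length mu"
  define h where "h x = (restrict x {1..n}, x (Suc n))" for x :: "nat \<Rightarrow> int"
  define h' where "h' z = (\<lambda>i\<in>{1..Suc n}. if i = Suc n then snd z else fst z i)" for z :: "(nat \<Rightarrow> int) \<times> int"
  have cA: "carrier (p_group p (mu @ [m])) = (\<Pi>\<^sub>E i\<in>{1..Suc n}. {0..<int (p ^ (if i = Suc n then m else mu !\<^sub>1 i))})"
    unfolding carrier_p_group[OF assms] length_append_singleton n_def
    by (intro PiE_cong) (auto simp: nth_append simp del: of_nat_power)
  have cB: "carrier (p_group p mu) = (\<Pi>\<^sub>E i\<in>{1..n}. {0..<int (p ^ (mu !\<^sub>1 i))})"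
    using assms by (simp add: carrier_p_group n_def del: of_nat_power)
  have "h \<in> iso (p_group p (mu @ [m])) (p_group p mu \<times>\<times> integer_mod_group (p ^ m))"
    unfolding iso_def
  proof (intro CollectI conjI)
    show "h \<in> hom (p_group p (mu @ [m])) (p_group p mu \<times>\<times> integer_mod_group (p ^ m))"
    proof (rule homI)
      fix x assume x: "x \<in> carrier (p_group p (mu @ [m]))"
      have "x (Suc n) \<in> {0..<int (p ^ m)}"
        using PiE_mem[OF x[unfolded cA], of "Suc n"] by (simp del: of_nat_power)
      moreover have "restrict x {1..n} \<in> carrier (p_group p mu)"
        unfolding cB
      proof (rule restrict_PiE_iff[THEN iffD2], rule ballI)
        fix i assume "i \<in> {1..n}"
        thus "x i \<in> {0..<int (p ^ (mu !\<^sub>1 i))}"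
          using PiE_mem[OF x[unfolded cA], of i] by (simp del: of_nat_power)
      qed
      ultimately show "h x \<in> carrier (p_group p mu \<times>\<times> integer_mod_group (p ^ m))"
        using assms by (simp add: h_def carrier_integer_mod_group del: of_nat_power)
    next
      fix x y
      show "h (x \<otimes>\<^bsub>p_group p (mu @ [m])\<^esub> y) = h x \<otimes>\<^bsub>p_group p mu \<times>\<times> integer_mod_group (p ^ m)\<^esub> h y"
        by (auto simp: h_def mult_p_group n_def nth_append fun_eq_iff simp del: of_nat_power)
    qed
    show "bij_betw h (carrier (p_group p (mu @ [m]))) (carrier (p_group p mu \<times>\<times> integer_mod_group (p ^ m)))"
    proof (rule bij_betwI[where g = h'])
      show "h \<in> carrier (p_group p (mu @ [m])) \<rightarrow> carrier (p_group p mu \<times>\<times> integer_mod_group (p ^ m))"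
        using \<open>h \<in> hom _ _\<close> by (auto simp: hom_def)
      show "h' \<in> carrier (p_group p mu \<times>\<times> integer_mod_group (p ^ m)) \<rightarrow> carrier (p_group p (mu @ [m]))"
      proof
        fix z assume "z \<in> carrier (p_group p mu \<times>\<times> integer_mod_group (p ^ m))"
        hence z: "fst z \<in> (\<Pi>\<^sub>E i\<in>{1..n}. {0..<int (p ^ (mu !\<^sub>1 i))})" "snd z \<in> {0..<int (p ^ m)}"
          using assms by (auto simp: cB carrier_integer_mod_group simp del: of_nat_power)
        show "h' z \<in> carrier (p_group p (mu @ [m]))"
          unfolding cA h'_def
        proof (rule restrict_PiE_iff[THEN iffD2], rule ballI)
          fix i assume "i \<in> {1..Suc n}"
          thus "(if i = Suc n then snd z else fst z i) \<in> {0..<int (p ^ (if i = Suc n then m else mu !\<^sub>1 i))}"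
            using z PiE_mem[OF z(1), of i] by (simp del: of_nat_power)
        qed
      qed
      show "h' (h x) = x" if "x \<in> carrier (p_group p (mu @ [m]))" for x
        using that unfolding cA by (auto simp: h_def h'_def fun_eq_iff PiE_iff extensional_def simp del: of_nat_power)
      show "h (h' z) = z" if "z \<in> carrier (p_group p mu \<times>\<times> integer_mod_group (p ^ m))" for z
        using that by (auto simp: cB h_def h'_def fun_eq_iff PiE_iff extensional_def simp del: of_nat_power intro!: prod_eqI)
    qed
  qed
  thus ?thesis by (auto simp: is_iso_def)
qed

lemma kernel_mult_mod:
  fixes R q :: int
  assumes "R > 0" "q > 0"
  shows "{c \<in> {0..<R * q}. R * c mod (R * q) = 0} = (\<lambda>c. q * c) ` {0..<R}"
proof (intro equalityI subsetI)
  fix c assume "c \<in> {c \<in> {0..<R * q}. R * c mod (R * q) = 0}"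
  hence c: "0 \<le> c" "c < R * q" "R * q dvd R * c" by (auto simp: mod_eq_0_iff_dvd)
  have "q dvd c" using c(3) assms by (metis dvd_mult_cancel_left less_irrefl)
  then obtain d where d: "c = q * d" by blast
  have "q * 0 \<le> q * d" "q * d < q * R" using c(1,2) by (simp_all add: d mult.commute)
  hence "0 \<le> d" "d < R" using assms(2) by (metis mult_le_cancel_left_pos, metis mult_less_cancel_left_pos)
  thus "c \<in> (\<lambda>c. q * c) ` {0..<R}" using d by auto
next
  fix c assume "c \<in> (\<lambda>c. q * c) ` {0..<R}"
  then obtain d where d0: "c = q * d" "d \<in> {0..<R}" by (rule imageE)
  hence d: "c = q * d" "0 \<le> d" "d < R" by simp_all
  have "q * d < q * R" using d assms(2) by (intro mult_strict_left_mono)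
  hence "c < R * q" by (simp add: d mult.commute)
  moreover have "R * q dvd R * (q * d)" by (intro mult_dvd_mono) simp_all
  ultimately show "c \<in> {c \<in> {0..<R * q}. R * c mod (R * q) = 0}"
    using d assms by (simp add: mod_eq_0_iff_dvd)
qed

lemma card_mod_torsion:
  assumes "p > 0"
  shows "card {c \<in> {0..<int (p ^ a)}. int (p ^ m) * c mod int (p ^ a) = 0} = p ^ min m a"
proof (cases "a \<le> m")
  case True
  hence "int (p ^ a) dvd int (p ^ m)" by (simp add: le_imp_power_dvd)
  hence "{c \<in> {0..<int (p ^ a)}. int (p ^ m) * c mod int (p ^ a) = 0} = {0..<int (p ^ a)}"
    by (auto simp: mod_eq_0_iff_dvd)
  thus ?thesis using True by (simp add: min_absorb2 del: of_nat_power)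
next
  case False
  define q where "q = int (p ^ (a - m))"
  have q: "q > 0" using assms by (simp add: q_def)
  have pa: "int (p ^ a) = int (p ^ m) * q" using False by (simp add: q_def flip: of_nat_mult power_add)
  have "inj_on (\<lambda>c. q * c) {0..<int (p ^ m)}" using q by (auto simp: inj_on_def)
  hence "card ((\<lambda>c. q * c) ` {0..<int (p ^ m)}) = p ^ m" by (simp add: card_image del: of_nat_power)
  moreover have "int (p ^ m) > 0" using assms by simp
  ultimately show ?thesis using False unfolding pa kernel_mult_mod[OF \<open>int (p ^ m) > 0\<close> q] by simp
qed

lemma card_torsion_p_group:
  assumes "p > 0"
  shows "card (torsion (p_group p la) (p ^ m)) = p ^ sum_list (map (min m) la)"
proof -
  define T where "T i = {c \<in> {0..<int (p ^ (la !\<^sub>1 i))}. int (p ^ m) * c mod int (p ^ (la !\<^sub>1 i)) = 0}" for i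
  have "torsion (p_group p la) (p ^ m) = (\<Pi>\<^sub>E i\<in>{1..length la}. T i)"
  proof (intro equalityI subsetI)
    fix x assume "x \<in> torsion (p_group p la) (p ^ m)"
    hence x: "x \<in> carrier (p_group p la)" "x [^]\<^bsub>p_group p la\<^esub> (p ^ m) = \<one>\<^bsub>p_group p la\<^esub>"
      by (auto simp: torsion_def)
    have "int (p ^ m) * x i mod int (p ^ (la !\<^sub>1 i)) = 0" if "i \<in> {1..length la}" for i
      using fun_cong[OF x(2), of i] pow_p_group[OF assms x(1), of "p ^ m"] that
      by (simp add: one_p_group del: of_nat_power)
    thus "x \<in> (\<Pi>\<^sub>E i\<in>{1..length la}. T i)"
      using x(1) by (auto simp: carrier_p_group[OF assms] T_def PiE_iff simp del: of_nat_power)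
  next
    fix x assume x: "x \<in> (\<Pi>\<^sub>E i\<in>{1..length la}. T i)"
    hence xc: "x \<in> carrier (p_group p la)"
      by (auto simp: carrier_p_group[OF assms] T_def PiE_iff simp del: of_nat_power)
    have "x [^]\<^bsub>p_group p la\<^esub> (p ^ m) = \<one>\<^bsub>p_group p la\<^esub>"
      using x unfolding pow_p_group[OF assms xc] one_p_group
      by (intro restrict_ext) (auto simp: T_def PiE_iff simp del: of_nat_power)
    thus "x \<in> torsion (p_group p la) (p ^ m)" using xc by (simp add: torsion_def)
  qed
  hence "card (torsion (p_group p la) (p ^ m)) = (\<Prod>i=1..length la. card (T i))"
    by (simp add: card_PiE)
  also have "\<dots> = (\<Prod>i=1..length la. p ^ min m (la !\<^sub>1 i))"
    unfolding T_def card_mod_torsion[OF assms] ..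
  also have "\<dots> = (\<Prod>i<length la. p ^ min m (la ! i))"
    by (rule prod.reindex_bij_witness[of _ Suc "\<lambda>i. i - 1"]) auto
  also have "\<dots> = p ^ (\<Sum>i<length la. min m (la ! i))" by (simp add: power_sum)
  also have "(\<Sum>i<length la. min m (la ! i)) = sum_list (map (min m) la)"
    by (simp add: sum_list_sum_nth atLeast0LessThan)
  finally show ?thesis .
qed

text \<open>In the cyclic factor of order \<open>p ^ x\<close> the elements killed by
  \<open>p\<close> are the multiples of \<open>p ^ (x - 1)\<close>, and \<open>m \<le> x\<close>
  makes these divisible by \<open>p ^ (m - 1)\<close>. This supplies the root hypothesis of the
  counting step and is the reason for adjoining the smallest part last.\<close>

lemma p_group_torsion_divisible:
  assumes "p > 0" "0 < m" "\<forall>x\<in>set mu. m \<le> x" "a \<in> torsion (p_group p mu) p"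
  shows "\<exists>b\<in>carrier (p_group p mu). a = b [^]\<^bsub>p_group p mu\<^esub> (p ^ (m - 1))"
proof -
  have ac: "a \<in> carrier (p_group p mu)" and a1: "a [^]\<^bsub>p_group p mu\<^esub> p = \<one>\<^bsub>p_group p mu\<^esub>"
    using assms(4) by (auto simp: torsion_def)
  define b where "b = (\<lambda>i\<in>{1..length mu}. a i div int (p ^ (m - 1)))"
  have aux: "int (p ^ (m - 1)) dvd a i \<and> 0 \<le> a i \<and> a i < int (p ^ (mu !\<^sub>1 i))" if i: "i \<in> {1..length mu}" for i
  proof -
    have "mu ! (i - 1) \<in> set mu" using i by (intro nth_mem) auto
    hence mi: "m \<le> mu ! (i - 1)" using assms(3) by blast
    have "int p * a i mod int (p ^ (mu !\<^sub>1 i)) = 0"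
      using fun_cong[OF a1, of i] pow_p_group[OF assms(1) ac, of p] i
      by (simp add: one_p_group del: of_nat_power)
    moreover have "int p * int (p ^ (m - 1)) = int (p ^ m)"
      using assms(2) by (cases m) simp_all
    moreover have "int (p ^ m) dvd int (p ^ (mu !\<^sub>1 i))" using mi by (simp add: le_imp_power_dvd)
    ultimately have "int p * int (p ^ (m - 1)) dvd int p * a i"
      by (metis mod_eq_0_iff_dvd dvd_trans)
    hence "int (p ^ (m - 1)) dvd a i" using assms(1) by (simp del: of_nat_power)
    moreover have "a i \<in> {0..<int (p ^ (mu !\<^sub>1 i))}"
      using PiE_mem[OF ac[unfolded carrier_p_group[OF assms(1)]] i] .
    ultimately show ?thesis by simp
  qed
  have bc: "b \<in> carrier (p_group p mu)"
    unfolding carrier_p_group[OF assms(1)] b_def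
  proof (rule restrict_PiE_iff[THEN iffD2], rule ballI)
    fix i assume i: "i \<in> {1..length mu}"
    have "a i div int (p ^ (m - 1)) \<le> a i div 1"
      using aux[OF i] assms(1) by (intro zdiv_mono2) auto
    hence "a i div int (p ^ (m - 1)) \<le> a i" by simp
    thus "a i div int (p ^ (m - 1)) \<in> {0..<int (p ^ (mu !\<^sub>1 i))}"
      using aux[OF i] assms(1) by (simp add: pos_imp_zdiv_nonneg_iff)
  qed
  have "a = b [^]\<^bsub>p_group p mu\<^esub> (p ^ (m - 1))"
  proof
    fix i
    show "a i = (b [^]\<^bsub>p_group p mu\<^esub> (p ^ (m - 1))) i"
    proof (cases "i \<in> {1..length mu}")
      case True
      thus ?thesis using aux[OF True]
        unfolding pow_p_group[OF assms(1) bc] by (simp add: b_def del: of_nat_power)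
    next
      case False
      thus ?thesis using ac
        by (auto simp: pow_p_group[OF assms(1) bc] carrier_p_group[OF assms(1)] PiE_iff extensional_def)
    qed
  qed
  thus ?thesis using bc by blast
qed

text \<open>The parts are adjoined in descending order, hence the induction from the right. When the
  \<open>k\<close>-th part (counted from 0) is adjoined and is positive, the earlier factors have
  exactly \<open>p ^ k\<close> elements killed by \<open>p\<close>; a zero part adds a trivial
  factor.\<close>

lemma card_ext_mon_p_group:
  assumes p: "prime p" and B: "comm_group B" and finB: "finite (carrier B)"
    and "sorted_wrt (\<ge>) mu"
  shows "int (card (ext_mon (p_group p mu) B)) =
    (\<Prod>k<length mu. if mu ! k = 0 then 1
       else int (card (torsion B (p ^ (mu ! k)))) - int (card (torsion B (p ^ (mu ! k - 1)))) * int p ^ k)"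
  using assms(4)
proof (induction mu rule: rev_induct)
  case Nil
  interpret B: comm_group B by (rule B)
  have c: "carrier (p_group p []) = {\<lambda>_. undefined}" by (simp add: p_group_def)
  have "ext_mon (p_group p []) B = {\<lambda>x\<in>carrier (p_group p []). \<one>\<^bsub>B\<^esub>}"
  proof (intro equalityI subsetI)
    fix h assume h: "h \<in> ext_mon (p_group p []) B"
    interpret h: group_hom "p_group p []" B h
      using ext_monD(1)[OF h] comm_group_p_group by (simp add: group_hom_def group_hom_axioms_def comm_group_def B.group_axioms)
    have "h \<one>\<^bsub>p_group p []\<^esub> = \<one>\<^bsub>B\<^esub>" by (rule h.hom_one)
    hence "h (\<lambda>_. undefined) = \<one>\<^bsub>B\<^esub>" by (simp add: one_p_group restrict_def)
    thus "h \<in> {\<lambda>x\<in>carrier (p_group p []). \<one>\<^bsub>B\<^esub>}"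
      using ext_monD(3)[OF h] unfolding c by (auto simp: extensional_def restrict_def)
  next
    fix h assume "h \<in> {\<lambda>x\<in>carrier (p_group p []). \<one>\<^bsub>B\<^esub>}"
    hence h: "h = (\<lambda>x\<in>{\<lambda>_. undefined}. \<one>\<^bsub>B\<^esub>)" by (simp add: c)
    show "h \<in> ext_mon (p_group p []) B"
      unfolding h
    proof (rule ext_monI)
      show "(\<lambda>x\<in>{\<lambda>_. undefined}. \<one>\<^bsub>B\<^esub>) \<in> extensional (carrier (p_group p []))"
        unfolding c by (rule restrict_extensional)
    qed (simp_all add: c hom_def mult_p_group restrict_def)
  qed
  thus ?case by simp
next
  case (snoc m mu)
  have p0: "p > 0" using p by (simp add: prime_gt_0_nat)
  have mu: "sorted_wrt (\<ge>) mu" "\<forall>x\<in>set mu. m \<le> x"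
    using snoc.prems by (auto simp: sorted_wrt_append)
  \<comment> \<open>All earlier parts are at least \<open>m\<close>, hence positive, so each earlier
    cyclic factor contains exactly \<open>p\<close> elements killed by \<open>p\<close>.\<close>
  have tor: "int (card (torsion (p_group p mu) p)) = int p ^ length mu" if "m \<noteq> 0"
  proof -
    have "sum_list (map (min 1) mu) = length mu"
      using mu(2) that by (induction mu) (auto simp: min_def)
    thus ?thesis using card_torsion_p_group[OF p0, of mu 1] by simp
  qed
  have "card (ext_mon (p_group p (mu @ [m])) B) = card (ext_mon (p_group p mu \<times>\<times> integer_mod_group (p ^ m)) B)"
    by (rule card_ext_mon_iso[OF _ _ p_group_snoc[OF p0]])
      (use comm_group_p_group in \<open>auto simp: comm_group_def intro!: DirProd_group\<close>)
  also have "int \<dots> = int (card (ext_mon (p_group p mu) B)) * (if m = 0 then 1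
     else int (card (torsion B (p ^ m))) - int (card (torsion B (p ^ (m - 1)))) * int (card (torsion (p_group p mu) p)))"
    using p_group_torsion_divisible[OF p0 _ mu(2)]
    by (intro card_ext_mon_DirProd_cyclic[OF comm_group_p_group B finite_carrier_p_group[OF p0] finB p]) auto
  also have "\<dots> = (\<Prod>k<length (mu @ [m]). if (mu @ [m]) ! k = 0 then 1
       else int (card (torsion B (p ^ ((mu @ [m]) ! k)))) - int (card (torsion B (p ^ ((mu @ [m]) ! k - 1)))) * int p ^ k)"
  proof -
    have "(\<Prod>k<length mu. if (mu @ [m]) ! k = 0 then 1
        else int (card (torsion B (p ^ ((mu @ [m]) ! k)))) - int (card (torsion B (p ^ ((mu @ [m]) ! k - 1)))) * int p ^ k)
      = int (card (ext_mon (p_group p mu) B))"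
      unfolding snoc.IH[OF mu(1)] by (intro prod.cong) (simp_all add: nth_append)
    thus ?thesis using tor by simp
  qed
  finally show ?case .
qed

section \<open>The number of subgroups of a given type\<close>

text \<open>For \<open>j \<ge> 1\<close> this is the \<open>j\<close>-th part of the conjugate
  partition; for \<open>j = 0\<close> it is the length, zero parts included.\<close>

definition count_ge :: "nat list \<Rightarrow> nat \<Rightarrow> nat"
  where "count_ge xs j = length (filter (\<lambda>x. j \<le> x) xs)"

lemma sum_list_min_Suc:
  "sum_list (map (min (Suc m)) xs) = sum_list (map (min m) xs) + count_ge xs (Suc m)"
  by (induction xs) (auto simp: count_ge_def min_def)

text \<open>The count is the number of monomorphisms into the ambient group divided by the number of
  automorphisms of the subgroup. From each factor of either number the order of the torsion subgroup
  is split off; what remains is 1 minus a power of \<open>1 / p\<close> whose exponent compares a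
  conjugate part with the position. Hypothesis \<open>le\<close> says that \<open>mu\<close> lies
  below \<open>la\<close>.\<close>

lemma num_subgroups_eq:
  assumes p: "prime p" and mu: "sorted_wrt (\<ge>) mu"
    and le: "\<And>k. k < length mu \<Longrightarrow> k < count_ge la (mu ! k)"
    and len: "length la = length mu"
  shows "(of_nat (num_subgroups la mu p) :: rat) =
    (\<Prod>k<length mu. of_nat p ^ sum_list (map (min (mu ! k)) la) / of_nat p ^ sum_list (map (min (mu ! k)) mu)) *
    (\<Prod>k<length mu. (1 - (1 / of_nat p) ^ (count_ge la (mu ! k) - k)) / (1 - (1 / of_nat p) ^ (count_ge mu (mu ! k) - k)))"
proof -
  have p0: "p > 0" and p1: "p > 1" using prime_gt_0_nat[OF p] prime_gt_1_nat[OF p] by auto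
  define P where "P = (of_nat p :: rat)"
  have P: "P > 1" using p1 by (simp add: P_def)
  have lemu: "k < count_ge mu (mu ! k)" if "k < length mu" for k
  proof -
    have "{..k} \<subseteq> {i. i < length mu \<and> mu ! k \<le> mu ! i}"
    proof clarsimp
      fix i assume "i \<le> k"
      thus "i < length mu \<and> mu ! k \<le> mu ! i"
        using that mu by (cases "i = k") (auto simp: sorted_wrt_iff_nth_less)
    qed
    hence "card {..k} \<le> card {i. i < length mu \<and> mu ! k \<le> mu ! i}" by (rule card_mono[rotated]) auto
    thus ?thesis by (simp add: count_ge_def length_filter_conv_card)
  qed
  have factor: "(if m = 0 then 1 else P ^ sum_list (map (min m) xs) - P ^ sum_list (map (min (m - 1)) xs) * P ^ k)
      = P ^ sum_list (map (min m) xs) * (if m = 0 then 1 else 1 - (1 / P) ^ (count_ge xs m - k))"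
    if "k < count_ge xs m" for xs m k
  proof (cases m)
    case 0
    have "sum_list (map (min m) xs) = 0" unfolding 0 by (induction xs) auto
    thus ?thesis by (simp only: 0) simp
  next
    case (Suc m')
    have "P ^ sum_list (map (min m) xs) * (1 / P) ^ (count_ge xs m - k) = P ^ sum_list (map (min m') xs) * P ^ k"
      using that P unfolding Suc sum_list_min_Suc
      by (simp add: power_add power_one_over power_diff field_simps)
    thus ?thesis using Suc by (simp add: right_diff_distrib)
  qed
  have mon: "of_nat (card (ext_mon (p_group p mu) (p_group p xs))) =
      (\<Prod>k<length mu. P ^ sum_list (map (min (mu ! k)) xs)) *
      (\<Prod>k<length mu. if mu ! k = 0 then 1 else 1 - (1 / P) ^ (count_ge xs (mu ! k) - k))"
    if "\<And>k. k < length mu \<Longrightarrow> k < count_ge xs (mu ! k)" for xs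
  proof -
    have "(of_nat (card (ext_mon (p_group p mu) (p_group p xs))) :: rat) =
      of_int (\<Prod>k<length mu. if mu ! k = 0 then 1
       else int (card (torsion (p_group p xs) (p ^ (mu ! k)))) - int (card (torsion (p_group p xs) (p ^ (mu ! k - 1)))) * int p ^ k)"
      by (subst card_ext_mon_p_group[OF p comm_group_p_group finite_carrier_p_group[OF p0] mu, symmetric]) simp
    also have "\<dots> = (\<Prod>k<length mu. if mu ! k = 0 then 1
        else P ^ sum_list (map (min (mu ! k)) xs) - P ^ sum_list (map (min (mu ! k - 1)) xs) * P ^ k)"
      unfolding of_int_prod card_torsion_p_group[OF p0] by (intro prod.cong) (auto simp: P_def)
    also have "\<dots> = (\<Prod>k<length mu. P ^ sum_list (map (min (mu ! k)) xs) *
        (if mu ! k = 0 then 1 else 1 - (1 / P) ^ (count_ge xs (mu ! k) - k)))"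
      by (intro prod.cong) (use factor that in auto)
    finally show ?thesis by (simp add: prod.distrib)
  qed
  define q where "q xs k = (if mu ! k = 0 then 1 else 1 - (1 / P) ^ (count_ge xs (mu ! k) - k))" for xs k
  have lt1: "(1 / P) ^ j < 1" if "j > 0" for j
    using P that by (simp add: power_one_over)
  have nz: "q mu k \<noteq> 0" if "k < length mu" for k
    using lemu[OF that] lt1[of "count_ge mu (mu ! k) - k"] by (auto simp: q_def)
  have "of_nat (num_subgroups la mu p) * ((\<Prod>k<length mu. P ^ sum_list (map (min (mu ! k)) mu)) * prod (q mu) {..<length mu})
      = (\<Prod>k<length mu. P ^ sum_list (map (min (mu ! k)) la)) * prod (q la) {..<length mu}"
  proof -
    have "card (ext_mon (p_group p mu) (p_group p la)) = num_subgroups la mu p * card (ext_mon (p_group p mu) (p_group p mu))"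
      unfolding num_subgroups_def
      by (intro card_ext_mon_eq_subgroups finite_carrier_p_group[OF p0])
        (use comm_group_p_group in \<open>auto simp: comm_group_def\<close>)
    hence "rat_of_nat (card (ext_mon (p_group p mu) (p_group p la))) =
        of_nat (num_subgroups la mu p) * of_nat (card (ext_mon (p_group p mu) (p_group p mu)))"
      by (simp flip: of_nat_mult)
    moreover note mon[of la] mon[of mu]
    ultimately show ?thesis using le lemu unfolding q_def by simp
  qed
  moreover have "(\<Prod>k<length mu. P ^ sum_list (map (min (mu ! k)) mu)) \<noteq> 0" "prod (q mu) {..<length mu} \<noteq> 0"
    using P nz by (simp_all add: prod_zero_iff)
  ultimately have "of_nat (num_subgroups la mu p) =
    (\<Prod>k<length mu. P ^ sum_list (map (min (mu ! k)) la)) * prod (q la) {..<length mu} /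
    ((\<Prod>k<length mu. P ^ sum_list (map (min (mu ! k)) mu)) * prod (q mu) {..<length mu})"
    by (intro eq_divide_imp) auto
  also have "\<dots> = (\<Prod>k<length mu. P ^ sum_list (map (min (mu ! k)) la) / P ^ sum_list (map (min (mu ! k)) mu)) *
      (\<Prod>k<length mu. q la k / q mu k)"
    by (simp add: prod_dividef)
  also have "(\<Prod>k<length mu. q la k / q mu k) =
    (\<Prod>k<length mu. (1 - (1 / P) ^ (count_ge la (mu ! k) - k)) / (1 - (1 / P) ^ (count_ge mu (mu ! k) - k)))"
  proof (intro prod.cong refl)
    fix k assume "k \<in> {..<length mu}"
    hence "k < length mu" by simp
    \<comment> \<open>At a zero part both counts equal the common length, so the uniform quotient is
      1, in agreement with the value of \<open>q\<close> there.\<close>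
    moreover have "count_ge xs 0 = length xs" for xs by (simp add: count_ge_def)
    moreover have "(1 / P) ^ (length mu - k) < 1" if "k < length mu" using lt1 that by simp
    ultimately show "q la k / q mu k = (1 - (1 / P) ^ (count_ge la (mu ! k) - k)) / (1 - (1 / P) ^ (count_ge mu (mu ! k) - k))"
      using len by (auto simp: q_def)
  qed
  finally show ?thesis by (simp add: P_def)
qed

section \<open>Block decompositions of Dyck words\<close>

text \<open>A normal form for words ending in \<open>LOne\<close>: the list of numbers of zeros
  directly before each one. It is determined by the word, whereas two block decompositions may a
  priori have different numbers of blocks.\<close>

definition gap_word :: "nat list \<Rightarrow> letter list"
  where "gap_word ds = concat (map (\<lambda>d. replicate d LZero @ [LOne]) ds)"

lemma replicate_LZero_LOne_inject:
  "replicate d LZero @ LOne # w = replicate d' LZero @ LOne # w' \<Longrightarrow> d = d' \<and> w = w'"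
proof (induction d arbitrary: d')
  case 0
  thus ?case by (cases d') auto
next
  case (Suc d)
  thus ?case by (cases d') auto
qed

lemma gap_word_inject:
  "gap_word ds = gap_word ds' \<Longrightarrow> ds = ds'"
proof (induction ds arbitrary: ds')
  case Nil
  thus ?case by (cases ds') (auto simp: gap_word_def)
next
  case (Cons d ds)
  then obtain d' es where ds': "ds' = d' # es" by (cases ds') (auto simp: gap_word_def)
  have "replicate d LZero @ LOne # gap_word ds = replicate d' LZero @ LOne # gap_word es"
    using Cons.prems by (simp add: ds' gap_word_def)
  from replicate_LZero_LOne_inject[OF this] show ?case using Cons.IH by (simp add: ds')
qed

lemma gap_word_append: "gap_word (xs @ ys) = gap_word xs @ gap_word ys"
  by (simp add: gap_word_def)

lemma gap_word_replicate_0: "gap_word (replicate m 0) = replicate m LOne"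
  by (induction m) (auto simp: gap_word_def)

lemma cuts_le:
  assumes "cuts n r L" "i \<le> j" "j \<le> r"
  shows "L i \<le> L j"
  using assms(2,3)
proof (induction j rule: dec_induct)
  case (step m)
  have "Suc m \<in> {1..r}" using step by simp
  hence "L (Suc m - 1) < L (Suc m)" using assms(1) unfolding cuts_def by blast
  thus ?case using step by simp
qed simp

lemma cuts_less:
  assumes "cuts n r L" "i < j" "j \<le> r"
  shows "L i < L j"
proof -
  have "L (j - 1) < L j" using assms by (auto simp: cuts_def)
  moreover have "i \<le> j - 1" "j - 1 \<le> r" using assms by auto
  hence "L i \<le> L (j - 1)" by (rule cuts_le[OF assms(1)])
  ultimately show ?thesis by simp
qed

lemma cuts_le_n: "cuts n r L \<Longrightarrow> i \<le> r \<Longrightarrow> L i \<le> n"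
  using cuts_le[of n r L i r] by (simp add: cuts_def)

lemma cuts_block_exists:
  assumes "cuts n r M" "1 \<le> k" "k \<le> n"
  obtains i where "i \<in> {1..r}" "M (i - 1) < k" "k \<le> M i"
proof -
  define i where "i = (LEAST i. k \<le> M i)"
  have ex: "k \<le> M r" using assms by (simp add: cuts_def)
  have 1: "k \<le> M i" unfolding i_def by (rule LeastI[of "\<lambda>i. k \<le> M i", OF ex])
  have 2: "i \<le> r" unfolding i_def by (rule Least_le[of "\<lambda>i. k \<le> M i", OF ex])
  have 3: "i \<noteq> 0"
  proof
    assume "i = 0"
    thus False using 1 assms by (simp add: cuts_def)
  qed
  hence "i - 1 < i" by simp
  hence "\<not> k \<le> M (i - 1)" unfolding i_def by (rule not_less_Least)
  thus ?thesis using that[of i] 1 2 3 by simp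
qed

text \<open>The number of zeros before the \<open>k\<close>-th one of \<open>block_word\<close>, for
  \<open>k \<ge> 1\<close>. The least index finds the block containing that one; at
  \<open>k = 0\<close> it returns \<open>L 0\<close>.\<close>

definition block_height :: "(nat \<Rightarrow> nat) \<Rightarrow> (nat \<Rightarrow> nat) \<Rightarrow> nat \<Rightarrow> nat"
  where "block_height L M k = L (LEAST i. k \<le> M i)"

lemma block_height_0: "L 0 = 0 \<Longrightarrow> block_height L M 0 = 0"
  by (simp add: block_height_def)

lemma block_height_eq:
  assumes "cuts n r M" "i \<in> {1..r}" "M (i - 1) < k" "k \<le> M i"
  shows "block_height L M k = L i"
proof -
  have "(LEAST i. k \<le> M i) = i"
  proof (rule Least_equality)
    fix j assume "k \<le> M j"
    show "i \<le> j"
    proof (rule ccontr)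
      assume "\<not> i \<le> j"
      hence "M j \<le> M (i - 1)" using assms by (intro cuts_le[OF assms(1)]) auto
      thus False using assms(3) \<open>k \<le> M j\<close> by simp
    qed
  qed (use assms in simp)
  thus ?thesis by (simp add: block_height_def)
qed

lemma upt_split: "i \<le> j \<Longrightarrow> j \<le> k \<Longrightarrow> [i..<k] = [i..<j] @ [j..<k]"
  using upt_add_eq_append[of i j "k - j"] by simp

lemma block_word_Suc:
  "block_word (Suc r) L M = block_word r L M @ replicate (L (Suc r) - L r) LZero @ replicate (M (Suc r) - M r) LOne"
  by (simp add: block_word_def)

text \<open>\<open>k j\<close> is the number of letters \<open>LZero\<close> before the \<open>j\<close>-th letter \<open>LOne\<close>.\<close>

lemma block_word_eq_gap_word:
  assumes L: "cuts n r L" and M: "cuts n r M" and k0: "k 0 = 0"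
    and k: "\<And>i j. i \<in> {1..r} \<Longrightarrow> M (i - 1) < j \<Longrightarrow> j \<le> M i \<Longrightarrow> k j = L i"
  shows "block_word r L M = gap_word (map (\<lambda>j. k j - k (j - 1)) [1..<n + 1])"
proof -
  have M0: "M 0 = 0" and L0: "L 0 = 0" using L M by (auto simp: cuts_def)
  have "block_word i L M = gap_word (map (\<lambda>j. k j - k (j - 1)) [1..<M i + 1])" if "i \<le> r" for i
    using that
  proof (induction i)
    case 0
    show ?case by (simp add: block_word_def gap_word_def M0)
  next
    case (Suc i)
    have lt: "M i < M (Suc i)" using cuts_less[OF M, of i "Suc i"] Suc.prems by simp
    have kM: "k (M i) = L i"
    proof (cases "i = 0")
      case False
      hence "M (i - 1) < M i" using cuts_less[OF M, of "i - 1" i] Suc.prems by simp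
      thus ?thesis using k[of i "M i"] False Suc.prems by simp
    qed (simp add: M0 L0 k0)
    have kS: "k j = L (Suc i)" if "M i < j" "j \<le> M (Suc i)" for j
      using k[of "Suc i" j] that Suc.prems by simp
    have e1: "[1..<M (Suc i) + 1] = [1..<M i + 1] @ (M i + 1) # [M i + 2..<M (Suc i) + 1]"
      using lt upt_split[of 1 "M i + 1" "M (Suc i) + 1"] upt_conv_Cons[of "M i + 1" "M (Suc i) + 1"]
      by (simp del: upt_Suc)
    have e2: "map (\<lambda>j. k j - k (j - 1)) [M i + 2..<M (Suc i) + 1] = replicate (M (Suc i) - M i - 1) 0"
      by (rule nth_equalityI) (auto simp: kS simp del: upt_Suc)
    have e3: "k (M i + 1) - k (M i + 1 - 1) = L (Suc i) - L i" using kM kS[of "M i + 1"] lt by simp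
    have "gap_word (map (\<lambda>j. k j - k (j - 1)) [1..<M (Suc i) + 1]) =
      gap_word (map (\<lambda>j. k j - k (j - 1)) [1..<M i + 1]) @ gap_word ((L (Suc i) - L i) # replicate (M (Suc i) - M i - 1) 0)"
      unfolding e1 map_append list.map e2 e3 gap_word_append ..
    also have "gap_word (map (\<lambda>j. k j - k (j - 1)) [1..<M i + 1]) = block_word i L M" using Suc by simp
    also have "gap_word ((L (Suc i) - L i) # replicate (M (Suc i) - M i - 1) 0) =
      replicate (L (Suc i) - L i) LZero @ LOne # gap_word (replicate (M (Suc i) - M i - 1) 0)"
      by (simp add: gap_word_def)
    also have "LOne # gap_word (replicate (M (Suc i) - M i - 1) 0) = replicate (Suc (M (Suc i) - M i - 1)) LOne"
      unfolding gap_word_replicate_0 by simp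
    also have "Suc (M (Suc i) - M i - 1) = M (Suc i) - M i" using lt by simp
    finally show ?case by (simp add: block_word_Suc)
  qed
  from this[of r] show ?thesis using M by (simp add: cuts_def)
qed

lemma telescoping_gaps:
  fixes k :: "nat \<Rightarrow> nat"
  assumes "k 0 = 0" "\<And>i. 1 \<le> i \<Longrightarrow> i \<le> n \<Longrightarrow> k (i - 1) \<le> k i" "j \<le> n"
  shows "(\<Sum>i=1..j. k i - k (i - 1)) = k j"
  using assms(3)
proof (induction j)
  case 0
  thus ?case using assms(1) by simp
next
  case (Suc j)
  thus ?case using assms(2)[of "Suc j"] by simp
qed

text \<open>The gaps are truncated differences, so monotonicity is what allows the heights to be
  recovered by telescoping.\<close>

lemma gap_word_heights_inject:
  assumes "gap_word (map (\<lambda>j. k j - k (j - 1)) [1..<n + 1]) = gap_word (map (\<lambda>j. k' j - k' (j - 1)) [1..<n + 1])"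
    and "k 0 = 0" "k' 0 = 0"
    and "\<And>i. 1 \<le> i \<Longrightarrow> i \<le> n \<Longrightarrow> k (i - 1) \<le> k i" "\<And>i. 1 \<le> i \<Longrightarrow> i \<le> n \<Longrightarrow> k' (i - 1) \<le> k' i"
    and "j \<le> n"
  shows "k j = k' j"
proof -
  have "k i - k (i - 1) = k' i - k' (i - 1)" if "i \<in> {1..n}" for i
  proof -
    have "\<forall>i\<in>set [1..<n + 1]. k i - k (i - 1) = k' i - k' (i - 1)"
      using gap_word_inject[OF assms(1)] by (simp only: map_eq_conv)
    thus ?thesis using that by (simp del: upt_Suc)
  qed
  hence "(\<Sum>i=1..j. k i - k (i - 1)) = (\<Sum>i=1..j. k' i - k' (i - 1))"
    using assms(6) by (intro sum.cong) auto
  thus ?thesis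
    using telescoping_gaps[of k n j] telescoping_gaps[of k' n j] assms by simp
qed

lemma block_height_mono:
  assumes "cuts n r L" "cuts n r M" "i \<le> j" "j \<le> n"
  shows "block_height L M i \<le> block_height L M j"
proof (cases "i = 0")
  case True
  thus ?thesis using block_height_0[of L M] assms by (simp add: cuts_def)
next
  case False
  obtain a where a: "a \<in> {1..r}" "M (a - 1) < i" "i \<le> M a"
    using cuts_block_exists[OF assms(2), of i] False assms by auto
  obtain b where b: "b \<in> {1..r}" "M (b - 1) < j" "j \<le> M b"
    using cuts_block_exists[OF assms(2), of j] False assms by auto
  have "a \<le> b"
  proof (rule ccontr)
    assume "\<not> a \<le> b"
    hence "M b \<le> M (a - 1)" using a b by (intro cuts_le[OF assms(2)]) auto
    thus False using a b assms(3) by simp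
  qed
  thus ?thesis
    using block_height_eq[OF assms(2) a] block_height_eq[OF assms(2) b] cuts_le[OF assms(1)] b by simp
qed

lemma block_word_heights_inject:
  assumes L: "cuts n r L" and M: "cuts n r M" and L': "cuts n r' L'" and M': "cuts n r' M'"
    and eq: "block_word r L M = block_word r' L' M'" and "j \<le> n"
  shows "block_height L M j = block_height L' M' j"
proof (rule gap_word_heights_inject[OF _ _ _ _ _ \<open>j \<le> n\<close>])
  have 0: "L 0 = 0" "L' 0 = 0" using L L' by (auto simp: cuts_def)
  show "block_height L M 0 = 0" "block_height L' M' 0 = 0" using 0 by (auto simp: block_height_0)
  show "gap_word (map (\<lambda>j. block_height L M j - block_height L M (j - 1)) [1..<n + 1]) =
    gap_word (map (\<lambda>j. block_height L' M' j - block_height L' M' (j - 1)) [1..<n + 1])"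
    using block_word_eq_gap_word[OF L M, of "block_height L M"]
      block_word_eq_gap_word[OF L' M', of "block_height L' M'"] eq 0
      block_height_eq[OF M] block_height_eq[OF M'] block_height_0 by simp
qed (use block_height_mono[OF L M] block_height_mono[OF L' M'] in auto)

lemma block_height_image:
  assumes "cuts n r L" "cuts n r M"
  shows "block_height L M ` {1..n} = L ` {1..r}"
proof (intro equalityI subsetI)
  fix x assume "x \<in> block_height L M ` {1..n}"
  then obtain k where k: "1 \<le> k" "k \<le> n" "x = block_height L M k" by auto
  obtain i where i: "i \<in> {1..r}" "M (i - 1) < k" "k \<le> M i"
    using cuts_block_exists[OF assms(2) k(1,2)] .
  thus "x \<in> L ` {1..r}" using block_height_eq[OF assms(2) i] k by auto
next
  fix x assume "x \<in> L ` {1..r}"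
  then obtain i where i: "i \<in> {1..r}" "x = L i" by auto
  have "M (i - 1) < M i" using assms i by (auto simp: cuts_def)
  moreover have "M i \<le> n" using cuts_le_n[OF assms(2)] i by simp
  ultimately show "x \<in> block_height L M ` {1..n}"
    using block_height_eq[OF assms(2) i(1), of "M i" L] i by (intro image_eqI[of _ _ "M i"]) auto
qed

lemma block_height_le_iff:
  assumes "cuts n r L" "cuts n r M" "i \<le> r" "k \<in> {1..n}"
  shows "block_height L M k \<le> L i \<longleftrightarrow> k \<le> M i"
proof -
  obtain j where j: "j \<in> {1..r}" "M (j - 1) < k" "k \<le> M j"
    using cuts_block_exists[OF assms(2), of k] assms(4) by auto
  have "L j \<le> L i \<longleftrightarrow> j \<le> i"
    using cuts_le[OF assms(1), of j i] cuts_less[OF assms(1), of i j] j assms(3) by force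
  moreover have "k \<le> M i \<longleftrightarrow> j \<le> i"
  proof
    assume "j \<le> i"
    thus "k \<le> M i" using j cuts_le[OF assms(2), of j i] assms(3) by simp
  next
    assume "k \<le> M i"
    show "j \<le> i"
    proof (rule ccontr)
      assume "\<not> j \<le> i"
      hence "M i \<le> M (j - 1)" using j by (intro cuts_le[OF assms(2)]) auto
      thus False using j \<open>k \<le> M i\<close> by simp
    qed
  qed
  ultimately show ?thesis using block_height_eq[OF assms(2) j] by simp
qed

lemma cuts_sorted_list:
  assumes "cuts n r L"
  shows "map L [1..<r + 1] = sorted_list_of_set (L ` {1..r})"
proof -
  have "sorted_wrt (<) (map L [1..<r + 1])"
    using cuts_less[OF assms] by (auto simp: sorted_wrt_iff_nth_less simp del: upt_Suc)
  moreover have "set (map L [1..<r + 1]) = L ` {1..r}" by (auto simp: less_Suc_eq_le simp del: upt_Suc)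
  ultimately show ?thesis
    by (metis strict_sorted_equal sorted_list_of_set.strict_sorted_key_list_of_set finite_imageI finite_atLeastAtMost set_sorted_list_of_set)
qed

text \<open>The word determines all heights. Their set of values is the set of the
  \<open>L i\<close>, whose increasing enumeration gives \<open>r\<close> and \<open>L\<close>; then
  \<open>M i\<close> is the last position whose height is at most \<open>L i\<close>.\<close>

lemma block_word_inject:
  assumes L: "cuts n r L" and M: "cuts n r M" and L': "cuts n r' L'" and M': "cuts n r' M'"
    and eq: "block_word r L M = block_word r' L' M'"
  shows "r = r'" and "i \<le> r \<Longrightarrow> L i = L' i" and "i \<le> r \<Longrightarrow> M i = M' i"
proof -
  have h: "block_height L M j = block_height L' M' j" if "j \<le> n" for j
    using block_word_heights_inject[OF assms that] .
  have "L ` {1..r} = L' ` {1..r'}"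
    unfolding block_height_image[OF L M, symmetric] block_height_image[OF L' M', symmetric]
    using h by (intro image_cong) auto
  hence m: "map L [1..<r + 1] = map L' [1..<r' + 1]"
    using cuts_sorted_list[OF L] cuts_sorted_list[OF L'] by simp
  from arg_cong[OF this, of length] show r: "r = r'" by (simp del: upt_Suc)
  have LL: "L i = L' i" if "i \<le> r" for i
  proof (cases "i = 0")
    case True
    thus ?thesis using L L' by (simp add: cuts_def)
  next
    case False
    have "\<forall>j\<in>set [1..<r + 1]. L j = L' j" using m unfolding r by (simp only: map_eq_conv)
    thus ?thesis using False that by (simp del: upt_Suc)
  qed
  thus "i \<le> r \<Longrightarrow> L i = L' i" .
  show "M i = M' i" if "i \<le> r"
  proof -
    have "k \<le> M i \<longleftrightarrow> k \<le> M' i" if "k \<in> {1..n}" for k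
      using block_height_le_iff[OF L M \<open>i \<le> r\<close> that] block_height_le_iff[OF L' M' _ that, of i] h[of k] that \<open>i \<le> r\<close> LL[of i] r
      by auto
    moreover have "M i \<le> n" "M' i \<le> n" using cuts_le_n[OF M] cuts_le_n[OF M'] that r by auto
    ultimately have "\<And>k. k \<in> {1..n} \<Longrightarrow> k \<le> M i \<longleftrightarrow> k \<le> M' i" "M i \<le> n" "M' i \<le> n" by auto
    from this(1)[of "M i"] this(1)[of "M' i"] this(2,3) show ?thesis
      by (cases "M i = 0"; cases "M' i = 0") auto
  qed
qed

text \<open>The first \<open>i\<close> blocks form an initial segment with \<open>L i\<close> zeros
  and \<open>M i\<close> ones, to which the Dyck condition applies.\<close>

lemma block_word_dyck_le:
  assumes L: "cuts n r L" and M: "cuts n r M" and D: "block_word r L M \<in> dyck_words n" and "i \<le> r"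
  shows "M i \<le> L i"
proof -
  have cnt: "count_list (block_word i L M) LZero = L i \<and> count_list (block_word i L M) LOne = M i" if "i \<le> r" for i
    using that
  proof (induction i)
    case 0
    show ?case using L M by (simp add: block_word_def cuts_def)
  next
    case (Suc i)
    have rep: "count_list (replicate m x) y = (if x = y then m else 0)" for m and x y :: letter
      by (induction m) auto
    show ?case using Suc cuts_less[OF L, of i "Suc i"] cuts_less[OF M, of i "Suc i"]
      by (simp add: block_word_Suc rep)
  qed
  have "[1..<r + 1] = [1..<i + 1] @ [i + 1..<r + 1]"
    using assms(4) by (intro upt_split) auto
  hence "\<exists>v. block_word r L M = block_word i L M @ v" by (simp add: block_word_def)
  then obtain v where "block_word r L M = block_word i L M @ v" by blast
  hence "take (length (block_word i L M)) (block_word r L M) = block_word i L M" by simp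
  thus ?thesis using D cnt[OF assms(4)] unfolding dyck_words_def by (metis (mono_tags, lifting) mem_Collect_eq)
qed

section \<open>The word of a pair of partitions\<close>

text \<open>In a non-ascending list the entries that are at least \<open>x\<close> form an initial
  segment, of length \<open>count_ge la x\<close>; the inequality is strict because positions start
  at 0 here.\<close>

lemma le_nth_iff_less_count_ge:
  assumes "sorted_wrt (\<ge>) la" "i < length la"
  shows "x \<le> la ! i \<longleftrightarrow> i < count_ge la x"
proof -
  have cg: "count_ge la x = card {j. j < length la \<and> x \<le> la ! j}"
    by (simp add: count_ge_def length_filter_conv_card)
  have anti: "la ! j \<le> la ! i" if "i \<le> j" "j < length la" for i j
    using that assms(1) by (cases "i = j") (auto simp: sorted_wrt_iff_nth_less)
  show ?thesis
  proof
    assume "x \<le> la ! i"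
    hence "{..i} \<subseteq> {j. j < length la \<and> x \<le> la ! j}" using anti assms(2) by fastforce
    hence "card {..i} \<le> count_ge la x" unfolding cg by (rule card_mono[rotated]) auto
    thus "i < count_ge la x" by simp
  next
    assume i: "i < count_ge la x"
    show "x \<le> la ! i"
    proof (rule ccontr)
      assume "\<not> x \<le> la ! i"
      hence "{j. j < length la \<and> x \<le> la ! j} \<subseteq> {..<i}"
        using anti[of i] by (fastforce simp: not_le)
      hence "count_ge la x \<le> card {..<i}" unfolding cg by (rule card_mono[rotated]) auto
      thus False using i by simp
    qed
  qed
qed

lemma count_ge_le_length: "count_ge la x \<le> length la"
  by (simp add: count_ge_def)

lemma count_ge_antimono: "x \<le> y \<Longrightarrow> count_ge la y \<le> count_ge la x"
  unfolding count_ge_def length_filter_conv_card by (intro card_mono) auto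

text \<open>The inequalities inside the definite description of \<open>pair_word\<close>, isolated
  so that they can be restated for given cut sequences.\<close>

definition corners :: "nat \<Rightarrow> nat list \<Rightarrow> nat list \<Rightarrow> nat \<Rightarrow> (nat \<Rightarrow> nat) \<Rightarrow> (nat \<Rightarrow> nat) \<Rightarrow> bool"
  where "corners n mu la r L M \<longleftrightarrow>
       (\<forall>i\<in>{1..r}. la !\<^sub>1 (L i) \<ge> mu !\<^sub>1 (M (i - 1) + 1)) \<and>
       (\<forall>i\<in>{1..<r}. mu !\<^sub>1 (M i) > la !\<^sub>1 (L i + 1))"

text \<open>The number \<open>count_ge la (mu !\<^sub>1 k)\<close> grows with \<open>k\<close>. The
  inequality at the start of block \<open>i\<close> bounds it below by \<open>L i\<close>, the one
  at the end bounds it above by \<open>L i\<close>, so it is constant on the block. The conditions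
  at the corners thus become a condition on every part.\<close>

lemma corners_iff:
  assumes L: "cuts n r L" and M: "cuts n r M" and la: "la \<in> partitions n" and mu: "mu \<in> partitions n"
  shows "corners n mu la r L M \<longleftrightarrow>
    (\<forall>i\<in>{1..r}. \<forall>k. M (i - 1) < k \<and> k \<le> M i \<longrightarrow> count_ge la (mu !\<^sub>1 k) = L i)"
proof -
  have len: "length la = n" "length mu = n" and s: "sorted_wrt (\<ge>) la" "sorted_wrt (\<ge>) mu"
    using la mu by (auto simp: partitions_def)
  have anti: "mu !\<^sub>1 k \<le> mu !\<^sub>1 j" if "1 \<le> j" "j \<le> k" "k \<le> n" for j k
    using that s(2) len by (cases "j = k") (auto simp: sorted_wrt_iff_nth_less)
  have Ln: "L i \<le> n" "M i \<le> n" if "i \<le> r" for i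
    using cuts_le_n[OF L that] cuts_le_n[OF M that] by auto
  have Lpos: "L (i - 1) < L i" "M (i - 1) < M i" if "i \<in> {1..r}" for i
    using L M that by (auto simp: cuts_def)
  have last: "i = r \<longleftrightarrow> L i = n" if "i \<in> {1..r}" for i
    using cuts_less[OF L, of i r] L that by (force simp: cuts_def)
  have low: "la !\<^sub>1 (L i) \<ge> x \<longleftrightarrow> L i \<le> count_ge la x" if "i \<in> {1..r}" for i x
    using le_nth_iff_less_count_ge[OF s(1), of "L i - 1" x] Lpos[OF that] Ln[of i] len that by auto
  have high: "x > la !\<^sub>1 (L i + 1) \<longleftrightarrow> count_ge la x \<le> L i" if "i \<in> {1..<r}" for i x
    using le_nth_iff_less_count_ge[OF s(1), of "L i" x] Ln[of i] last[of i] len that by auto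
  show ?thesis
  proof
    assume c: "corners n mu la r L M"
    show "\<forall>i\<in>{1..r}. \<forall>k. M (i - 1) < k \<and> k \<le> M i \<longrightarrow> count_ge la (mu !\<^sub>1 k) = L i"
    proof (intro ballI allI impI)
      fix i k assume i: "i \<in> {1..r}" and k: "M (i - 1) < k \<and> k \<le> M i"
      have "L i \<le> count_ge la (mu !\<^sub>1 (M (i - 1) + 1))"
        using c i low[OF i] unfolding corners_def by blast
      also have "\<dots> \<le> count_ge la (mu !\<^sub>1 k)"
        using k i Ln(2)[of i] by (intro count_ge_antimono anti) auto
      finally have ge: "L i \<le> count_ge la (mu !\<^sub>1 k)" .
      \<comment> \<open>The last block has no inequality at its end; there the upper bound is the
        length \<open>n = L r\<close>.\<close>
      show "count_ge la (mu !\<^sub>1 k) = L i"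
      proof (cases "i = r")
        case True
        thus ?thesis using ge last[OF i] count_ge_le_length[of la] len by (simp add: le_antisym)
      next
        case False
        hence i': "i \<in> {1..<r}" using i by auto
        have "count_ge la (mu !\<^sub>1 k) \<le> count_ge la (mu !\<^sub>1 (M i))"
          using k i Ln(2)[of i] by (intro count_ge_antimono anti) auto
        also have "\<dots> \<le> L i" using c high[OF i'] i' unfolding corners_def by blast
        finally show ?thesis using ge by simp
      qed
    qed
  next
    assume c: "\<forall>i\<in>{1..r}. \<forall>k. M (i - 1) < k \<and> k \<le> M i \<longrightarrow> count_ge la (mu !\<^sub>1 k) = L i"
    show "corners n mu la r L M"
      unfolding corners_def
    proof (intro conjI ballI)
      fix i assume i: "i \<in> {1..r}"
      show "la !\<^sub>1 (L i) \<ge> mu !\<^sub>1 (M (i - 1) + 1)"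
        unfolding low[OF i] using c i Lpos(2)[OF i] by (metis Suc_eq_plus1 Suc_leI lessI order_refl)
    next
      fix i assume i: "i \<in> {1..<r}"
      hence i': "i \<in> {1..r}" by auto
      show "mu !\<^sub>1 (M i) > la !\<^sub>1 (L i + 1)"
        unfolding high[OF i] using c i' Lpos(2)[OF i'] by (metis order_refl)
    qed
  qed
qed

text \<open>The values of \<open>k j = count_ge la (mu !\<^sub>1 j)\<close> in increasing order are
  taken as the \<open>L i\<close>, and \<open>M i\<close> counts the positions with value at most
  \<open>L i\<close>. From \<open>mu\<close> below \<open>la\<close> one gets
  \<open>j \<le> k j\<close>; hence no value is 0, and the last value is \<open>n\<close>, as cut
  sequences require.\<close>

lemma corners_exist:
  assumes la: "la \<in> partitions n" and mu: "mu \<in> partitions n" and le: "\<forall>i\<in>{1..n}. mu !\<^sub>1 i \<le> la !\<^sub>1 i"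
  obtains r L M where "cuts n r L" "cuts n r M" "corners n mu la r L M"
proof -
  have len: "length la = n" "length mu = n" and s: "sorted_wrt (\<ge>) la" "sorted_wrt (\<ge>) mu"
    using la mu by (auto simp: partitions_def)
  define k where "k j = count_ge la (mu !\<^sub>1 j)" for j
  have kn: "k j \<le> n" for j using count_ge_le_length[of la] len by (simp add: k_def)
  have jk: "j \<le> k j" if "j \<in> {1..n}" for j
  proof -
    have "mu !\<^sub>1 j \<le> la !\<^sub>1 j" using le that by blast
    moreover have "j - 1 < length la" using that len by auto
    ultimately have "j - 1 < k j" using le_nth_iff_less_count_ge[OF s(1)] by (simp add: k_def)
    thus ?thesis by simp
  qed
  have mono: "k i \<le> k j" if "1 \<le> i" "i \<le> j" "j \<le> n" for i j
  proof -
    have "mu !\<^sub>1 j \<le> mu !\<^sub>1 i"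
      using that s(2) len by (cases "i = j") (auto simp: sorted_wrt_iff_nth_less)
    thus ?thesis unfolding k_def by (rule count_ge_antimono)
  qed
  define S where "S = k ` {1..n}"
  define ls where "ls = sorted_list_of_set S"
  define r where "r = length ls"
  define L where "L i = (if i = 0 then 0 else ls ! (i - 1))" for i
  define M where "M i = card {j \<in> {1..n}. k j \<le> L i}" for i
  have finS: "finite S" by (simp add: S_def)
  have setls: "set ls = S" using finS by (simp add: ls_def)
  have Lpos: "L i \<in> S" if "i \<in> {1..r}" for i
    using that setls nth_mem[of "i - 1" ls] by (auto simp: L_def r_def)
  have Sex: "\<exists>i\<in>{1..r}. x = L i" if "x \<in> S" for x
  proof -
    have "x \<in> set ls" using that setls by simp
    then obtain i where i: "i < length ls" "ls ! i = x" unfolding in_set_conv_nth by blast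
    have "L (Suc i) = x" "Suc i \<in> {1..r}" using i by (simp_all add: L_def r_def)
    thus ?thesis by blast
  qed
  have Sge: "x \<ge> 1" if "x \<in> S" for x
  proof -
    obtain j where "j \<in> {1..n}" "x = k j" using \<open>x \<in> S\<close> unfolding S_def by blast
    thus ?thesis using jk[of j] by simp
  qed
  have Lstep: "L (i - 1) < L i" if "i \<in> {1..r}" for i
  proof (cases "i = 1")
    case True
    thus ?thesis using Sge[OF Lpos[OF that]] by (simp add: L_def)
  next
    case False
    have "sorted_wrt (<) ls" using finS by (simp add: ls_def)
    thus ?thesis using that False by (auto simp: L_def r_def sorted_wrt_iff_nth_less)
  qed
  have Lmono: "i \<le> j \<Longrightarrow> j \<le> r \<Longrightarrow> L i \<le> L j" for i j
  proof (induction j rule: dec_induct)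
    case (step m)
    thus ?case using Lstep[of "Suc m"] by simp
  qed simp
  have Lr: "L r = n"
  proof (cases "n = 0")
    case True
    thus ?thesis by (simp add: L_def r_def ls_def S_def)
  next
    case False
    hence "n \<in> S" using jk[of n] kn[of n] by (auto simp: S_def intro!: image_eqI[of _ _ n])
    then obtain i where i: "i \<in> {1..r}" "n = L i" using Sex by blast
    hence "n \<le> L r" using Lmono[of i r] by simp
    moreover have "L r \<in> S" using i by (intro Lpos) auto
    ultimately show ?thesis using kn by (auto simp: S_def intro: le_antisym)
  qed
  have L: "cuts n r L" using Lr Lstep by (simp add: cuts_def L_def)
  have Miff: "k j \<le> L i \<longleftrightarrow> j \<le> M i" if "j \<in> {1..n}" for i j
  proof
    assume "k j \<le> L i"
    have "{1..j} \<subseteq> {j \<in> {1..n}. k j \<le> L i}"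
    proof
      fix x assume x: "x \<in> {1..j}"
      have "k x \<le> k j" using mono[of x j] x \<open>j \<in> {1..n}\<close> by simp
      thus "x \<in> {j \<in> {1..n}. k j \<le> L i}" using x \<open>j \<in> {1..n}\<close> \<open>k j \<le> L i\<close> by simp
    qed
    moreover have "finite {j \<in> {1..n}. k j \<le> L i}" by simp
    ultimately have "card {1..j} \<le> M i" unfolding M_def by (rule card_mono[rotated])
    thus "j \<le> M i" by simp
  next
    assume j: "j \<le> M i"
    show "k j \<le> L i"
    proof (rule ccontr)
      assume "\<not> k j \<le> L i"
      have "{j \<in> {1..n}. k j \<le> L i} \<subseteq> {1..<j}"
      proof
        fix x assume x: "x \<in> {j \<in> {1..n}. k j \<le> L i}"
        have "\<not> j \<le> x" using mono[of j x] x \<open>j \<in> {1..n}\<close> \<open>\<not> k j \<le> L i\<close> by auto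
        thus "x \<in> {1..<j}" using x by simp
      qed
      moreover have "finite {1..<j}" by simp
      ultimately have "M i \<le> card {1..<j}" unfolding M_def by (rule card_mono[rotated])
      thus False using j that by auto
    qed
  qed
  have "{j \<in> {1..n}. k j \<le> L 0} = {}"
  proof -
    have "\<not> k j \<le> 0" if "j \<in> {1..n}" for j using jk[OF that] that by simp
    thus ?thesis by (simp add: L_def)
  qed
  hence "M 0 = 0" unfolding M_def by simp
  moreover have "M r = n"
  proof -
    have "{j \<in> {1..n}. k j \<le> L r} = {1..n}" using kn Lr by auto
    thus ?thesis by (simp add: M_def)
  qed
  moreover have "M (i - 1) < M i" if i: "i \<in> {1..r}" for i
  proof -
    obtain j where j: "j \<in> {1..n}" "L i = k j" using Lpos[OF i] unfolding S_def by blast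
    have "j \<le> M i" using Miff[OF j(1), of i] j(2) by simp
    moreover have "\<not> k j \<le> L (i - 1)" using Lstep[OF i] j(2) by simp
    hence "\<not> j \<le> M (i - 1)" using Miff[OF j(1), of "i - 1"] by blast
    ultimately show ?thesis by simp
  qed
  ultimately have M: "cuts n r M" by (simp add: cuts_def)
  have "corners n mu la r L M"
    unfolding corners_iff[OF L M la mu]
  proof (intro ballI allI impI)
    fix i j assume i: "i \<in> {1..r}" and j: "M (i - 1) < j \<and> j \<le> M i"
    have jn: "j \<in> {1..n}" using j i cuts_le_n[OF M, of i] by auto
    obtain i' where i': "i' \<in> {1..r}" "k j = L i'" using Sex[of "k j"] jn by (auto simp: S_def)
    have "L i' \<le> L i" "\<not> L i' \<le> L (i - 1)" using Miff[OF jn] j i'(2) by auto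
    moreover have "i - 1 \<le> r" "i' \<le> r" using i i' by auto
    ultimately have "\<not> i < i'" "\<not> i' \<le> i - 1"
      using Lmono[of i' "i - 1"] cuts_less[OF L, of i i'] by (metis not_le, metis)
    hence "i' = i" using i by auto
    thus "count_ge la (mu !\<^sub>1 j) = L i" using i' by (simp add: k_def)
  qed
  thus ?thesis using that L M by blast
qed

text \<open>Every decomposition with the corner property spells the same word \<open>W\<close>,
  whose heights are the numbers \<open>count_ge la (mu !\<^sub>1 j)\<close>. So the definite
  description denotes \<open>W\<close>, and injectivity of \<open>block_word\<close> turns equality
  of words into equality of cuts.\<close>

lemma pair_word_eq_iff:
  assumes L: "cuts n r L" and M: "cuts n r M" and la: "la \<in> partitions n" and mu: "mu \<in> partitions n"
    and le: "\<forall>i\<in>{1..n}. mu !\<^sub>1 i \<le> la !\<^sub>1 i"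
  shows "pair_word n mu la = block_word r L M \<longleftrightarrow>
    (\<forall>i\<in>{1..r}. \<forall>k. M (i - 1) < k \<and> k \<le> M i \<longrightarrow> count_ge la (mu !\<^sub>1 k) = L i)"
proof -
  define k where "k j = (if j = 0 then 0 else count_ge la (mu !\<^sub>1 j))" for j
  define W where "W = gap_word (map (\<lambda>j. k j - k (j - 1)) [1..<n + 1])"
  have word: "block_word r' L' M' = W" if "cuts n r' L'" "cuts n r' M'" "corners n mu la r' L' M'" for r' L' M'
    unfolding W_def using that corners_iff[OF that(1,2) la mu]
    by (intro block_word_eq_gap_word) (auto simp: k_def)
  obtain r0 L0 M0 where c0: "cuts n r0 L0" "cuts n r0 M0" "corners n mu la r0 L0 M0"
    using corners_exist[OF la mu le] .
  have pw: "pair_word n mu la = W"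
    unfolding pair_word_def
  proof (rule the_equality)
    show "\<exists>r L M. cuts n r L \<and> cuts n r M \<and>
       (\<forall>i\<in>{1..r}. la !\<^sub>1 (L i) \<ge> mu !\<^sub>1 (M (i - 1) + 1)) \<and>
       (\<forall>i\<in>{1..<r}. mu !\<^sub>1 (M i) > la !\<^sub>1 (L i + 1)) \<and> W = block_word r L M"
      using c0 word[OF c0] unfolding corners_def by metis
  next
    fix w assume "\<exists>r L M. cuts n r L \<and> cuts n r M \<and>
       (\<forall>i\<in>{1..r}. la !\<^sub>1 (L i) \<ge> mu !\<^sub>1 (M (i - 1) + 1)) \<and>
       (\<forall>i\<in>{1..<r}. mu !\<^sub>1 (M i) > la !\<^sub>1 (L i + 1)) \<and> w = block_word r L M"
    thus "w = W" using word unfolding corners_def by metis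
  qed
  show ?thesis
  proof
    assume "pair_word n mu la = block_word r L M"
    hence eq: "block_word r L M = block_word r0 L0 M0" using pw word[OF c0] by simp
    have r: "r = r0" and LM: "\<And>i. i \<le> r \<Longrightarrow> L i = L0 i \<and> M i = M0 i"
      using block_word_inject[OF L M c0(1,2) eq] by auto
    show "\<forall>i\<in>{1..r}. \<forall>k. M (i - 1) < k \<and> k \<le> M i \<longrightarrow> count_ge la (mu !\<^sub>1 k) = L i"
    proof (intro ballI allI impI)
      fix i k assume i: "i \<in> {1..r}" and k: "M (i - 1) < k \<and> k \<le> M i"
      have "i \<le> r" "i - 1 \<le> r" using i by auto
      thus "count_ge la (mu !\<^sub>1 k) = L i"
        using c0(3) i k LM[of i] LM[of "i - 1"] r unfolding corners_iff[OF c0(1,2) la mu] by metis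
    qed
  next
    assume "\<forall>i\<in>{1..r}. \<forall>k. M (i - 1) < k \<and> k \<le> M i \<longrightarrow> count_ge la (mu !\<^sub>1 k) = L i"
    hence "corners n mu la r L M" using corners_iff[OF L M la mu] by simp
    thus "pair_word n mu la = block_word r L M" using word[OF L M] pw by simp
  qed
qed

section \<open>Sums of power series\<close>

text \<open>Convergence is expressed coefficient by coefficient: each coefficient is a finite sum.
  Products, reindexings and regroupings of infinite families then reduce to finite sums, and the
  topological sum is reached only through \<open>has_fsum_imp_has_sum\<close>.\<close>

definition has_fsum :: "('i \<Rightarrow> 'a::comm_ring_1 fps) \<Rightarrow> 'a fps \<Rightarrow> 'i set \<Rightarrow> bool"
  where "has_fsum F S A \<longleftrightarrow>
    (\<forall>k. finite {a \<in> A. fps_nth (F a) k \<noteq> 0} \<and>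
         fps_nth S k = (\<Sum>a\<in>{a \<in> A. fps_nth (F a) k \<noteq> 0}. fps_nth (F a) k))"

lemma has_fsumI:
  assumes "\<And>k. finite (B k)" "\<And>k. B k \<subseteq> A" "\<And>k a. a \<in> A - B k \<Longrightarrow> fps_nth (F a) k = 0"
    and "\<And>k. fps_nth S k = (\<Sum>a\<in>B k. fps_nth (F a) k)"
  shows "has_fsum F S A"
  unfolding has_fsum_def
proof
  fix k
  have sub: "{a \<in> A. fps_nth (F a) k \<noteq> 0} \<subseteq> B k" using assms(3) by blast
  moreover have "(\<Sum>a\<in>B k. fps_nth (F a) k) = (\<Sum>a\<in>{a \<in> A. fps_nth (F a) k \<noteq> 0}. fps_nth (F a) k)"
    using assms(1,2) sub by (intro sum.mono_neutral_right) auto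
  ultimately show "finite {a \<in> A. fps_nth (F a) k \<noteq> 0} \<and>
         fps_nth S k = (\<Sum>a\<in>{a \<in> A. fps_nth (F a) k \<noteq> 0}. fps_nth (F a) k)"
    using assms(1)[of k] assms(4)[of k] finite_subset by metis
qed

lemma has_fsum_finite: "has_fsum F S A \<Longrightarrow> finite {a \<in> A. fps_nth (F a) k \<noteq> 0}"
  by (simp add: has_fsum_def)

lemma has_fsum_nth:
  assumes "has_fsum F S A" "finite B" "B \<subseteq> A" "{a \<in> A. fps_nth (F a) k \<noteq> 0} \<subseteq> B"
  shows "fps_nth S k = (\<Sum>a\<in>B. fps_nth (F a) k)"
proof -
  have "fps_nth S k = (\<Sum>a\<in>{a \<in> A. fps_nth (F a) k \<noteq> 0}. fps_nth (F a) k)"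
    using assms(1) by (simp add: has_fsum_def)
  also have "\<dots> = (\<Sum>a\<in>B. fps_nth (F a) k)"
    using assms by (intro sum.mono_neutral_left) auto
  finally show ?thesis .
qed

lemma has_fsum_imp_has_sum:
  assumes "has_fsum F S A"
  shows "(F has_sum S) A"
  unfolding has_sum_def tendsto_fps_iff
proof (intro allI)
  fix k
  define B where "B = {a \<in> A. fps_nth (F a) k \<noteq> 0}"
  have B: "finite B" "B \<subseteq> A" using has_fsum_finite[OF assms] by (auto simp: B_def)
  have "fps_nth (sum F X) k = fps_nth S k" if "finite X" "B \<subseteq> X" "X \<subseteq> A" for X
    using has_fsum_nth[OF assms that(1,3), of k] that(2) by (simp add: fps_sum_nth B_def)
  thus "\<forall>\<^sub>F X in finite_subsets_at_top A. fps_nth (sum F X) k = fps_nth S k"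
    unfolding eventually_finite_subsets_at_top using B by blast
qed

lemma has_fsum_reindex:
  assumes "bij_betw h A B" "has_fsum (\<lambda>a. F (h a)) S A"
  shows "has_fsum F S B"
proof (rule has_fsumI)
  fix k
  have inj: "inj_on h A" and im: "h ` A = B" using assms(1) by (auto simp: bij_betw_def)
  show "finite (h ` {a \<in> A. fps_nth (F (h a)) k \<noteq> 0})" using has_fsum_finite[OF assms(2)] by simp
  show "h ` {a \<in> A. fps_nth (F (h a)) k \<noteq> 0} \<subseteq> B" using im by auto
  show "fps_nth (F a) k = 0" if "a \<in> B - h ` {a \<in> A. fps_nth (F (h a)) k \<noteq> 0}" for a
    using that im by auto
  have "inj_on h {a \<in> A. fps_nth (F (h a)) k \<noteq> 0}" by (rule inj_on_subset[OF inj]) auto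
  thus "fps_nth S k = (\<Sum>a\<in>h ` {a \<in> A. fps_nth (F (h a)) k \<noteq> 0}. fps_nth (F a) k)"
    using assms(2) by (simp add: has_fsum_def sum.reindex)
qed

text \<open>The coefficient \<open>k\<close> of a product involves all coefficients up to
  \<open>k\<close> of both factors, which is why the finite index sets collect indices over all
  degrees \<open>i \<le> k\<close>.\<close>

lemma has_fsum_product:
  assumes F: "has_fsum F S A" and G: "has_fsum G T B"
  shows "has_fsum (\<lambda>(a, b). F a * G b) (S * T) (A \<times> B)"
proof (rule has_fsumI)
  fix k
  define FA where "FA k = (\<Union>i\<le>k. {a \<in> A. fps_nth (F a) i \<noteq> 0})" for k :: nat
  define GB where "GB k = (\<Union>i\<le>k. {b \<in> B. fps_nth (G b) i \<noteq> 0})" for k :: nat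
  have fin: "finite (FA k)" "finite (GB k)"
    using has_fsum_finite[OF F] has_fsum_finite[OF G] by (auto simp: FA_def GB_def)
  show "finite (FA k \<times> GB k)" using fin by simp
  show "FA k \<times> GB k \<subseteq> A \<times> B" by (auto simp: FA_def GB_def)
  show "fps_nth ((\<lambda>(a, b). F a * G b) ab) k = 0" if "ab \<in> A \<times> B - FA k \<times> GB k" for ab
  proof -
    obtain a b where ab: "ab = (a, b)" by (metis surj_pair)
    have "a \<notin> FA k \<or> b \<notin> GB k" "a \<in> A" "b \<in> B" using that ab by auto
    hence "fps_nth (F a) i * fps_nth (G b) (k - i) = 0" if "i \<le> k" for i
      using that diff_le_self[of k i] by (auto simp: FA_def GB_def)
    thus ?thesis by (simp add: ab fps_mult_nth)
  qed
  have S: "fps_nth S i = (\<Sum>a\<in>FA k. fps_nth (F a) i)" if "i \<le> k" for i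
    using fin that by (intro has_fsum_nth[OF F]) (auto simp: FA_def)
  have T: "fps_nth T (k - i) = (\<Sum>b\<in>GB k. fps_nth (G b) (k - i))" for i
  proof (rule has_fsum_nth[OF G fin(2)])
    have "k - i \<in> {..k}" by simp
    thus "{b \<in> B. fps_nth (G b) (k - i) \<noteq> 0} \<subseteq> GB k" unfolding GB_def by blast
  qed (auto simp: GB_def)
  have "fps_nth (S * T) k = (\<Sum>i=0..k. \<Sum>a\<in>FA k. \<Sum>b\<in>GB k. fps_nth (F a) i * fps_nth (G b) (k - i))"
    unfolding fps_mult_nth by (intro sum.cong refl) (simp add: S T sum_product)
  also have "\<dots> = (\<Sum>a\<in>FA k. \<Sum>b\<in>GB k. \<Sum>i=0..k. fps_nth (F a) i * fps_nth (G b) (k - i))"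
    by (subst sum.swap, intro sum.cong refl, rule sum.swap)
  also have "\<dots> = (\<Sum>ab\<in>FA k \<times> GB k. fps_nth ((\<lambda>(a, b). F a * G b) ab) k)"
    by (subst sum.cartesian_product, intro sum.cong refl) (simp add: fps_mult_nth case_prod_unfold)
  finally show "fps_nth (S * T) k = (\<Sum>ab\<in>FA k \<times> GB k. fps_nth ((\<lambda>(a, b). F a * G b) ab) k)" .
qed

lemma has_fsum_singleton: "has_fsum F (F a) {a}"
  by (rule has_fsumI[where B = "\<lambda>_. {a}"]) auto

lemma has_fsum_cmult:
  assumes "has_fsum F S A"
  shows "has_fsum (\<lambda>a. c * F a) (c * S) A"
proof -
  have "bij_betw snd ({()} \<times> A) A" by (auto simp: bij_betw_def inj_on_def)
  moreover have "has_fsum (\<lambda>z. c * F (snd z)) (c * S) ({()} \<times> A)"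
    using has_fsum_product[OF has_fsum_singleton[of "\<lambda>_. c" "()"] assms] by (simp add: case_prod_unfold)
  ultimately show ?thesis by (rule has_fsum_reindex)
qed

lemma has_fsum_Sigma:
  assumes "finite I" "\<And>i. i \<in> I \<Longrightarrow> has_fsum (F i) (S i) (A i)"
  shows "has_fsum (\<lambda>(i, a). F i a) (\<Sum>i\<in>I. S i) (Sigma I A)"
proof (rule has_fsumI)
  fix k
  define B where "B k i = {a \<in> A i. fps_nth (F i a) k \<noteq> 0}" for k i
  have fin: "finite (B k i)" if "i \<in> I" for i
    using has_fsum_finite[OF assms(2)[OF that]] by (simp add: B_def)
  show "finite (Sigma I (B k))" using assms(1) fin by blast
  show "Sigma I (B k) \<subseteq> Sigma I A" by (auto simp: B_def)
  show "fps_nth ((\<lambda>(i, a). F i a) z) k = 0" if "z \<in> Sigma I A - Sigma I (B k)" for z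
    using that by (auto simp: B_def)
  have "fps_nth (\<Sum>i\<in>I. S i) k = (\<Sum>i\<in>I. \<Sum>a\<in>B k i. fps_nth (F i a) k)"
    unfolding fps_sum_nth
    by (intro sum.cong refl) (use assms(2) in \<open>simp add: has_fsum_def B_def\<close>)
  also have "\<dots> = (\<Sum>z\<in>Sigma I (B k). fps_nth ((\<lambda>(i, a). F i a) z) k)"
    using assms(1) fin by (simp add: sum.Sigma case_prod_unfold)
  finally show "fps_nth (\<Sum>i\<in>I. S i) k = (\<Sum>z\<in>Sigma I (B k). fps_nth ((\<lambda>(i, a). F i a) z) k)" .
qed

text \<open>Passes from a sum over pairs to a sum over first components. It serves to sum out the
  partitions \<open>mu\<close> below a fixed tuple, of which there are finitely many.\<close>

lemma has_fsum_marginal: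
  assumes "has_fsum (\<lambda>(a, b). F a b) S (Sigma A B)" "\<And>a. a \<in> A \<Longrightarrow> finite (B a)"
  shows "has_fsum (\<lambda>a. \<Sum>b\<in>B a. F a b) S A"
proof (rule has_fsumI)
  fix k
  define Z where "Z k = fst ` {z \<in> Sigma A B. fps_nth ((\<lambda>(a, b). F a b) z) k \<noteq> 0}" for k
  show fin: "finite (Z k)" using has_fsum_finite[OF assms(1)] by (simp add: Z_def)
  show ZA: "Z k \<subseteq> A" by (auto simp: Z_def)
  show "fps_nth (\<Sum>b\<in>B a. F a b) k = 0" if "a \<in> A - Z k" for a
  proof -
    have "fps_nth (F a b) k = 0" if "b \<in> B a" for b
    proof (rule ccontr)
      assume "fps_nth (F a b) k \<noteq> 0"
      hence "(a, b) \<in> {z \<in> Sigma A B. fps_nth ((\<lambda>(a, b). F a b) z) k \<noteq> 0}"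
        using that \<open>a \<in> A - Z k\<close> by simp
      hence "fst (a, b) \<in> Z k" unfolding Z_def by (rule imageI)
      thus False using \<open>a \<in> A - Z k\<close> by simp
    qed
    thus ?thesis by (simp add: fps_sum_nth)
  qed
  have "fps_nth S k = (\<Sum>z\<in>Sigma (Z k) B. fps_nth ((\<lambda>(a, b). F a b) z) k)"
  proof (rule has_fsum_nth[OF assms(1)])
    show "finite (Sigma (Z k) B)" using fin assms(2) ZA by blast
    show "Sigma (Z k) B \<subseteq> Sigma A B" using ZA by auto
    show "{z \<in> Sigma A B. fps_nth ((\<lambda>(a, b). F a b) z) k \<noteq> 0} \<subseteq> Sigma (Z k) B"
      by (force simp: Z_def)
  qed
  also have "\<dots> = (\<Sum>a\<in>Z k. \<Sum>b\<in>B a. fps_nth (F a b) k)"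
    using fin assms(2) ZA by (subst sum.Sigma) (auto simp: case_prod_unfold)
  finally show "fps_nth S k = (\<Sum>a\<in>Z k. fps_nth (\<Sum>b\<in>B a. F a b) k)" by (simp add: fps_sum_nth)
qed

text \<open>This matches the shape of \<open>D_wA\<close>: a finite sum over weak orderings
  \<open>v\<close> of infinite sums over the tuples with weak ordering \<open>v\<close>. Each
  coefficient has finite support, which is split along the fibres of \<open>c\<close>.\<close>

lemma sum_infsum_fibres:
  assumes "has_fsum F S A" "finite V" "\<And>a. a \<in> A \<Longrightarrow> c a \<in> V"
  shows "(\<Sum>v\<in>V. infsum F {a \<in> A. c a = v}) = S"
proof -
  define Z where "Z k = {a \<in> A. fps_nth (F a) k \<noteq> 0}" for k
  have fin: "finite (Z k)" for k using has_fsum_finite[OF assms(1)] by (simp add: Z_def)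
  define T where "T v = Abs_fps (\<lambda>k. \<Sum>a\<in>{a \<in> Z k. c a = v}. fps_nth (F a) k)" for v
  have "has_fsum F (T v) {a \<in> A. c a = v}" for v
  proof (rule has_fsumI[where B = "\<lambda>k. {a \<in> Z k. c a = v}"])
    show "finite {a \<in> Z k. c a = v}" for k using fin by simp
  qed (auto simp: T_def Z_def)
  hence inf: "infsum F {a \<in> A. c a = v} = T v" for v
    using has_fsum_imp_has_sum infsumI by blast
  show ?thesis
  proof (rule fps_ext)
    fix k
    have "fps_nth (\<Sum>v\<in>V. infsum F {a \<in> A. c a = v}) k = (\<Sum>v\<in>V. \<Sum>a\<in>{a \<in> Z k. c a = v}. fps_nth (F a) k)"
      by (simp add: fps_sum_nth inf T_def)
    also have "\<dots> = (\<Sum>a\<in>Z k. fps_nth (F a) k)"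
      by (rule sum.group) (use fin assms in \<open>auto simp: Z_def\<close>)
    also have "\<dots> = fps_nth S k" using assms(1) by (simp add: has_fsum_def Z_def)
    finally show "fps_nth (\<Sum>v\<in>V. infsum F {a \<in> A. c a = v}) k = fps_nth S k" .
  qed
qed

text \<open>Distributivity for families indexed by functions on a finite set. The functions are the
  multiplicities of the states of a fixed chain, which vary independently.\<close>

lemma has_fsum_PiE:
  assumes "finite Y" "\<And>s. s \<in> Y \<Longrightarrow> has_fsum (F s) (S s) (A s)"
  shows "has_fsum (\<lambda>m. \<Prod>s\<in>Y. F s (m s)) (\<Prod>s\<in>Y. S s) (PiE Y A)"
  using assms
proof (induction Y)
  case empty
  show ?case using has_fsum_singleton[of "\<lambda>m. \<Prod>s\<in>{}. F s (m s)" "\<lambda>_. undefined"] by simp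
next
  case (insert x Y)
  have bij: "bij_betw (\<lambda>(y, g). g(x := y)) (A x \<times> PiE Y A) (PiE (insert x Y) A)"
    unfolding bij_betw_def PiE_insert_eq using inj_combinator[OF insert(2)] by simp
  have "has_fsum (\<lambda>z. F x (fst z) * (\<Prod>s\<in>Y. F s (snd z s))) (S x * (\<Prod>s\<in>Y. S s)) (A x \<times> PiE Y A)"
    using has_fsum_product[of "F x" "S x" "A x" "\<lambda>m. \<Prod>s\<in>Y. F s (m s)" "\<Prod>s\<in>Y. S s" "PiE Y A"]
      insert by (simp add: case_prod_unfold)
  moreover have "(\<Prod>s\<in>insert x Y. F s ((\<lambda>(y, g). g(x := y)) z s)) = F x (fst z) * (\<Prod>s\<in>Y. F s (snd z s))" for z
  proof -
    have "(\<Prod>s\<in>Y. F s (if s = x then fst z else snd z s)) = (\<Prod>s\<in>Y. F s (snd z s))"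
      using insert(2) by (intro prod.cong) auto
    thus ?thesis using insert(1,2) by (simp add: case_prod_unfold)
  qed
  ultimately have "has_fsum (\<lambda>z. \<Prod>s\<in>insert x Y. F s ((\<lambda>(y, g). g(x := y)) z s)) (S x * (\<Prod>s\<in>Y. S s)) (A x \<times> PiE Y A)"
    by simp
  hence "has_fsum (\<lambda>m. \<Prod>s\<in>insert x Y. F s (m s)) (S x * (\<Prod>s\<in>Y. S s)) (PiE (insert x Y) A)"
    by (rule has_fsum_reindex[OF bij])
  thus ?case using insert by simp
qed

lemma has_fsum_geometric:
  fixes W :: "'a::field fps"
  assumes "fps_nth W 0 = 0"
  shows "has_fsum (\<lambda>m. W ^ m) (W / (1 - W)) {1..}"
proof (rule has_fsumI)
  fix k :: nat
  show "finite {1..k}" "{1..k} \<subseteq> {1..}" by auto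
  have zero: "fps_nth (W ^ m) i = 0" if "i < m" for m i
    using startsby_zero_power_prefix[OF assms] that by blast
  show "fps_nth (W ^ m) k = 0" if "m \<in> {1..} - {1..k}" for m
    using that by (intro zero) auto
  have inv: "(1 - W) * inverse (1 - W) = 1"
    using assms by (intro inverse_mult_eq_1') simp
  \<comment> \<open>A partial sum plus the closed form of the remainder;
    \<open>(1 - W) * Z = W\<close>, and the remainder has no coefficient in degree
    \<open>k\<close>.\<close>
  define Z where "Z = (\<Sum>m=1..k. W ^ m) + W ^ Suc k * inverse (1 - W)"
  have "(1 - W) * (\<Sum>m=1..k. W ^ m) = W - W ^ Suc k"
  proof (induction k)
    case (Suc k)
    thus ?case by (simp add: distrib_left left_diff_distrib)
  qed simp
  hence "(1 - W) * Z = W - W ^ Suc k + W ^ Suc k * ((1 - W) * inverse (1 - W))"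
    by (simp only: Z_def distrib_left mult.left_commute)
  hence "W = (1 - W) * Z" by (simp only: inv) simp
  hence "W * inverse (1 - W) = Z * ((1 - W) * inverse (1 - W))" by (metis mult.assoc mult.commute)
  hence "W / (1 - W) = Z" using assms by (simp only: inv) (simp add: fps_divide_unit)
  moreover have "fps_nth (W ^ Suc k * inverse (1 - W)) k = 0"
    unfolding fps_mult_nth using zero[of _ "Suc k"] by (intro sum.neutral ballI) (simp del: power_Suc)
  ultimately show "fps_nth (W / (1 - W)) k = (\<Sum>m\<in>{1..k}. fps_nth (W ^ m) k)"
    by (simp add: Z_def fps_sum_nth del: power_Suc)
qed

section \<open>Gaussian multinomial coefficients\<close>

text \<open>The Pochhammer symbol \<open>(Y; Y)_h\<close>, that is, the q-factorial without its
  division by powers of \<open>1 - Y\<close>.\<close>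

definition qfact :: "nat \<Rightarrow> 'a::field \<Rightarrow> 'a"
  where "qfact h Y = (\<Prod>i=1..h. 1 - Y ^ i)"

lemma qfact_nonzero: "(\<And>k. k \<ge> 1 \<Longrightarrow> Y ^ k \<noteq> 1) \<Longrightarrow> qfact h Y \<noteq> 0"
proof -
  assume *: "\<And>k. k \<ge> 1 \<Longrightarrow> Y ^ k \<noteq> 1"
  have "1 - Y ^ i \<noteq> 0" if "i \<in> {1..h}" for i using *[of i] that by simp
  thus ?thesis unfolding qfact_def by (simp add: prod_zero_iff)
qed

lemma prod_split_at:
  fixes b a :: nat
  shows "b \<le> a \<Longrightarrow> prod F {1..a} = prod F {1..b} * prod F {b+1..a}"
  using prod.ub_add_nat[of 1 b F "a - b"] by simp

lemma qfact_split:
  assumes "b \<le> a"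
  shows "qfact a Y = qfact b Y * (\<Prod>i=b+1..a. 1 - Y ^ i)"
  unfolding qfact_def by (rule prod_split_at[OF assms])

lemma qfact_rev:
  assumes "m \<le> h"
  shows "(\<Prod>k=m+1..h. 1 - Y ^ (h + 1 - k)) = qfact (h - m) Y"
  unfolding qfact_def
  by (rule prod.reindex_bij_witness[of _ "\<lambda>i. h + 1 - i" "\<lambda>k. h + 1 - k"]) (use assms in auto)

lemma gauss_binomial_qfact:
  assumes "b \<le> a" "\<And>k. k \<ge> 1 \<Longrightarrow> Y ^ k \<noteq> 1"
  shows "gauss_binomial a b Y = qfact a Y / (qfact b Y * qfact (a - b) Y)"
proof -
  have "gauss_binomial a b Y = (\<Prod>i=a-b+1..a. 1 - Y ^ i) / qfact b Y"
    by (simp add: gauss_binomial_def qfact_def)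
  moreover have "qfact a Y = qfact (a - b) Y * (\<Prod>i=a-b+1..a. 1 - Y ^ i)"
    by (rule qfact_split) simp
  moreover have "qfact (a - b) Y \<noteq> 0" using qfact_nonzero[OF assms(2)] .
  ultimately show ?thesis by simp
qed

text \<open>If \<open>B\<close> contains the end positions of the constant runs of
  \<open>mu\<close>, this is the end of the run through position \<open>k\<close>, hence the number
  of parts that are at least the \<open>k\<close>-th one.\<close>

definition next_in :: "nat set \<Rightarrow> nat \<Rightarrow> nat"
  where "next_in B k = Min {c \<in> B. k \<le> c}"

lemma sorted_list_of_set_insert_max:
  fixes m :: nat
  assumes "finite I" "\<forall>i\<in>I. i < m"
  shows "sorted_list_of_set (insert m I) = sorted_list_of_set I @ [m]"
proof -
  have "sorted_wrt (<) (sorted_list_of_set I @ [m])"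
    using assms by (simp add: sorted_wrt_append)
  moreover have "sorted_wrt (<) (sorted_list_of_set (insert m I))" by simp
  moreover have "set (sorted_list_of_set (insert m I)) = set (sorted_list_of_set I @ [m])"
    using assms(1) set_sorted_list_of_set[of "insert m I"] set_sorted_list_of_set[of I]
    by (simp del: sorted_list_of_set_insert_remove sorted_list_of_set.sorted_key_list_of_set_insert_remove)
  ultimately show ?thesis using strict_sorted_equal by blast
qed

lemma gauss_multinomial_insert_max:
  assumes "finite I" "\<forall>i\<in>I. i < m"
  shows "gauss_multinomial h (insert m I) Y = gauss_binomial h m Y * gauss_multinomial m I Y"
proof -
  define xs where "xs = sorted_list_of_set I"
  have m: "m \<notin> I" using assms(2) by blast
  have len: "length xs = card I" by (simp add: xs_def)
  have "gauss_multinomial h (insert m I) Y =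
    (\<Prod>k=1..Suc (card I). gauss_binomial ((xs @ [m, h]) !\<^sub>1 (k + 1)) ((xs @ [m, h]) !\<^sub>1 k) Y)"
    unfolding gauss_multinomial_def Let_def sorted_list_of_set_insert_max[OF assms] card_insert_disjoint[OF assms(1) m]
    by (simp add: xs_def)
  also have "\<dots> = (\<Prod>k=1..card I. gauss_binomial ((xs @ [m, h]) !\<^sub>1 (k + 1)) ((xs @ [m, h]) !\<^sub>1 k) Y) * gauss_binomial h m Y"
    using len by (simp add: nth_append)
  also have "(\<Prod>k=1..card I. gauss_binomial ((xs @ [m, h]) !\<^sub>1 (k + 1)) ((xs @ [m, h]) !\<^sub>1 k) Y) =
    (\<Prod>k=1..card I. gauss_binomial ((xs @ [m]) !\<^sub>1 (k + 1)) ((xs @ [m]) !\<^sub>1 k) Y)"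
    by (intro prod.cong) (auto simp: nth_append len)
  also have "\<dots> = gauss_multinomial m I Y"
    by (simp add: gauss_multinomial_def Let_def xs_def)
  finally show ?thesis by simp
qed

text \<open>Between consecutive elements \<open>a < b\<close> of the index set, extended by 0 and
  \<open>h\<close>, \<open>next_in\<close> is constantly \<open>b\<close>, and the factors multiply
  to \<open>qfact (b - a)\<close>. So the right-hand side is the familiar quotient of q-factorials,
  written position by position in the form in which the subgroup count delivers it. The induction
  removes the largest element, that is, the outermost binomial.\<close>

lemma gauss_multinomial_next:
  fixes Y :: "'a::field"
  assumes "finite I" "\<forall>i\<in>I. i < h" "\<And>k. k \<ge> 1 \<Longrightarrow> Y ^ k \<noteq> 1"
  shows "gauss_multinomial h I Y = qfact h Y / (\<Prod>k=1..h. 1 - Y ^ (next_in (insert h I) k + 1 - k))"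
  using assms(1,2)
proof (induction I arbitrary: h rule: finite_linorder_max_induct)
  case empty
  have "next_in {h} k = h" if "k \<in> {1..h}" for k
  proof -
    have "{c \<in> {h}. k \<le> c} = {h}" using that by auto
    thus ?thesis by (simp add: next_in_def)
  qed
  hence "(\<Prod>k=1..h. 1 - Y ^ (next_in {h} k + 1 - k)) = (\<Prod>k=0+1..h. 1 - Y ^ (h + 1 - k))"
    by (intro prod.cong) auto
  thus ?case using qfact_rev[of 0 h Y] qfact_nonzero[OF assms(3)]
    by (simp add: gauss_multinomial_def Let_def)
next
  case (insert m I)
  have mh: "m < h" using insert.prems by simp
  have low: "next_in (insert h (insert m I)) k = next_in (insert m I) k" if "k \<in> {1..m}" for k
  proof -
    define C where "C = {c \<in> insert m I. k \<le> c}"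
    have C: "finite C" "C \<noteq> {}" using insert.hyps that by (auto simp: C_def)
    have "{c \<in> insert h (insert m I). k \<le> c} = insert h C" using mh that by (auto simp: C_def)
    moreover have "Min C \<le> h" using C mh insert.hyps that by (intro order.trans[OF Min_le[of C m]]) (auto simp: C_def)
    moreover have "next_in (insert m I) k = Min C" by (simp only: next_in_def C_def)
    ultimately show ?thesis using C by (simp add: next_in_def)
  qed
  have high: "next_in (insert h (insert m I)) k = h" if "k \<in> {m+1..h}" for k
  proof -
    have "\<not> k \<le> c" if "c \<in> insert m I" for c
    proof -
      have "c \<le> m" using that insert.hyps by auto
      thus ?thesis using \<open>k \<in> {m+1..h}\<close> by simp
    qed
    hence "{c \<in> insert h (insert m I). k \<le> c} = {h}" using that by auto
    thus ?thesis by (simp add: next_in_def)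
  qed
  have "(\<Prod>k=1..h. 1 - Y ^ (next_in (insert h (insert m I)) k + 1 - k)) =
    (\<Prod>k=1..m. 1 - Y ^ (next_in (insert h (insert m I)) k + 1 - k)) *
    (\<Prod>k=m+1..h. 1 - Y ^ (next_in (insert h (insert m I)) k + 1 - k))"
    using mh by (intro prod_split_at) simp
  also have "\<dots> = (\<Prod>k=1..m. 1 - Y ^ (next_in (insert m I) k + 1 - k)) * (\<Prod>k=m+1..h. 1 - Y ^ (h + 1 - k))"
    using low high by (intro arg_cong2[where f = "(*)"] prod.cong) auto
  also have "(\<Prod>k=m+1..h. 1 - Y ^ (h + 1 - k)) = qfact (h - m) Y" using mh by (intro qfact_rev) simp
  finally have eq: "(\<Prod>k=1..h. 1 - Y ^ (next_in (insert h (insert m I)) k + 1 - k)) =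
    (\<Prod>k=1..m. 1 - Y ^ (next_in (insert m I) k + 1 - k)) * qfact (h - m) Y" .
  have "gauss_multinomial h (insert m I) Y = gauss_binomial h m Y * gauss_multinomial m I Y"
    using insert.hyps by (intro gauss_multinomial_insert_max) auto
  also have "gauss_multinomial m I Y = qfact m Y / (\<Prod>k=1..m. 1 - Y ^ (next_in (insert m I) k + 1 - k))"
    using insert.hyps by (intro insert.IH) auto
  also have "gauss_binomial h m Y = qfact h Y / (qfact m Y * qfact (h - m) Y)"
    using mh assms(3) by (intro gauss_binomial_qfact) auto
  finally show ?case unfolding eq using qfact_nonzero[of Y m, OF assms(3)] by simp
qed

section \<open>Weak orderings\<close>

lemma down_closed_eq_interval:
  fixes Q :: "nat set"
  assumes "Q \<subseteq> {1..g}" "\<And>a b. b \<in> Q \<Longrightarrow> 1 \<le> a \<Longrightarrow> a \<le> b \<Longrightarrow> a \<in> Q"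
  shows "Q = {1..card Q}"
proof -
  have fin: "finite Q" using assms(1) finite_subset by blast
  have "b \<le> card Q" if "b \<in> Q" for b
  proof -
    have "{1..b} \<subseteq> Q" using assms(2)[OF that] by auto
    from card_mono[OF fin this] show ?thesis by simp
  qed
  hence "Q \<subseteq> {1..card Q}" using assms(1) by fastforce
  thus ?thesis using fin by (simp add: card_subset_eq)
qed

text \<open>Existence comes from sorting by the key \<open>h\<close>. For uniqueness, any such
  permutation lists the keys as the one strictly increasing enumeration of their set, and the keys
  are distinct.\<close>

lemma sorting_permutation:
  fixes h :: "nat \<Rightarrow> nat"
  assumes "inj_on h {1..g}"
  shows "\<exists>!\<sigma>. \<sigma> permutes {1..g} \<and> (\<forall>j\<in>{1..g-1}. h (\<sigma> j) < h (\<sigma> (j + 1)))"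
proof (rule ex_ex1I)
  define xs where "xs = sort_key h [1..<g + 1]"
  have xs: "length xs = g" "set xs = {1..g}" "distinct xs"
    by (auto simp: xs_def)
  have srt: "sorted (map h xs)" by (simp add: xs_def)
  define \<sigma> where "\<sigma> i = (if i \<in> {1..g} then xs ! (i - 1) else i)" for i
  have inj: "inj_on \<sigma> {1..g}"
    using xs by (auto simp: inj_on_def \<sigma>_def nth_eq_iff_index_eq)
  have "\<sigma> ` {1..g} \<subseteq> {1..g}"
  proof
    fix y assume "y \<in> \<sigma> ` {1..g}"
    then obtain i where "i \<in> {1..g}" "y = xs ! (i - 1)" by (auto simp: \<sigma>_def)
    moreover from this have "xs ! (i - 1) \<in> set xs" using xs by (intro nth_mem) auto
    ultimately show "y \<in> {1..g}" using xs by simp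
  qed
  hence im: "\<sigma> ` {1..g} = {1..g}" using inj by (simp add: endo_inj_surj)
  have perm: "\<sigma> permutes {1..g}"
    using inj im by (intro bij_imp_permutes) (auto simp: bij_betw_def \<sigma>_def)
  have "h (\<sigma> j) < h (\<sigma> (j + 1))" if j: "j \<in> {1..g-1}" for j
  proof -
    have jj: "j \<in> {1..g}" "j + 1 \<in> {1..g}" using j by auto
    have "map h xs ! (j - 1) \<le> map h xs ! j"
      using jj xs by (intro sorted_nth_mono[OF srt]) auto
    hence "h (\<sigma> j) \<le> h (\<sigma> (j + 1))" using jj xs by (simp add: \<sigma>_def)
    moreover have "\<sigma> j \<noteq> \<sigma> (j + 1)" using inj_onD[OF inj _ jj] by fastforce
    moreover have "\<sigma> j \<in> {1..g}" "\<sigma> (j + 1) \<in> {1..g}" using jj im by blast+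
    ultimately show ?thesis using inj_onD[OF assms] by (metis le_neq_implies_less)
  qed
  thus "\<exists>\<sigma>. \<sigma> permutes {1..g} \<and> (\<forall>j\<in>{1..g-1}. h (\<sigma> j) < h (\<sigma> (j + 1)))" using perm by blast
next
  fix \<sigma> \<tau>
  assume s: "\<sigma> permutes {1..g} \<and> (\<forall>j\<in>{1..g-1}. h (\<sigma> j) < h (\<sigma> (j + 1)))"
    and t: "\<tau> permutes {1..g} \<and> (\<forall>j\<in>{1..g-1}. h (\<tau> j) < h (\<tau> (j + 1)))"
  have key: "map (\<lambda>i. h (\<rho> i)) [1..<g + 1] = sorted_list_of_set (h ` {1..g})"
    if r: "\<rho> permutes {1..g} \<and> (\<forall>j\<in>{1..g-1}. h (\<rho> j) < h (\<rho> (j + 1)))" for \<rho>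
  proof -
    have "sorted_wrt (<) (map (\<lambda>i. h (\<rho> i)) [1..<g + 1])"
      unfolding sorted_wrt_iff_nth_Suc_transp[OF transp_on_less]
    proof (intro allI impI)
      fix i assume "Suc i < length (map (\<lambda>i. h (\<rho> i)) [1..<g + 1])"
      hence i: "i + 1 \<in> {1..g-1}" "Suc i < g" by (auto simp del: upt_Suc)
      have "h (\<rho> (i + 1)) < h (\<rho> (i + 1 + 1))" using r i(1) by blast
      thus "map (\<lambda>i. h (\<rho> i)) [1..<g + 1] ! i < map (\<lambda>i. h (\<rho> i)) [1..<g + 1] ! Suc i"
        using i(2) by (simp del: upt_Suc)
    qed
    moreover have "set (map (\<lambda>i. h (\<rho> i)) [1..<g + 1]) = h ` {1..g}"
    proof -
      have "\<rho> ` {1..g} = {1..g}" using r permutes_image by blast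
      moreover have "set [1..<g + 1] = {1..g}" by auto
      ultimately show ?thesis by (metis image_image list.set_map)
    qed
    ultimately show ?thesis
      by (metis strict_sorted_equal sorted_list_of_set.strict_sorted_key_list_of_set finite_imageI finite_atLeastAtMost set_sorted_list_of_set)
  qed
  show "\<sigma> = \<tau>"
  proof
    fix i
    show "\<sigma> i = \<tau> i"
    proof (cases "i \<in> {1..g}")
      case True
      have "map (\<lambda>i. h (\<sigma> i)) [1..<g + 1] = map (\<lambda>i. h (\<tau> i)) [1..<g + 1]" using key[OF s] key[OF t] by simp
      hence "\<forall>i\<in>set [1..<g + 1]. h (\<sigma> i) = h (\<tau> i)" by (simp only: map_eq_conv)
      moreover have "i \<in> set [1..<g + 1]" using True by auto
      ultimately have "h (\<sigma> i) = h (\<tau> i)" by blast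
      moreover have "\<sigma> i \<in> {1..g}" "\<tau> i \<in> {1..g}"
        using True permutes_in_image[OF conjunct1[OF s], of i] permutes_in_image[OF conjunct1[OF t], of i] by blast+
      ultimately show ?thesis using inj_onD[OF assms] by blast
    next
      case False
      thus ?thesis using s t permutes_not_in by metis
    qed
  qed
qed

text \<open>A weak ordering whose descent set lies in \<open>J\<close> lists ties in increasing order, so it sorts
  the pairs \<open>(- E k, k)\<close> lexicographically; the key below encodes these pairs as natural numbers.\<close>

lemma weak_ordering_of_props:
  fixes l :: "nat list" and f :: "nat \<Rightarrow> nat"
  defines "E \<equiv> \<lambda>k. l !\<^sub>1 (psum f k)"
  assumes v: "weak_ordering_of g f l = (\<sigma>, J)"
  shows "(\<sigma>, J) \<in> weak_orderings g" "\<sigma> permutes {1..g}"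
    "\<And>i j. 1 \<le> i \<Longrightarrow> i \<le> j \<Longrightarrow> j \<le> g \<Longrightarrow> E (\<sigma> i) \<ge> E (\<sigma> j)"
    "J = {j\<in>{1..g-1}. E (\<sigma> j) > E (\<sigma> (j + 1))}"
proof -
  define B where "B = (\<Sum>k=1..g. E k)"
  define h where "h k = (B - E k) * (g + 1) + k" for k
  have EB: "E k \<le> B" if "k \<in> {1..g}" for k
    unfolding B_def using that by (intro member_le_sum) auto
  have hmod: "h k mod (g + 1) = k" if "k \<in> {1..g}" for k
  proof -
    have "h k mod (g + 1) = k mod (g + 1)" unfolding h_def by (rule mod_mult_self3)
    thus ?thesis using that by simp
  qed
  have inj: "inj_on h {1..g}"
  proof (rule inj_onI)
    fix a b assume "a \<in> {1..g}" "b \<in> {1..g}" "h a = h b"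
    thus "a = b" using hmod[of a] hmod[of b] by simp
  qed
  have hless: "h a < h b \<longleftrightarrow> E b < E a \<or> (E a = E b \<and> a < b)" if ab: "a \<in> {1..g}" "b \<in> {1..g}" for a b
  proof -
    have lt: "h a < h b" if "B - E a < B - E b" "a \<in> {1..g}" "b \<in> {1..g}" for a b
    proof -
      have "h a < (B - E a + 1) * (g + 1)" using that by (simp add: h_def)
      also have "\<dots> \<le> (B - E b) * (g + 1)" using that by (intro mult_right_mono) auto
      also have "\<dots> \<le> h b" by (simp add: h_def)
      finally show ?thesis .
    qed
    consider "E b < E a" | "E a < E b" | "E a = E b" by linarith
    thus ?thesis
    proof cases
      case 1
      hence "B - E a < B - E b" using EB[OF ab(1)] by linarith
      thus ?thesis using lt[of a b] 1 ab by simp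
    next
      case 2
      hence "B - E b < B - E a" using EB[OF ab(2)] by linarith
      hence "h b < h a" using lt[of b a] ab by simp
      thus ?thesis using 2 by simp
    next
      case 3
      thus ?thesis by (simp add: h_def)
    qed
  qed
  define C where "C v \<longleftrightarrow> v \<in> weak_orderings g \<and>
       (case v of (\<sigma>, J) \<Rightarrow>
          (\<forall>j\<in>{1..g-1}. E (\<sigma> j) \<ge> E (\<sigma> (j + 1))) \<and>
          J = {j\<in>{1..g-1}. E (\<sigma> j) > E (\<sigma> (j + 1))})" for v
  have C_iff: "C (\<tau>, K) \<longleftrightarrow> (\<tau> permutes {1..g} \<and> (\<forall>j\<in>{1..g-1}. h (\<tau> j) < h (\<tau> (j + 1)))) \<and>
      K = {j\<in>{1..g-1}. E (\<tau> j) > E (\<tau> (j + 1))}" for \<tau> K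
  proof (cases "\<tau> permutes {1..g} \<and> K = {j\<in>{1..g-1}. E (\<tau> j) > E (\<tau> (j + 1))}")
    case True
    have step: "h (\<tau> j) < h (\<tau> (j + 1)) \<longleftrightarrow>
        E (\<tau> j) \<ge> E (\<tau> (j + 1)) \<and> (\<tau> j > \<tau> (j + 1) \<longrightarrow> j \<in> K)" if j: "j \<in> {1..g-1}" for j
    proof -
      have jj: "j \<in> {1..g}" "j + 1 \<in> {1..g}" using j by auto
      have "\<tau> j \<in> {1..g}" "\<tau> (j + 1) \<in> {1..g}"
        using jj permutes_in_image[OF conjunct1[OF True]] by blast+
      moreover have "\<tau> j \<noteq> \<tau> (j + 1)" using injD[OF permutes_inj[OF conjunct1[OF True]], of j "j + 1"] by auto
      ultimately show ?thesis using hless[of "\<tau> j" "\<tau> (j + 1)"] True j by auto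
    qed
    have "C (\<tau>, K) \<longleftrightarrow> (\<forall>j\<in>{1..g-1}. E (\<tau> j) \<ge> E (\<tau> (j + 1)) \<and> (\<tau> j > \<tau> (j + 1) \<longrightarrow> j \<in> K))"
      using True by (auto simp: C_def weak_orderings_def Des_def)
    also have "\<dots> \<longleftrightarrow> (\<forall>j\<in>{1..g-1}. h (\<tau> j) < h (\<tau> (j + 1)))"
      using step by blast
    finally show ?thesis using True by blast
  next
    case False
    thus ?thesis by (auto simp: C_def weak_orderings_def)
  qed
  obtain \<tau> where \<tau>: "\<tau> permutes {1..g} \<and> (\<forall>j\<in>{1..g-1}. h (\<tau> j) < h (\<tau> (j + 1)))"
    and uniq: "\<And>\<rho>. \<rho> permutes {1..g} \<and> (\<forall>j\<in>{1..g-1}. h (\<rho> j) < h (\<rho> (j + 1))) \<Longrightarrow> \<rho> = \<tau>"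
    using sorting_permutation[OF inj] by blast
  define K where "K = {j\<in>{1..g-1}. E (\<tau> j) > E (\<tau> (j + 1))}"
  have "C (\<tau>, K)" using \<tau> K_def C_iff by blast
  moreover have "v = (\<tau>, K)" if "C v" for v
  proof -
    obtain \<rho> K' where vv: "v = (\<rho>, K')" by (metis surj_pair)
    have "\<rho> = \<tau>" using that uniq unfolding vv C_iff by blast
    thus ?thesis using that unfolding vv C_iff K_def by blast
  qed
  ultimately have "(THE v. C v) = (\<tau>, K)" by (rule the_equality)
  moreover have "weak_ordering_of g f l = (THE v. C v)"
    unfolding weak_ordering_of_def C_def E_def ..
  ultimately have "(\<sigma>, J) = (\<tau>, K)" using v by simp
  hence CC: "C (\<sigma>, J)" using \<open>C (\<tau>, K)\<close> by simp
  have C': "(\<sigma>, J) \<in> weak_orderings g \<and> (\<forall>j\<in>{1..g-1}. E (\<sigma> j) \<ge> E (\<sigma> (j + 1))) \<and>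
      J = {j\<in>{1..g-1}. E (\<sigma> j) > E (\<sigma> (j + 1))}"
    using CC unfolding C_def prod.case .
  show "(\<sigma>, J) \<in> weak_orderings g" using C' by (rule conjunct1)
  show "\<sigma> permutes {1..g}" using CC C_iff by blast
  show "J = {j\<in>{1..g-1}. E (\<sigma> j) > E (\<sigma> (j + 1))}" using C' by blast
  show "E (\<sigma> i) \<ge> E (\<sigma> j)" if "1 \<le> i" "i \<le> j" "j \<le> g" for i j
    using that(2,3)
  proof (induction j rule: dec_induct)
    case (step m)
    have "m \<in> {1..g-1}" using step that(1) by auto
    hence "E (\<sigma> m) \<ge> E (\<sigma> (m + 1))" using C' by blast
    thus ?case using step by simp
  qed simp
qed

section \<open>Set partitions induced by weak orderings\<close>

lemma permutes_image_interval_diff: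
  assumes "\<sigma> permutes S" "a \<le> (b::nat)"
  shows "\<sigma> ` {1..b} - \<sigma> ` {1..a} = \<sigma> ` {a + 1..b}"
proof -
  have inj: "inj \<sigma>" using assms permutes_inj by blast
  have "{1..b} - {1..a} = {a + 1..b}" using assms(2) by auto
  thus ?thesis using image_set_diff[OF inj, of "{1..b}" "{1..a}"] by simp
qed

text \<open>Eliminates the permutation: it lists the blocks by descending values of
  \<open>E\<close>, with \<open>J\<close> marking the strict drops. Hence the
  \<open>A !\<^sub>1 i\<close> are consecutive runs separated by drops exactly if every value on the
  initial union \<open>P i\<close> exceeds every value outside it.\<close>

lemma is_induced_partition_iff:
  fixes l :: "nat list" and f :: "nat \<Rightarrow> nat" and P :: "nat \<Rightarrow> nat set"
  defines "E \<equiv> \<lambda>k. l !\<^sub>1 (psum f k)"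
  assumes A: "A \<in> compatible_partitions n g f w" and len: "length A = r"
    and P0: "P 0 = {}" and Pr: "P r = {1..g}" and Pmono: "\<And>i. i \<in> {1..r} \<Longrightarrow> P (i - 1) \<subset> P i"
    and AP: "\<And>i. i \<in> {1..r} \<Longrightarrow> A !\<^sub>1 i = P i - P (i - 1)"
  shows "is_induced_partition n g f w (weak_ordering_of g f l) A \<longleftrightarrow>
    (\<forall>i\<in>{1..<r}. \<forall>q\<in>P i. \<forall>q'\<in>{1..g} - P i. E q' < E q)"
proof -
  obtain \<sigma> J where v: "weak_ordering_of g f l = (\<sigma>, J)" by (metis surj_pair)
  have Ek: "E k = l !\<^sub>1 (psum f k)" for k by (simp add: E_def)
  note wo = weak_ordering_of_props[OF v, folded Ek]
  have inj: "inj \<sigma>" using wo(2) permutes_inj by blast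
  have Ple: "P i \<subseteq> P j" if "i \<le> j" "j \<le> r" for i j
    using that
  proof (induction j rule: dec_induct)
    case (step m)
    have "Suc m \<in> {1..r}" using step by simp
    from Pmono[OF this] show ?case using step by auto
  qed simp
  have Pg: "P i \<subseteq> {1..g}" if "i \<le> r" for i using Ple[OF that] Pr by simp
  show ?thesis
  proof
    assume "is_induced_partition n g f w (weak_ordering_of g f l) A"
    then obtain r' t where t: "cuts g r' t" "t ` {1..<r'} \<subseteq> J"
      and At: "A = map (\<lambda>k. \<sigma> ` {t (k - 1) + 1..t k}) [1..<r' + 1]"
      by (auto simp: is_induced_partition_def v)
    have r': "r' = r" using arg_cong[OF At, of length] len by (simp del: upt_Suc)
    have Ai: "A !\<^sub>1 i = \<sigma> ` {t (i - 1) + 1..t i}" if "i \<in> {1..r}" for i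
      using that unfolding At r' by (auto simp del: upt_Suc)
    have Pt: "P i = \<sigma> ` {1..t i}" if "i \<le> r" for i
      using that
    proof (induction i)
      case 0
      thus ?case using P0 t by (simp add: cuts_def)
    next
      case (Suc i)
      have S: "Suc i \<in> {1..r}" using Suc by simp
      have tt: "t i \<le> t (Suc i)" using cuts_less[OF t(1), of i "Suc i"] Suc.prems r' by simp
      have "P (Suc i) = P i \<union> A !\<^sub>1 (Suc i)" using AP[OF S] Pmono[OF S] by auto
      also have "\<dots> = \<sigma> ` ({1..t i} \<union> {t i + 1..t (Suc i)})" using Suc Ai[OF S] by (simp add: image_Un)
      also have "{1..t i} \<union> {t i + 1..t (Suc i)} = {1..t (Suc i)}" using tt by auto
      finally show ?case .
    qed
    show "\<forall>i\<in>{1..<r}. \<forall>q\<in>P i. \<forall>q'\<in>{1..g} - P i. E q' < E q"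
    proof (intro ballI)
      fix i q q' assume i: "i \<in> {1..<r}" and q: "q \<in> P i" and q': "q' \<in> {1..g} - P i"
      obtain a where a: "a \<in> {1..t i}" "q = \<sigma> a" using q Pt[of i] i by auto
      have "q' \<in> \<sigma> ` {1..g}" using q' permutes_image[OF wo(2)] by simp
      then obtain b where b: "b \<in> {1..g}" "q' = \<sigma> b" by blast
      have "b \<notin> {1..t i}" using q' Pt[of i] i b by auto
      hence bt: "t i < b" using b by auto
      have "t i \<in> J" using t(2) i r' by blast
      hence "E (\<sigma> (t i + 1)) < E (\<sigma> (t i))" "t i \<in> {1..g-1}" using wo(4) by blast+
      moreover have "E (\<sigma> b) \<le> E (\<sigma> (t i + 1))" using bt b by (intro wo(3)) auto
      moreover have "E (\<sigma> (t i)) \<le> E (\<sigma> a)" using a \<open>t i \<in> {1..g-1}\<close> by (intro wo(3)) auto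
      ultimately show "E q' < E q" using a b by simp
    qed
  next
    assume up: "\<forall>i\<in>{1..<r}. \<forall>q\<in>P i. \<forall>q'\<in>{1..g} - P i. E q' < E q"
    define t where "t i = card (P i)" for i
    have finP: "finite (P i)" if "i \<le> r" for i using finite_subset[OF Pg[OF that]] by simp
    have cut: "cuts g r t"
      unfolding cuts_def
    proof (intro conjI ballI)
      fix i assume i: "i \<in> {1..r}"
      show "t (i - 1) < t i" unfolding t_def
        using i by (intro psubset_card_mono Pmono[OF i] finP) auto
    qed (simp_all add: t_def P0 Pr)
    have Pt: "P i = \<sigma> ` {1..t i}" if ir: "i \<le> r" for i
    proof -
      define Q where "Q = {a \<in> {1..g}. \<sigma> a \<in> P i}"
      have sQ: "\<sigma> ` Q = P i"
      proof
        show "P i \<subseteq> \<sigma> ` Q"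
        proof
          fix q assume q: "q \<in> P i"
          hence "q \<in> \<sigma> ` {1..g}" using Pg[OF ir] permutes_image[OF wo(2)] by auto
          thus "q \<in> \<sigma> ` Q" using q by (auto simp: Q_def)
        qed
      qed (auto simp: Q_def)
      have "card Q = t i" unfolding t_def sQ[symmetric]
        using inj by (metis card_image inj_on_subset subset_UNIV)
      \<comment> \<open>The positions sent into \<open>P i\<close> are closed downwards: an earlier
        position has a value of \<open>E\<close> at least as large, while a block outside
        \<open>P i\<close> would have a strictly smaller one.\<close>
      moreover have "Q = {1..card Q}"
      proof (rule down_closed_eq_interval)
        show "Q \<subseteq> {1..g}" by (auto simp: Q_def)
        fix a b assume b: "b \<in> Q" and ab: "1 \<le> a" "a \<le> b"
        have bg: "b \<le> g" "\<sigma> b \<in> P i" using b by (auto simp: Q_def)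
        have sa: "\<sigma> a \<in> {1..g}" using ab bg permutes_in_image[OF wo(2)] by simp
        show "a \<in> Q"
        proof (rule ccontr)
          assume "a \<notin> Q"
          hence na: "\<sigma> a \<notin> P i" using ab bg by (simp add: Q_def)
          have "i \<noteq> 0"
          proof
            assume "i = 0"
            thus False using P0 bg(2) by simp
          qed
          moreover have "i \<noteq> r"
          proof
            assume "i = r"
            thus False using Pr na sa by simp
          qed
          ultimately have "i \<in> {1..<r}" using ir by simp
          hence "E (\<sigma> a) < E (\<sigma> b)" using up bg(2) sa na by blast
          thus False using wo(3)[OF ab bg(1)] by simp
        qed
      qed
      ultimately show ?thesis using sQ by simp
    qed
    have "A = map (\<lambda>k. \<sigma> ` {t (k - 1) + 1..t k}) [1..<r + 1]"
    proof (rule nth_equalityI)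
      show "length A = length (map (\<lambda>k. \<sigma> ` {t (k - 1) + 1..t k}) [1..<r + 1])" using len by simp
      fix j assume "j < length A"
      hence j: "j < r" "Suc j \<in> {1..r}" using len by auto
      have "A ! j = P (Suc j) - P j" using AP[OF j(2)] by simp
      also have "\<dots> = \<sigma> ` {t j + 1..t (Suc j)}"
        using Pt[of "Suc j"] Pt[of j] j cuts_less[OF cut, of j "Suc j"]
        by (simp add: permutes_image_interval_diff[OF wo(2), of "t j" "t (Suc j)", simplified])
      finally show "A ! j = map (\<lambda>k. \<sigma> ` {t (k - 1) + 1..t k}) [1..<r + 1] ! j"
        using j by (simp del: upt_Suc)
    qed
    moreover have "t ` {1..<r} \<subseteq> J"
    proof
      fix x assume "x \<in> t ` {1..<r}"
      then obtain i where i: "i \<in> {1..<r}" "x = t i" by blast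
      have tlt: "0 < t i" "t i < g"
        using cuts_less[OF cut, of 0 i] cuts_less[OF cut, of i r] i cut by (auto simp: cuts_def)
      have "\<sigma> (t i) \<in> P i" using Pt[of i] i tlt by simp
      moreover have "\<sigma> (t i + 1) \<notin> P i"
      proof
        assume "\<sigma> (t i + 1) \<in> P i"
        hence "\<sigma> (t i + 1) \<in> \<sigma> ` {1..t i}" using Pt[of i] i by simp
        then obtain a where a: "a \<in> {1..t i}" "\<sigma> (t i + 1) = \<sigma> a" by blast
        have "t i + 1 = a" using injD[OF inj a(2)] .
        thus False using a(1) by simp
      qed
      moreover have "\<sigma> (t i + 1) \<in> {1..g}" using tlt permutes_in_image[OF wo(2)] by simp
      ultimately have "E (\<sigma> (t i + 1)) < E (\<sigma> (t i))" using up i(1) by blast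
      moreover have "t i \<in> {1..g-1}" using tlt by auto
      ultimately show "x \<in> J" unfolding wo(4) i(2) by blast
    qed
    ultimately show "is_induced_partition n g f w (weak_ordering_of g f l) A"
      unfolding is_induced_partition_def v using cut A by auto
  qed
qed

text \<open>The word fixes the numbers \<open>L i\<close>, and \<open>t i\<close> must satisfy
  \<open>F (t i) = L i\<close>, where \<open>F\<close> sums the block sizes along the permutation.
  Positive block sizes make \<open>F\<close> strictly increasing, so \<open>t\<close> is determined.
  This justifies the definite description in \<open>induced_partition\<close>.\<close>

lemma is_induced_partition_unique:
  assumes f: "\<forall>i\<in>{1..g}. 1 \<le> f i"
    and \<sigma>: "\<sigma> permutes {1..g}"
    and A: "is_induced_partition n g f w (\<sigma>, J) A" and A': "is_induced_partition n g f w (\<sigma>, J) A'"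
  shows "A = A'"
proof -
  obtain r t where t: "cuts g r t" and At: "A = map (\<lambda>k. \<sigma> ` {t (k - 1) + 1..t k}) [1..<r + 1]"
    and Ac: "A \<in> compatible_partitions n g f w"
    using A by (auto simp: is_induced_partition_def)
  obtain r' t' where t': "cuts g r' t'" and At': "A' = map (\<lambda>k. \<sigma> ` {t' (k - 1) + 1..t' k}) [1..<r' + 1]"
    and Ac': "A' \<in> compatible_partitions n g f w"
    using A' by (auto simp: is_induced_partition_def)
  obtain s L M where c: "cuts n s L" "cuts n s M" "w = block_word s L M" "length A = s"
    and cs: "\<And>i. i \<in> {1..s} \<Longrightarrow> (\<Sum>j\<in>A !\<^sub>1 i. f j) = L i - L (i - 1)"
    using Ac by (auto simp: compatible_partitions_def)
  obtain s' L' M' where c': "cuts n s' L'" "cuts n s' M'" "w = block_word s' L' M'" "length A' = s'"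
    and cs': "\<And>i. i \<in> {1..s'} \<Longrightarrow> (\<Sum>j\<in>A' !\<^sub>1 i. f j) = L' i - L' (i - 1)"
    using Ac' by (auto simp: compatible_partitions_def)
  have eqw: "block_word s L M = block_word s' L' M'" using c(3) c'(3) by simp
  have ss: "s = s'" by (rule block_word_inject(1)[OF c(1,2) c'(1,2) eqw])
  have LL: "L i = L' i" if "i \<le> s" for i by (rule block_word_inject(2)[OF c(1,2) c'(1,2) eqw that])
  have rs: "r = s" "r' = s"
    using arg_cong[OF At, of length] arg_cong[OF At', of length] c(4) c'(4) ss by (simp_all del: upt_Suc)
  have inj: "inj \<sigma>" using \<sigma> permutes_inj by blast
  define F where "F k = (\<Sum>a=1..k. f (\<sigma> a))" for k
  have Fless: "F a < F b" if "a < b" "b \<le> g" for a b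
  proof -
    have "{1..b} = {1..a} \<union> {a+1..b}" using that by auto
    hence "F b = F a + (\<Sum>k=a+1..b. f (\<sigma> k))"
      unfolding F_def by (subst sum.union_disjoint[symmetric]) auto
    moreover have "f (\<sigma> b) \<le> (\<Sum>k=a+1..b. f (\<sigma> k))"
      using that by (intro member_le_sum) auto
    moreover have "1 \<le> f (\<sigma> b)" using f that permutes_in_image[OF \<sigma>, of b] by simp
    ultimately show ?thesis by linarith
  qed
  have FL: "F (u i) = K i"
    if u: "cuts g s u" and K: "cuts n s K" and "i \<le> s"
      and B: "\<And>i. i \<in> {1..s} \<Longrightarrow> (\<Sum>j\<in>\<sigma> ` {u (i - 1) + 1..u i}. f j) = K i - K (i - 1)" for u K i
    using \<open>i \<le> s\<close>
  proof (induction i)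
    case 0
    show ?case using u K by (simp add: cuts_def F_def)
  next
    case (Suc i)
    have le: "u i < u (Suc i)" "K i < K (Suc i)"
      using cuts_less[OF u, of i "Suc i"] cuts_less[OF K, of i "Suc i"] Suc.prems by auto
    have "{1..u (Suc i)} = {1..u i} \<union> {u i + 1..u (Suc i)}" using le by auto
    hence "F (u (Suc i)) = F (u i) + (\<Sum>a=u i + 1..u (Suc i). f (\<sigma> a))"
      unfolding F_def by (subst sum.union_disjoint[symmetric]) auto
    also have "(\<Sum>a=u i + 1..u (Suc i). f (\<sigma> a)) = (\<Sum>j\<in>\<sigma> ` {u i + 1..u (Suc i)}. f j)"
      using inj by (subst sum.reindex) (auto intro: inj_on_subset)
    also have "\<dots> = K (Suc i) - K i" using B[of "Suc i"] Suc.prems by simp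
    finally show ?case using Suc le by simp
  qed
  have Ai: "A !\<^sub>1 i = \<sigma> ` {t (i - 1) + 1..t i}" "A' !\<^sub>1 i = \<sigma> ` {t' (i - 1) + 1..t' i}" if "i \<in> {1..s}" for i
    using that unfolding At At' rs by (auto simp del: upt_Suc)
  have "t i = t' i" if "i \<le> s" for i
  proof -
    have "F (t i) = L i" using FL[OF t[unfolded rs] c(1) that] cs Ai(1) by simp
    moreover have "F (t' i) = L' i" using FL[OF t'[unfolded rs] c'(1)[folded ss] that] cs' Ai(2) ss by simp
    moreover have "t i \<le> g" "t' i \<le> g" using cuts_le_n[OF t] cuts_le_n[OF t'] that rs by auto
    ultimately show ?thesis using LL[OF that] Fless[of "t i" "t' i"] Fless[of "t' i" "t i"]
      by (cases "t i" "t' i" rule: linorder_cases) auto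
  qed
  thus ?thesis unfolding At At' rs
    by (intro map_cong refl) (auto simp del: upt_Suc)
qed

section \<open>Level sets of a tuple and a partition\<close>

text \<open>Rebuilds an admissible tuple from one value per block; on admissible tuples this inverts
  the reading of the entry at the end of each block.\<close>

definition block_list :: "nat \<Rightarrow> (nat \<Rightarrow> nat) \<Rightarrow> (nat \<Rightarrow> nat) \<Rightarrow> nat list"
  where "block_list g f e = concat (map (\<lambda>k. replicate (f k) (e k)) [1..<g + 1])"

lemma block_list_Suc: "block_list (Suc g) f e = block_list g f e @ replicate (f (Suc g)) (e (Suc g))"
  by (simp add: block_list_def)

lemma length_block_list: "length (block_list g f e) = psum f g"
  by (induction g) (simp_all add: block_list_Suc psum_def, simp add: block_list_def)

lemma psum_Suc: "psum f (Suc g) = psum f g + f (Suc g)"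
  by (simp add: psum_def)

lemma nth_block_list:
  assumes "k \<in> {1..g}" "psum f (k - 1) < i" "i \<le> psum f k"
  shows "block_list g f e !\<^sub>1 i = e k"
  using assms
proof (induction g)
  case (Suc g)
  show ?case
  proof (cases "k = Suc g")
    case True
    have "\<not> i - 1 < psum f g" "i - 1 - psum f g < f (Suc g)"
      using Suc.prems unfolding True by (auto simp: psum_Suc)
    thus ?thesis unfolding True block_list_Suc nth_append length_block_list by simp
  next
    case False
    hence k: "k \<in> {1..g}" using Suc.prems by auto
    have "psum f k \<le> psum f g" using k unfolding psum_def by (intro sum_mono2) auto
    hence "i - 1 < psum f g" using Suc.prems(2,3) by linarith
    thus ?thesis using Suc.IH[OF k Suc.prems(2,3)]
      by (simp add: block_list_Suc nth_append length_block_list)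
  qed
qed simp

lemma cuts_psum:
  assumes "\<forall>i\<in>{1..g}. 1 \<le> f i"
  shows "cuts (psum f g) g (psum f)"
  unfolding cuts_def
proof (intro conjI ballI)
  fix i assume i: "i \<in> {1..g}"
  obtain j where "i = Suc j" using i by (cases i) auto
  moreover have "1 \<le> f i" using assms i by blast
  ultimately show "psum f (i - 1) < psum f i" by (simp add: psum_Suc)
qed (simp_all add: psum_def)

lemma nth_block_list_psum:
  assumes "\<forall>i\<in>{1..g}. 1 \<le> f i" "k \<in> {1..g}"
  shows "block_list g f e !\<^sub>1 (psum f k) = e k"
proof -
  have "psum f (k - 1) < psum f k" using cuts_psum[OF assms(1)] assms(2) unfolding cuts_def by blast
  thus ?thesis using nth_block_list[OF assms(2)] by simp
qed

lemma block_list_admissible: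
  assumes "\<forall>i\<in>{1..g}. 1 \<le> f i" "psum f g = n"
  shows "block_list g f e \<in> admissible n g f"
  unfolding admissible_def
proof (intro CollectI conjI ballI)
  show "length (block_list g f e) = n" using assms(2) length_block_list by simp
  fix i k assume i: "i \<in> {1..g}" and k: "k \<in> {psum f (i - 1) + 1..psum f i}"
  show "block_list g f e !\<^sub>1 k = block_list g f e !\<^sub>1 (psum f i)"
    using nth_block_list_psum[OF assms(1) i] nth_block_list[OF i, of f k e] k by simp
qed

lemma admissible_eq_block_list:
  assumes f: "\<forall>i\<in>{1..g}. 1 \<le> f i" "psum f g = n" and l: "l \<in> admissible n g f"
  shows "block_list g f (\<lambda>k. l !\<^sub>1 (psum f k)) = l"
proof (rule nth_equalityI)
  show "length (block_list g f (\<lambda>k. l !\<^sub>1 (psum f k))) = length l"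
    using l f(2) by (simp add: length_block_list admissible_def)
  fix i assume "i < length (block_list g f (\<lambda>k. l !\<^sub>1 (psum f k)))"
  hence i: "i < n" using f(2) by (simp add: length_block_list)
  obtain k where k: "k \<in> {1..g}" "psum f (k - 1) < i + 1" "i + 1 \<le> psum f k"
    by (rule cuts_block_exists[OF cuts_psum[OF f(1)], of "i + 1"]) (use i f(2) in auto)
  have "l !\<^sub>1 (i + 1) = l !\<^sub>1 (psum f k)"
  proof -
    have "i + 1 \<in> {psum f (k - 1) + 1..psum f k}" using k by auto
    thus ?thesis using l k(1) unfolding admissible_def by blast
  qed
  thus "block_list g f (\<lambda>k. l !\<^sub>1 (psum f k)) ! i = l ! i"
    using nth_block_list[OF k] by simp
qed

lemma sum_list_map_block_list:
  "sum_list (map h (block_list g f e)) = (\<Sum>k=1..g. f k * h (e k))"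
  by (induction g) (simp_all add: block_list_Suc sum_list_replicate, simp add: block_list_def)

lemma count_ge_eq_sum_list: "count_ge xs j = sum_list (map (\<lambda>x. if j \<le> x then 1 else 0) xs)"
  by (induction xs) (simp_all add: count_ge_def)

lemma count_ge_block_list: "count_ge (block_list g f e) j = sum f {q \<in> {1..g}. j \<le> e q}"
proof -
  have "count_ge (block_list g f e) j = (\<Sum>k=1..g. if j \<le> e k then f k else 0)"
    unfolding count_ge_eq_sum_list sum_list_map_block_list by (intro sum.cong) auto
  also have "\<dots> = sum f {q \<in> {1..g}. j \<le> e q}" by (rule sum.inter_filter[symmetric]) simp
  finally show ?thesis .
qed

lemma sum_list_map_sort_desc: "sum_list (map h (sort_desc l)) = sum_list (map h l)"
  for h :: "nat \<Rightarrow> nat"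
proof -
  have "mset (sort_desc l) = mset l" by (simp add: sort_desc_def)
  thus ?thesis by (metis mset_map sum_mset_sum_list)
qed

lemma count_ge_sort_desc: "count_ge (sort_desc l) j = count_ge l j"
  by (simp add: count_ge_eq_sum_list sum_list_map_sort_desc)

lemma sort_desc_partition: "length l = n \<Longrightarrow> sort_desc l \<in> partitions n"
  by (simp add: partitions_def sort_desc_def sorted_wrt_rev)

subsection \<open>The states occurring at the positive levels\<close>

definition level_state :: "nat \<Rightarrow> nat \<Rightarrow> (nat \<Rightarrow> nat) \<Rightarrow> (nat \<Rightarrow> nat) \<Rightarrow> nat \<Rightarrow> nat set \<times> nat"
  where "level_state g n e mu j = ({q \<in> {1..g}. j \<le> e q}, card {k \<in> {1..n}. j \<le> mu k})"

text \<open>Level 0 is omitted because its state is always \<open>({1..g}, n)\<close>, and the state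
  \<open>({}, 0)\<close> because it occurs at all large levels and would have infinite
  multiplicity.\<close>

definition levels :: "nat \<Rightarrow> nat \<Rightarrow> (nat \<Rightarrow> nat) \<Rightarrow> (nat \<Rightarrow> nat) \<Rightarrow> (nat set \<times> nat) set"
  where "levels g n e mu = level_state g n e mu ` {1..} - {({}, 0)}"

definition level_mult :: "nat \<Rightarrow> nat \<Rightarrow> (nat \<Rightarrow> nat) \<Rightarrow> (nat \<Rightarrow> nat) \<Rightarrow> nat set \<times> nat \<Rightarrow> nat"
  where "level_mult g n e mu s = card {j. 1 \<le> j \<and> level_state g n e mu j = s}"

lemma level_state_cong:
  assumes "\<And>q. q \<in> {1..g} \<Longrightarrow> e q = e' q" "\<And>k. k \<in> {1..n} \<Longrightarrow> mu k = mu' k"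
  shows "level_state g n e mu = level_state g n e' mu'"
  unfolding level_state_def by (intro ext arg_cong2[where f = Pair] arg_cong[where f = card]) (use assms in auto)

lemma level_state_bound:
  "\<exists>N. \<forall>j>N. level_state g n e mu j = ({}, 0)"
proof -
  define N where "N = (\<Sum>q=1..g. e q) + (\<Sum>k=1..n. mu k)"
  have "level_state g n e mu j = ({}, 0)" if "N < j" for j
  proof -
    have "e q \<le> N" if "q \<in> {1..g}" for q
      unfolding N_def using that by (intro trans_le_add1 member_le_sum) auto
    moreover have "mu k \<le> N" if "k \<in> {1..n}" for k
      unfolding N_def using that by (intro trans_le_add2 member_le_sum) auto
    ultimately have "{q \<in> {1..g}. j \<le> e q} = {}" "{k \<in> {1..n}. j \<le> mu k} = {}"
      using that by (force, force)
    thus ?thesis unfolding level_state_def by simp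
  qed
  thus ?thesis by blast
qed

lemma finite_levels: "finite (levels g n e mu)"
proof -
  obtain N where N: "\<forall>j>N. level_state g n e mu j = ({}, 0)" using level_state_bound by blast
  have "levels g n e mu \<subseteq> level_state g n e mu ` {1..N}"
  proof
    fix s assume "s \<in> levels g n e mu"
    then obtain j where j: "1 \<le> j" "s = level_state g n e mu j" "s \<noteq> ({}, 0)" by (auto simp: levels_def)
    hence "j \<le> N" using N by (metis not_le)
    thus "s \<in> level_state g n e mu ` {1..N}" using j by auto
  qed
  thus ?thesis using finite_subset by blast
qed

lemma finite_level_fibre: "s \<noteq> ({}, 0) \<Longrightarrow> finite {j. 1 \<le> j \<and> level_state g n e mu j = s}"
proof -
  assume s: "s \<noteq> ({}, 0)"
  obtain N where N: "\<forall>j>N. level_state g n e mu j = ({}, 0)" using level_state_bound by blast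
  have "{j. 1 \<le> j \<and> level_state g n e mu j = s} \<subseteq> {..N}"
    using N s by (auto simp: not_less[symmetric])
  thus ?thesis using finite_subset by blast
qed

text \<open>The source of additivity: levels with property \<open>R\<close> are grouped by their
  state. With \<open>R\<close> expressing \<open>q \<in> fst s\<close> or
  \<open>k \<le> snd s\<close> the left-hand side is \<open>e q\<close> or \<open>mu k\<close>, and
  a conjunction of two such properties gives their minimum.\<close>

lemma card_levels:
  assumes "\<not> R ({}, 0)"
  shows "card {j. 1 \<le> j \<and> R (level_state g n e mu j)} = (\<Sum>s\<in>levels g n e mu. if R s then level_mult g n e mu s else 0)"
proof -
  define Z where "Z = {s \<in> levels g n e mu. R s}"
  have "{j. 1 \<le> j \<and> R (level_state g n e mu j)} = (\<Union>s\<in>Z. {j. 1 \<le> j \<and> level_state g n e mu j = s})"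
    using assms by (auto simp: Z_def levels_def)
  also have "card \<dots> = (\<Sum>s\<in>Z. card {j. 1 \<le> j \<and> level_state g n e mu j = s})"
  proof (rule card_UN_disjoint)
    show "finite Z" using finite_levels by (simp add: Z_def)
    show "\<forall>s\<in>Z. finite {j. 1 \<le> j \<and> level_state g n e mu j = s}"
      using finite_level_fibre by (auto simp: Z_def levels_def)
  qed auto
  also have "\<dots> = (\<Sum>s\<in>levels g n e mu. if R s then level_mult g n e mu s else 0)"
    unfolding level_mult_def Z_def by (rule sum.inter_filter[OF finite_levels])
  finally show ?thesis .
qed

text \<open>Since \<open>mu\<close> descends, the positions with \<open>mu k \<ge> j\<close> form an
  initial interval, which is therefore recorded by its cardinality alone.\<close>

lemma le_snd_level_state_iff:
  assumes "\<And>i j. 1 \<le> i \<Longrightarrow> i \<le> j \<Longrightarrow> j \<le> n \<Longrightarrow> mu j \<le> mu i" "k \<in> {1..n}"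
  shows "k \<le> snd (level_state g n e mu j) \<longleftrightarrow> j \<le> mu k"
proof -
  define Q where "Q = {k \<in> {1..n}. j \<le> mu k}"
  have Q: "Q = {1..card Q}"
  proof (rule down_closed_eq_interval)
    fix a b assume "b \<in> Q" "1 \<le> a" "a \<le> b"
    thus "a \<in> Q" using assms(1)[of a b] by (auto simp: Q_def)
  qed (auto simp: Q_def)
  have "k \<in> Q \<longleftrightarrow> k \<in> {1..card Q}" by (rule arg_cong[OF Q])
  moreover have "snd (level_state g n e mu j) = card Q" by (simp add: Q_def level_state_def)
  ultimately show ?thesis using assms(2) by (simp add: Q_def)
qed

lemma card_ge_Suc_le: "card {j. 1 \<le> j \<and> j \<le> (x::nat)} = x"
proof -
  have "{j. 1 \<le> j \<and> j \<le> x} = {1..x}" by auto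
  thus ?thesis by simp
qed

lemma e_eq_sum_levels:
  assumes "q \<in> {1..g}"
  shows "e q = (\<Sum>s\<in>levels g n e mu. if q \<in> fst s then level_mult g n e mu s else 0)"
  using card_levels[of "\<lambda>s. q \<in> fst s" g n e mu] card_ge_Suc_le[of "e q"] assms
  by (simp add: level_state_def)

lemma mu_eq_sum_levels:
  assumes "\<And>i j. 1 \<le> i \<Longrightarrow> i \<le> j \<Longrightarrow> j \<le> n \<Longrightarrow> mu j \<le> mu i" "k \<in> {1..n}"
  shows "mu k = (\<Sum>s\<in>levels g n e mu. if k \<le> snd s then level_mult g n e mu s else 0)"
  using card_levels[of "\<lambda>s. k \<le> snd s" g n e mu] card_ge_Suc_le[of "mu k"] assms(2)
  by (simp add: le_snd_level_state_iff[OF assms])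

lemma min_mu_e_eq_sum_levels:
  assumes "\<And>i j. 1 \<le> i \<Longrightarrow> i \<le> j \<Longrightarrow> j \<le> n \<Longrightarrow> mu j \<le> mu i" "k \<in> {1..n}" "q \<in> {1..g}"
  shows "min (mu k) (e q) = (\<Sum>s\<in>levels g n e mu. if k \<le> snd s \<and> q \<in> fst s then level_mult g n e mu s else 0)"
proof -
  have "{j. 1 \<le> j \<and> k \<le> snd (level_state g n e mu j) \<and> q \<in> fst (level_state g n e mu j)} = {j. 1 \<le> j \<and> j \<le> min (mu k) (e q)}"
    using assms(3) le_snd_level_state_iff[OF assms(1,2)] by (auto simp: level_state_def)
  thus ?thesis using card_levels[of "\<lambda>s. k \<le> snd s \<and> q \<in> fst s" g n e mu] by (simp only: card_ge_Suc_le) simp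
qed

lemma min_mu_mu_eq_sum_levels:
  assumes "\<And>i j. 1 \<le> i \<Longrightarrow> i \<le> j \<Longrightarrow> j \<le> n \<Longrightarrow> mu j \<le> mu i" "k \<in> {1..n}" "i \<in> {1..n}"
  shows "min (mu k) (mu i) = (\<Sum>s\<in>levels g n e mu. if k \<le> snd s \<and> i \<le> snd s then level_mult g n e mu s else 0)"
proof -
  have "{j. 1 \<le> j \<and> k \<le> snd (level_state g n e mu j) \<and> i \<le> snd (level_state g n e mu j)} = {j. 1 \<le> j \<and> j \<le> min (mu k) (mu i)}"
    using le_snd_level_state_iff[OF assms(1,2)] le_snd_level_state_iff[OF assms(1,3)] by auto
  thus ?thesis using card_levels[of "\<lambda>s. k \<le> snd s \<and> i \<le> snd s" g n e mu] assms(2,3)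
    by (simp only: card_ge_Suc_le) simp
qed

lemma level_mult_pos:
  assumes "s \<in> levels g n e mu"
  shows "1 \<le> level_mult g n e mu s"
proof -
  have s: "s \<noteq> ({}, 0)" "{j. 1 \<le> j \<and> level_state g n e mu j = s} \<noteq> {}"
    using assms by (auto simp: levels_def)
  hence "card {j. 1 \<le> j \<and> level_state g n e mu j = s} \<noteq> 0" using finite_level_fibre[OF s(1)] by (simp add: card_eq_0_iff)
  thus ?thesis by (simp add: level_mult_def)
qed

subsection \<open>Chains of states with multiplicities\<close>

definition is_chain :: "'a::order set \<Rightarrow> bool"
  where "is_chain Y \<longleftrightarrow> (\<forall>s\<in>Y. \<forall>s'\<in>Y. s \<le> s' \<or> s' \<le> s)"

lemma is_chainD: "is_chain Y \<Longrightarrow> s \<in> Y \<Longrightarrow> s' \<in> Y \<Longrightarrow> \<not> s \<le> s' \<Longrightarrow> s' < s"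
  unfolding is_chain_def by (metis order.not_eq_order_implies_strict order.refl)

lemma is_chain_levels: "is_chain (levels g n e mu)"
proof -
  have le: "level_state g n e mu j \<le> level_state g n e mu i" if "i \<le> j" for i j
    unfolding level_state_def less_eq_prod_def fst_conv snd_conv
  proof
    show "{q \<in> {1..g}. j \<le> e q} \<subseteq> {q \<in> {1..g}. i \<le> e q}" using that by auto
    show "card {k \<in> {1..n}. j \<le> mu k} \<le> card {k \<in> {1..n}. i \<le> mu k}"
      using that by (intro card_mono) auto
  qed
  show ?thesis unfolding is_chain_def
  proof (intro ballI)
    fix s s' assume "s \<in> levels g n e mu" "s' \<in> levels g n e mu"
    then obtain i j where "s = level_state g n e mu i" "s' = level_state g n e mu j" by (auto simp: levels_def)
    thus "s \<le> s' \<or> s' \<le> s" using le[of i j] le[of j i] by (metis nat_le_linear)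
  qed
qed

text \<open>The expansion of \<open>e q\<close> over the levels, read backwards as a definition: a
  chain with multiplicities is turned into heights. \<open>chain_mu\<close> does the same for the
  parts.\<close>

definition chain_e :: "(nat set \<times> nat) set \<Rightarrow> (nat set \<times> nat \<Rightarrow> nat) \<Rightarrow> nat \<Rightarrow> nat"
  where "chain_e Y m q = (\<Sum>s\<in>Y. if q \<in> fst s then m s else 0)"

definition chain_mu :: "(nat set \<times> nat) set \<Rightarrow> (nat set \<times> nat \<Rightarrow> nat) \<Rightarrow> nat \<Rightarrow> nat"
  where "chain_mu Y m k = (\<Sum>s\<in>Y. if k \<le> snd s then m s else 0)"

locale weighted_chain =
  fixes g n :: nat and Y :: "(nat set \<times> nat) set" and m :: "nat set \<times> nat \<Rightarrow> nat"
  assumes fin: "finite Y" and chain: "is_chain Y"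
    and sub: "s \<in> Y \<Longrightarrow> fst s \<subseteq> {1..g}" "s \<in> Y \<Longrightarrow> snd s \<le> n"
    and nonbot: "({}, 0) \<notin> Y" and pos: "s \<in> Y \<Longrightarrow> 1 \<le> m s"
begin

text \<open>The number of levels spent in larger states. States decrease with the level, so
  \<open>s\<close> should occupy exactly the levels \<open>j\<close> with \<open>above s < j\<close>
  and \<open>j \<le> above s + m s\<close>.\<close>

definition above :: "nat set \<times> nat \<Rightarrow> nat"
  where "above s = (\<Sum>s'\<in>{s' \<in> Y. s < s'}. m s')"

abbreviation st :: "nat \<Rightarrow> nat set \<times> nat"
  where "st \<equiv> level_state g n (chain_e Y m) (chain_mu Y m)"

lemma above_plus: "s \<in> Y \<Longrightarrow> above s + m s = (\<Sum>s'\<in>{s' \<in> Y. s \<le> s'}. m s')"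
proof -
  assume s: "s \<in> Y"
  have "{s' \<in> Y. s \<le> s'} = insert s {s' \<in> Y. s < s'}" using s by (auto simp: order.order_iff_strict)
  thus ?thesis using fin by (simp add: above_def)
qed

lemma chain_e_eq: "chain_e Y m q = (\<Sum>s'\<in>{s' \<in> Y. q \<in> fst s'}. m s')"
  unfolding chain_e_def by (rule sum.inter_filter[OF fin, symmetric])

lemma chain_mu_eq: "chain_mu Y m k = (\<Sum>s'\<in>{s' \<in> Y. k \<le> snd s'}. m s')"
  unfolding chain_mu_def by (rule sum.inter_filter[OF fin, symmetric])

text \<open>If \<open>R s\<close> holds, all states from \<open>s\<close> upwards have the upward
  closed property \<open>R\<close>, and their multiplicities already reach \<open>j\<close>. If it
  fails, comparability puts every state with \<open>R\<close> strictly above \<open>s\<close>, and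
  their multiplicities add up to at most \<open>above s < j\<close>.\<close>

lemma le_sum_iff:
  assumes s: "s \<in> Y" and j: "above s < j" "j \<le> above s + m s"
    and up: "\<And>a b. R a \<Longrightarrow> a \<le> b \<Longrightarrow> R b"
  shows "j \<le> (\<Sum>s'\<in>{s' \<in> Y. R s'}. m s') \<longleftrightarrow> R s"
proof
  assume "R s"
  hence "{s' \<in> Y. s \<le> s'} \<subseteq> {s' \<in> Y. R s'}" using up by blast
  hence "(\<Sum>s'\<in>{s' \<in> Y. s \<le> s'}. m s') \<le> (\<Sum>s'\<in>{s' \<in> Y. R s'}. m s')"
    using fin by (intro sum_mono2) auto
  thus "j \<le> (\<Sum>s'\<in>{s' \<in> Y. R s'}. m s')" using j above_plus[OF s] by simp
next
  assume le: "j \<le> (\<Sum>s'\<in>{s' \<in> Y. R s'}. m s')"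
  show "R s"
  proof (rule ccontr)
    assume nR: "\<not> R s"
    have "{s' \<in> Y. R s'} \<subseteq> {s' \<in> Y. s < s'}"
    proof
      fix s' assume s': "s' \<in> {s' \<in> Y. R s'}"
      hence "\<not> s' \<le> s" using nR up by blast
      thus "s' \<in> {s' \<in> Y. s < s'}" using is_chainD[OF chain, of s' s] s s' by simp
    qed
    hence "(\<Sum>s'\<in>{s' \<in> Y. R s'}. m s') \<le> above s"
      unfolding above_def using fin by (intro sum_mono2) auto
    thus False using le j by simp
  qed
qed

lemma st_eq:
  assumes s: "s \<in> Y" and j: "above s < j" "j \<le> above s + m s"
  shows "st j = s"
proof -
  have 1: "j \<le> chain_e Y m q \<longleftrightarrow> q \<in> fst s" for q
    unfolding chain_e_eq by (rule le_sum_iff[OF s j]) (auto simp: less_eq_prod_def)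
  have 2: "j \<le> chain_mu Y m k \<longleftrightarrow> k \<le> snd s" for k
    unfolding chain_mu_eq by (rule le_sum_iff[OF s j]) (auto simp: less_eq_prod_def)
  have "{q \<in> {1..g}. q \<in> fst s} = fst s" using sub(1)[OF s] by blast
  moreover have "{k \<in> {1..n}. k \<le> snd s} = {1..snd s}" using sub(2)[OF s] by auto
  ultimately show ?thesis unfolding level_state_def 1 2 by simp
qed

text \<open>The interval containing \<open>j\<close> belongs to the smallest state \<open>s\<close>
  with \<open>above s < j\<close>. If \<open>j\<close> lay beyond it, the next smaller state
  \<open>b\<close> would have \<open>above b = above s + m s < j\<close>, against minimality; with
  no smaller state, \<open>j\<close> would exceed the total multiplicity.\<close>

lemma st_cases:
  assumes "1 \<le> j" "st j \<noteq> ({}, 0)"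
  obtains s where "s \<in> Y" "above s < j" "j \<le> above s + m s"
proof -
  have tot: "j \<le> sum m Y"
  proof (rule ccontr)
    assume "\<not> j \<le> sum m Y"
    moreover have "chain_e Y m q \<le> sum m Y" "chain_mu Y m q \<le> sum m Y" for q
      unfolding chain_e_eq chain_mu_eq using fin by (auto intro!: sum_mono2)
    ultimately have "\<not> j \<le> chain_e Y m q" "\<not> j \<le> chain_mu Y m q" for q
      by (meson order.trans)+
    thus False using assms(2) by (simp add: level_state_def)
  qed
  define Z where "Z = {s \<in> Y. above s < j}"
  have "Y \<noteq> {}" using tot assms(1) by auto
  then obtain t where t: "t \<in> Y" "\<And>s. s \<in> Y \<Longrightarrow> t \<le> s \<Longrightarrow> t = s"
    using finite_has_maximal[OF fin] by metis
  have "{s' \<in> Y. t < s'} = {}" using t(2) by (auto simp: less_le)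
  hence "above t = 0" unfolding above_def by (simp only: sum.empty)
  hence "t \<in> Z" using t(1) assms(1) by (simp add: Z_def)
  moreover have finZ: "finite Z" using fin by (simp add: Z_def)
  ultimately obtain s where s: "s \<in> Z" "\<And>s'. s' \<in> Z \<Longrightarrow> s' \<le> s \<Longrightarrow> s = s'"
    using finite_has_minimal[of Z] by blast
  have sY: "s \<in> Y" "above s < j" using s(1) by (auto simp: Z_def)
  have "j \<le> above s + m s"
  proof (rule ccontr)
    assume gt: "\<not> j \<le> above s + m s"
    define B where "B = {s' \<in> Y. s' < s}"
    show False
    proof (cases "B = {}")
      case True
      have "{s' \<in> Y. s \<le> s'} = Y"
        using is_chainD[OF chain sY(1)] True by (auto simp: B_def)
      thus False using above_plus[OF sY(1)] gt tot by simp
    next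
      case False
      moreover have "finite B" using fin by (simp add: B_def)
      ultimately obtain b where b: "b \<in> B" "\<And>s'. s' \<in> B \<Longrightarrow> b \<le> s' \<Longrightarrow> b = s'"
        using finite_has_maximal[of B] by blast
      have bY: "b \<in> Y" "b < s" using b(1) by (auto simp: B_def)
      have "{s' \<in> Y. b < s'} = {s' \<in> Y. s \<le> s'}"
      proof (intro equalityI subsetI)
        fix x assume x: "x \<in> {s' \<in> Y. b < s'}"
        have "s \<le> x"
        proof (rule ccontr)
          assume "\<not> s \<le> x"
          hence "x < s" using is_chainD[OF chain sY(1)] x by blast
          hence "x \<in> B" using x by (simp add: B_def)
          thus False using b(2)[of x] x by (simp add: less_le)
        qed
        thus "x \<in> {s' \<in> Y. s \<le> s'}" using x by simp
      next
        fix x assume "x \<in> {s' \<in> Y. s \<le> s'}"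
        thus "x \<in> {s' \<in> Y. b < s'}" using bY(2) by (simp add: less_le_trans)
      qed
      hence "above b = above s + m s" using above_plus[OF sY(1)] by (simp add: above_def)
      hence "b \<in> Z" using gt bY(1) by (simp add: Z_def)
      thus False using s(2)[of b] bY(2) by (simp add: less_le)
    qed
  qed
  thus ?thesis using that sY by blast
qed

lemma fibre_eq:
  assumes "s \<in> Y"
  shows "{j. 1 \<le> j \<and> st j = s} = {above s<..above s + m s}"
proof (intro equalityI subsetI)
  fix j assume "j \<in> {j. 1 \<le> j \<and> st j = s}"
  hence j: "1 \<le> j" "st j = s" by auto
  hence "st j \<noteq> ({}, 0)" using nonbot assms by metis
  then obtain s' where s': "s' \<in> Y" "above s' < j" "j \<le> above s' + m s'" using st_cases[OF j(1)] by blast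
  have "s' = s" using st_eq[OF s'] j(2) by simp
  thus "j \<in> {above s<..above s + m s}" using s' by simp
next
  fix j assume "j \<in> {above s<..above s + m s}"
  hence j: "above s < j" "j \<le> above s + m s" by auto
  thus "j \<in> {j. 1 \<le> j \<and> st j = s}" using st_eq[OF assms j] by simp
qed

lemma level_mult_chain: "s \<in> Y \<Longrightarrow> level_mult g n (chain_e Y m) (chain_mu Y m) s = m s"
  unfolding level_mult_def by (subst fibre_eq) simp_all

lemma levels_chain: "levels g n (chain_e Y m) (chain_mu Y m) = Y"
proof (intro equalityI subsetI)
  fix s assume "s \<in> levels g n (chain_e Y m) (chain_mu Y m)"
  then obtain j where j: "1 \<le> j" "s = st j" "st j \<noteq> ({}, 0)" by (auto simp: levels_def)
  obtain s' where s': "s' \<in> Y" "above s' < j" "j \<le> above s' + m s'" using st_cases[OF j(1,3)] .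
  thus "s \<in> Y" using st_eq[OF s'] j(2) by simp
next
  fix s assume s: "s \<in> Y"
  hence "{j. 1 \<le> j \<and> st j = s} \<noteq> {}" using pos[OF s] unfolding fibre_eq[OF s] by simp
  then obtain j where "1 \<le> j" "s = st j" by blast
  moreover have "s \<noteq> ({}, 0)" using s nonbot by metis
  ultimately show "s \<in> levels g n (chain_e Y m) (chain_mu Y m)" unfolding levels_def by blast
qed

lemma chain_mu_antimono: "i \<le> j \<Longrightarrow> chain_mu Y m j \<le> chain_mu Y m i"
  unfolding chain_mu_eq using fin by (intro sum_mono2) auto

end

section \<open>Pairs of a tuple and a partition with a given word and set partition\<close>

text \<open>\<open>P i\<close> is the union of the first \<open>i\<close> blocks of the set partition.\<close>

locale dyck_blocks =
  fixes n g r :: nat and f L M :: "nat \<Rightarrow> nat" and P :: "nat \<Rightarrow> nat set"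
  assumes n1: "1 \<le> n" and f1: "\<forall>i\<in>{1..g}. 1 \<le> f i" and sum_f: "psum f g = n"
    and cL: "cuts n r L" and cM: "cuts n r M" and M_le_L: "i \<le> r \<Longrightarrow> M i \<le> L i"
    and P0: "P 0 = {}" and Pr: "P r = {1..g}" and Pstep: "i \<in> {1..r} \<Longrightarrow> P (i - 1) \<subset> P i"
    and FP: "i \<le> r \<Longrightarrow> sum f (P i) = L i"
begin

lemma Pmono: "i \<le> j \<Longrightarrow> j \<le> r \<Longrightarrow> P i \<subseteq> P j"
proof (induction j rule: dec_induct)
  case (step m)
  have "Suc m \<in> {1..r}" using step by simp
  from Pstep[OF this] show ?case using step by auto
qed simp

lemma Psub: "i \<le> r \<Longrightarrow> P i \<subseteq> {1..g}"
  using Pmono[of i r] Pr by simp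

lemma r1: "1 \<le> r"
proof (rule ccontr)
  assume "\<not> 1 \<le> r"
  hence "r = 0" by simp
  thus False using cM n1 by (simp add: cuts_def)
qed

text \<open>Word, containment and induced set partition condensed into one condition: at each part
  of \<open>mu\<close> from the \<open>i\<close>-th run of ones, the blocks of \<open>l\<close> that
  are at least as high make up exactly \<open>P i\<close>.\<close>

definition good :: "(nat \<Rightarrow> nat) \<Rightarrow> (nat \<Rightarrow> nat) \<Rightarrow> bool"
  where "good e mu \<longleftrightarrow> (\<forall>i\<in>{1..r}. \<forall>k. M (i - 1) < k \<and> k \<le> M i \<longrightarrow> {q \<in> {1..g}. mu k \<le> e q} = P i)"

definition heights :: "nat list \<Rightarrow> nat \<Rightarrow> nat"
  where "heights l k = l !\<^sub>1 (psum f k)"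

lemma count_ge_heights:
  assumes "l \<in> admissible n g f"
  shows "count_ge l j = sum f {q \<in> {1..g}. j \<le> heights l q}"
  using admissible_eq_block_list[OF f1 sum_f assms] count_ge_block_list[of g f "heights l" j]
  by (simp add: heights_def[abs_def])

lemma sum_f_inj:
  assumes "S \<subseteq> T" "T \<subseteq> {1..g}" "sum f S = sum f T"
  shows "S = T"
proof (rule ccontr)
  assume "S \<noteq> T"
  then obtain q where q: "q \<in> T" "q \<notin> S" using assms(1) by blast
  have fin: "finite T" using assms(2) finite_subset by blast
  have "sum f T = sum f S + sum f (T - S)"
    using fin assms(1) by (simp add: sum.subset_diff)
  moreover have "f q \<le> sum f (T - S)" using q fin by (intro member_le_sum) auto
  moreover have "1 \<le> f q" using f1 q assms(2) by blast
  ultimately show False using assms(3) by simp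
qed

text \<open>For a part in run \<open>i\<close>, let \<open>S\<close> be the set of blocks that are
  at least as high. The word gives \<open>sum f S = L i = sum f (P i)\<close>; the set partition
  separates \<open>P i\<close> from its complement by height, so \<open>S\<close> and
  \<open>P i\<close> are comparable; positive sizes then force equality. Conversely, containment
  follows from \<open>k \<le> M i \<le> L i\<close>.\<close>

lemma good_iff:
  assumes l: "l \<in> admissible n g f" and mu: "mus \<in> partitions n"
    and A: "A \<in> compatible_partitions n g f (block_word r L M)" and len: "length A = r"
    and AP: "\<And>i. i \<in> {1..r} \<Longrightarrow> A !\<^sub>1 i = P i - P (i - 1)"
  shows "is_induced_partition n g f (block_word r L M) (weak_ordering_of g f l) A \<and>
      (\<forall>i\<in>{1..n}. mus !\<^sub>1 i \<le> sort_desc l !\<^sub>1 i) \<and> pair_word n mus (sort_desc l) = block_word r L M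
    \<longleftrightarrow> good (heights l) (\<lambda>k. mus !\<^sub>1 k)"
proof -
  have lenl: "length l = n" using l by (simp add: admissible_def)
  have la: "sort_desc l \<in> partitions n" by (rule sort_desc_partition[OF lenl])
  have cnt: "count_ge (sort_desc l) j = sum f {q \<in> {1..g}. j \<le> heights l q}" for j
    using count_ge_heights[OF l] by (simp add: count_ge_sort_desc)
  have ind: "is_induced_partition n g f (block_word r L M) (weak_ordering_of g f l) A \<longleftrightarrow>
    (\<forall>i\<in>{1..<r}. \<forall>q\<in>P i. \<forall>q'\<in>{1..g} - P i. heights l q' < heights l q)"
    unfolding heights_def by (rule is_induced_partition_iff[OF A len P0 Pr Pstep AP])
  show ?thesis
  proof
    assume *: "is_induced_partition n g f (block_word r L M) (weak_ordering_of g f l) A \<and>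
      (\<forall>i\<in>{1..n}. mus !\<^sub>1 i \<le> sort_desc l !\<^sub>1 i) \<and> pair_word n mus (sort_desc l) = block_word r L M"
    hence c: "\<forall>i\<in>{1..r}. \<forall>k. M (i - 1) < k \<and> k \<le> M i \<longrightarrow> count_ge (sort_desc l) (mus !\<^sub>1 k) = L i"
      using pair_word_eq_iff[OF cL cM la mu] by blast
    show "good (heights l) (\<lambda>k. mus !\<^sub>1 k)"
      unfolding good_def
    proof (intro ballI allI impI)
      fix i k assume i: "i \<in> {1..r}" and k: "M (i - 1) < k \<and> k \<le> M i"
      define S where "S = {q \<in> {1..g}. mus !\<^sub>1 k \<le> heights l q}"
      have eq: "sum f S = sum f (P i)"
        using c i k FP[of i] unfolding S_def cnt by simp
      have Pi: "P i \<subseteq> {1..g}" using Psub[of i] i by simp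
      have Sg: "S \<subseteq> {1..g}" by (auto simp: S_def)
      have "S \<subseteq> P i \<or> P i \<subseteq> S"
      proof (cases "i = r")
        case True
        thus ?thesis using Sg Pr by simp
      next
        case False
        hence ir: "i \<in> {1..<r}" using i by auto
        show ?thesis
        proof (rule ccontr)
          assume "\<not> (S \<subseteq> P i \<or> P i \<subseteq> S)"
          then obtain q q' where q: "q \<in> S" "q \<notin> P i" "q' \<in> P i" "q' \<notin> S" by blast
          have "heights l q < heights l q'"
            using * ind ir q Sg by blast
          moreover have "mus !\<^sub>1 k \<le> heights l q" using q by (simp add: S_def)
          moreover have "\<not> mus !\<^sub>1 k \<le> heights l q'" using q Pi by (auto simp: S_def)
          ultimately show False by simp
        qed
      qed
      thus "{q \<in> {1..g}. mus !\<^sub>1 k \<le> heights l q} = P i"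
        using sum_f_inj[OF _ Pi eq] sum_f_inj[OF _ Sg eq[symmetric]] unfolding S_def by auto
    qed
  next
    assume good: "good (heights l) (\<lambda>k. mus !\<^sub>1 k)"
    have c: "count_ge (sort_desc l) (mus !\<^sub>1 k) = L i" if "i \<in> {1..r}" "M (i - 1) < k" "k \<le> M i" for i k
    proof -
      have "{q \<in> {1..g}. mus !\<^sub>1 k \<le> heights l q} = P i" using good that unfolding good_def by blast
      thus ?thesis unfolding cnt using FP[of i] that by simp
    qed
    have le: "\<forall>k\<in>{1..n}. mus !\<^sub>1 k \<le> sort_desc l !\<^sub>1 k"
    proof
      fix k assume k: "k \<in> {1..n}"
      obtain i where i: "i \<in> {1..r}" "M (i - 1) < k" "k \<le> M i"
        using cuts_block_exists[OF cM, of k] k by auto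
      have "k - 1 < count_ge (sort_desc l) (mus !\<^sub>1 k)"
        using c[OF i] M_le_L[of i] i k by auto
      moreover have "sorted_wrt (\<ge>) (sort_desc l)" "k - 1 < length (sort_desc l)"
        using la k by (auto simp: partitions_def)
      ultimately show "mus !\<^sub>1 k \<le> sort_desc l !\<^sub>1 k" using le_nth_iff_less_count_ge by blast
    qed
    have "pair_word n mus (sort_desc l) = block_word r L M"
      using pair_word_eq_iff[OF cL cM la mu le] c by blast
    moreover have "\<forall>i\<in>{1..<r}. \<forall>q\<in>P i. \<forall>q'\<in>{1..g} - P i. heights l q' < heights l q"
    proof (intro ballI)
      fix i q q' assume i: "i \<in> {1..<r}" and q: "q \<in> P i" and q': "q' \<in> {1..g} - P i"
      have ir: "i \<in> {1..r}" using i by auto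
      hence "M (i - 1) < M i" using cM unfolding cuts_def by blast
      hence "{q \<in> {1..g}. mus !\<^sub>1 M i \<le> heights l q} = P i" using good ir unfolding good_def by blast
      hence "mus !\<^sub>1 M i \<le> heights l q" "\<not> mus !\<^sub>1 M i \<le> heights l q'" using q q' by blast+
      thus "heights l q' < heights l q" by simp
    qed
    ultimately show "is_induced_partition n g f (block_word r L M) (weak_ordering_of g f l) A \<and>
      (\<forall>i\<in>{1..n}. mus !\<^sub>1 i \<le> sort_desc l !\<^sub>1 i) \<and> pair_word n mus (sort_desc l) = block_word r L M"
      using ind le by blast
  qed
qed

subsection \<open>Admissible chains of states\<close>

text \<open>The path from \<open>(P (i - 1), M (i - 1))\<close>, excluded, to \<open>(P i, M i)\<close>, included.\<close>

definition hook :: "nat \<Rightarrow> (nat set \<times> nat) set"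
  where "hook i = {(S, b). P (i - 1) \<subseteq> S \<and> S \<subseteq> P i \<and>
    (b = M (i - 1) \<and> S \<noteq> P (i - 1) \<or> S = P i \<and> M (i - 1) < b \<and> b \<le> M i)}"

definition hook_chains :: "(nat set \<times> nat) set set"
  where "hook_chains = {Y. Y \<subseteq> (\<Union>i\<in>{1..r}. hook i) \<and> is_chain Y \<and> (\<forall>i\<in>{1..<r}. (P i, M i) \<in> Y)}"

lemma hook_bounds:
  assumes "i \<in> {1..r}" "s \<in> hook i"
  shows "P (i - 1) \<subseteq> fst s" "fst s \<subseteq> P i" "M (i - 1) \<le> snd s" "snd s \<le> M i"
    "fst s \<subseteq> {1..g}" "snd s \<le> n" "s \<noteq> ({}, 0)"
    "M (i - 1) < snd s \<Longrightarrow> fst s = P i"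
proof -
  have lt: "M (i - 1) < M i" using cM assms(1) unfolding cuts_def by blast
  show 1: "P (i - 1) \<subseteq> fst s" "fst s \<subseteq> P i" "M (i - 1) \<le> snd s" "snd s \<le> M i"
    "M (i - 1) < snd s \<Longrightarrow> fst s = P i"
    using assms(2) lt by (auto simp: hook_def)
  have "P i \<subseteq> {1..g}" using assms(1) by (intro Psub) simp
  thus "fst s \<subseteq> {1..g}" using 1(2) by simp
  show "snd s \<le> n" using 1(4) cuts_le_n[OF cM, of i] assms(1) by simp
  show "s \<noteq> ({}, 0)"
    using assms(2) lt by (auto simp: hook_def)
qed

lemma hook_chain_weighted:
  assumes "Y \<in> hook_chains" "\<And>s. s \<in> Y \<Longrightarrow> 1 \<le> m s"
  shows "weighted_chain g n Y m"
proof
  have sub: "s \<in> Y \<Longrightarrow> \<exists>i\<in>{1..r}. s \<in> hook i" for s using assms(1) by (auto simp: hook_chains_def)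
  show f: "fst s \<subseteq> {1..g}" "snd s \<le> n" if "s \<in> Y" for s using sub[OF that] hook_bounds by blast+
  show "finite Y"
  proof (rule finite_subset)
    show "Y \<subseteq> Pow {1..g} \<times> {..n}" using f by (auto simp: subset_eq)
  qed simp
  show "is_chain Y" using assms(1) by (simp add: hook_chains_def)
  show "({}, 0) \<notin> Y" using sub hook_bounds(7) by blast
  show "1 \<le> m s" if "s \<in> Y" for s using assms(2)[OF that] .
qed

lemma finite_hook_chain: "Y \<in> hook_chains \<Longrightarrow> finite Y"
  using hook_chain_weighted[of Y "\<lambda>_. 1"] by (simp add: weighted_chain_def)

lemma finite_hook_chains: "finite hook_chains"
proof (rule finite_subset)
  show "hook_chains \<subseteq> Pow (Pow {1..g} \<times> {..n})"
  proof
    fix Y assume "Y \<in> hook_chains"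
    hence "Y \<subseteq> (\<Union>i\<in>{1..r}. hook i)" by (simp add: hook_chains_def)
    hence "fst s \<subseteq> {1..g}" "snd s \<le> n" if "s \<in> Y" for s using that hook_bounds(5,6) by blast+
    thus "Y \<in> Pow (Pow {1..g} \<times> {..n})" by (auto simp: subset_eq)
  qed
qed simp

text \<open>For a state \<open>(S, b)\<close> at level \<open>j\<close>, the part at position
  \<open>b\<close> reaches \<open>j\<close> and the part at \<open>b + 1\<close> does not. Goodness
  at \<open>b\<close> bounds \<open>S\<close> from below and at \<open>b + 1\<close> from above.
  Both bounds are \<open>P i\<close> when the two positions lie in the same run; otherwise
  \<open>b = M (i - 1)\<close> and \<open>S\<close> lies between \<open>P (i - 1)\<close> and
  \<open>P i\<close>.\<close>

lemma levels_hook_chain: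
  assumes good: "good e mu" and anti: "\<And>i j. 1 \<le> i \<Longrightarrow> i \<le> j \<Longrightarrow> j \<le> n \<Longrightarrow> mu j \<le> mu i"
  shows "levels g n e mu \<in> hook_chains"
proof -
  have G: "{q \<in> {1..g}. mu k \<le> e q} = P i" if "i \<in> {1..r}" "M (i - 1) < k" "k \<le> M i" for i k
    using good that unfolding good_def by blast
  have "s \<in> (\<Union>i\<in>{1..r}. hook i)" if s: "s \<in> levels g n e mu" for s
  proof -
    obtain j where j: "1 \<le> j" "s = level_state g n e mu j" "s \<noteq> ({}, 0)"
      using s by (auto simp: levels_def)
    define S where "S = fst s"
    define b where "b = snd s"
    have sS: "s = (S, b)" by (simp add: S_def b_def)
    have S: "S = {q \<in> {1..g}. j \<le> e q}" by (simp add: S_def j level_state_def)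
    have bn: "b \<le> n"
    proof -
      have "card {k \<in> {1..n}. j \<le> mu k} \<le> card {1..n}" by (intro card_mono) auto
      thus ?thesis by (simp add: b_def j level_state_def)
    qed
    have bk: "k \<le> b \<longleftrightarrow> j \<le> mu k" if "k \<in> {1..n}" for k
      unfolding b_def j(2) by (rule le_snd_level_state_iff[OF anti that])
    have up: "P i \<subseteq> S" if "i \<in> {1..r}" "M (i - 1) < k" "k \<le> M i" "k \<le> b" for i k
    proof -
      have "k \<in> {1..n}" using that bn by auto
      hence "j \<le> mu k" using bk that by blast
      thus ?thesis unfolding S G[OF that(1-3), symmetric] by auto
    qed
    have down: "S \<subseteq> P i" if "i \<in> {1..r}" "M (i - 1) < k" "k \<le> M i" "b < k" for i k
    proof -
      have "k \<in> {1..n}" using that cuts_le_n[OF cM, of i] by auto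
      hence "mu k < j" using bk[of k] that(4) by simp
      thus ?thesis unfolding S G[OF that(1-3), symmetric] by auto
    qed
    show ?thesis
    proof (cases "b = n")
      case True
      have rr: "r \<in> {1..r}" using r1 by simp
      have Mr: "M r = n" "M (r - 1) < M r" using cM rr unfolding cuts_def by blast+
      have "P r \<subseteq> S" using up[OF rr, of n] Mr True by simp
      hence "S = P r" using Pr S by auto
      hence "s \<in> hook r" using True Mr Pmono[of "r - 1" r] unfolding sS hook_def by simp
      thus ?thesis using rr by blast
    next
      case False
      hence bn': "b + 1 \<le> n" using bn by simp
      obtain i where i: "i \<in> {1..r}" "M (i - 1) < b + 1" "b + 1 \<le> M i"
        using cuts_block_exists[OF cM _ bn'] by auto
      have SP: "S \<subseteq> P i" using down[OF i] by simp
      show ?thesis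
      proof (cases "M (i - 1) < b")
        case True
        have "P i \<subseteq> S" using up[OF i(1) True] i(3) by simp
        hence "S = P i" using SP by simp
        hence "s \<in> hook i" using True i Pmono[of "i - 1" i] unfolding sS hook_def by simp
        thus ?thesis using i(1) by blast
      next
        case nb: False
        hence b: "b = M (i - 1)" using i(2) by simp
        show ?thesis
        proof (cases "i = 1")
          case True
          hence "b = 0" using b cM by (simp add: cuts_def)
          hence "S \<noteq> P (i - 1)" using j(3) True P0 sS by simp
          hence "s \<in> hook i" using b SP True P0 unfolding sS hook_def by simp
          thus ?thesis using i(1) by blast
        next
          case False
          define i' where "i' = i - 1"
          have i': "i' \<in> {1..r}" "i = Suc i'" using False i(1) by (auto simp: i'_def)
          have lt: "M (i' - 1) < M i'" using cM i'(1) unfolding cuts_def by blast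
          have PS: "P i' \<subseteq> S" using up[OF i'(1) lt] b i'_def by simp
          show ?thesis
          \<comment> \<open>The start of a hook is excluded from it, so this point is counted as the
            end of the preceding hook.\<close>
          proof (cases "S = P i'")
            case True
            hence "s \<in> hook i'" using b i'_def lt Pmono[of "i' - 1" i'] i'(1) unfolding sS hook_def by simp
            thus ?thesis using i'(1) by blast
          next
            case False
            hence "s \<in> hook i" using b SP PS unfolding sS hook_def i'_def by simp
            thus ?thesis using i(1) by blast
          qed
        qed
      qed
    qed
  qed
  moreover have "(P i, M i) \<in> levels g n e mu" if i: "i \<in> {1..<r}" for i
  proof -
    have ir: "i \<in> {1..r}" "Suc i \<in> {1..r}" using i by auto
    have lt: "M (i - 1) < M i" "M i < M (Suc i)"
      using cM ir unfolding cuts_def by (blast, fastforce)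
    have Mi: "M i \<in> {1..n}" "Suc (M i) \<in> {1..n}" using lt cuts_le_n[OF cM, of "Suc i"] ir by auto
    define j where "j = mu (M i)"
    have S: "{q \<in> {1..g}. j \<le> e q} = P i" unfolding j_def by (rule G[OF ir(1) lt(1)]) simp
    have S': "{q \<in> {1..g}. mu (Suc (M i)) \<le> e q} = P (Suc i)"
      using G[OF ir(2), of "Suc (M i)"] lt by simp
    have "P i \<subset> P (Suc i)" using Pstep[OF ir(2)] by simp
    \<comment> \<open>Equal parts on both sides of the cut would have the same set of higher blocks,
      but these sets are \<open>P i\<close> and the larger \<open>P (Suc i)\<close>. Because of the
      drop, level \<open>j\<close> has exactly the state \<open>(P i, M i)\<close>.\<close>
    hence neq: "mu (Suc (M i)) < j"
      using S S' anti[of "M i" "Suc (M i)"] Mi unfolding j_def by (cases "mu (Suc (M i)) = mu (M i)") auto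
    have "M i \<le> snd (level_state g n e mu j)"
      using le_snd_level_state_iff[OF anti Mi(1)] j_def by simp
    moreover have "\<not> Suc (M i) \<le> snd (level_state g n e mu j)"
      using le_snd_level_state_iff[OF anti Mi(2)] neq by simp
    ultimately have "snd (level_state g n e mu j) = M i" by simp
    hence "level_state g n e mu j = (P i, M i)" using S by (simp add: level_state_def)
    moreover have "1 \<le> j" using neq by simp
    moreover have "(P i, M i) \<noteq> ({}, 0)" using Mi by simp
    ultimately show ?thesis unfolding levels_def by (metis DiffI atLeast_iff imageI singletonD)
  qed
  ultimately show ?thesis using is_chain_levels unfolding hook_chains_def by blast
qed

text \<open>Entries and parts are sums of multiplicities, so two sets of states are compared. A
  state with \<open>snd s \<ge> k\<close> contains all of \<open>P i\<close>. A state containing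
  some \<open>q\<close> outside \<open>P i\<close> lies in a later hook and has
  \<open>snd s \<ge> M i\<close>; the forced state \<open>(P i, M i)\<close> is counted for
  \<open>k\<close> but not for \<open>q\<close>, which makes the second inequality strict.\<close>

lemma good_chain:
  assumes Y: "Y \<in> hook_chains" and pos: "\<And>s. s \<in> Y \<Longrightarrow> 1 \<le> m s"
  shows "good (chain_e Y m) (chain_mu Y m)"
  unfolding good_def
proof (intro ballI allI impI)
  interpret weighted_chain g n Y m by (rule hook_chain_weighted[OF Y pos])
  fix i k assume i: "i \<in> {1..r}" and k: "M (i - 1) < k \<and> k \<le> M i"
  have hk: "\<exists>j\<in>{1..r}. s \<in> hook j" if "s \<in> Y" for s using Y that by (auto simp: hook_chains_def)
  have 1: "chain_mu Y m k \<le> chain_e Y m q" if "q \<in> P i" for q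
    unfolding chain_e_eq chain_mu_eq
  proof (rule sum_mono2)
    show "{s' \<in> Y. k \<le> snd s'} \<subseteq> {s' \<in> Y. q \<in> fst s'}"
    proof
      fix s assume s: "s \<in> {s' \<in> Y. k \<le> snd s'}"
      then obtain j where j: "j \<in> {1..r}" "s \<in> hook j" using hk by blast
      have "i \<le> j"
      proof (rule ccontr)
        assume "\<not> i \<le> j"
        hence "M j \<le> M (i - 1)" using i by (intro cuts_le[OF cM]) auto
        thus False using hook_bounds(4)[OF j] k s by simp
      qed
      have "P i \<subseteq> fst s"
      proof (cases "i = j")
        case True
        thus ?thesis using hook_bounds(8)[OF j] k s by simp
      next
        case False
        hence "P i \<subseteq> P (j - 1)" using \<open>i \<le> j\<close> j(1) by (intro Pmono) auto
        thus ?thesis using hook_bounds(1)[OF j] by blast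
      qed
      thus "s \<in> {s' \<in> Y. q \<in> fst s'}" using s that by blast
    qed
  qed (use fin in auto)
  have 2: "chain_e Y m q < chain_mu Y m k" if q: "q \<in> {1..g}" "q \<notin> P i" for q
  proof -
    have "i \<noteq> r"
    proof
      assume "i = r"
      thus False using q Pr by simp
    qed
    hence "i \<in> {1..<r}" using i by simp
    hence end_in: "(P i, M i) \<in> Y" using Y unfolding hook_chains_def by blast
    have sub: "insert (P i, M i) {s' \<in> Y. q \<in> fst s'} \<subseteq> {s' \<in> Y. k \<le> snd s'}"
    proof
      fix s assume s: "s \<in> insert (P i, M i) {s' \<in> Y. q \<in> fst s'}"
      show "s \<in> {s' \<in> Y. k \<le> snd s'}"
      proof (cases "s = (P i, M i)")
        case True
        thus ?thesis using end_in k by simp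
      next
        case False
        hence s': "s \<in> Y" "q \<in> fst s" using s by auto
        then obtain j where j: "j \<in> {1..r}" "s \<in> hook j" using hk by blast
        have "\<not> j \<le> i"
        proof
          assume "j \<le> i"
          hence "P j \<subseteq> P i" using i by (intro Pmono) auto
          thus False using hook_bounds(2)[OF j] s' q by blast
        qed
        hence "M i \<le> M (j - 1)" using j by (intro cuts_le[OF cM]) auto
        thus ?thesis using s' hook_bounds(3)[OF j] k by simp
      qed
    qed
    have "sum m (insert (P i, M i) {s' \<in> Y. q \<in> fst s'}) = m (P i, M i) + sum m {s' \<in> Y. q \<in> fst s'}"
      using fin q by simp
    moreover have "sum m (insert (P i, M i) {s' \<in> Y. q \<in> fst s'}) \<le> sum m {s' \<in> Y. k \<le> snd s'}"
      using fin by (intro sum_mono2[OF _ sub]) auto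
    ultimately show ?thesis unfolding chain_e_eq chain_mu_eq using pos[OF end_in] by simp
  qed
  have "P i \<subseteq> {1..g}" using i by (intro Psub) simp
  thus "{q \<in> {1..g}. chain_mu Y m k \<le> chain_e Y m q} = P i"
    using 1 2 by (auto simp: not_less[symmetric])
qed

section \<open>Good pairs correspond to chains with positive multiplicities\<close>

definition good_pairs :: "(nat list \<times> nat list) set"
  where "good_pairs = {(l, mus). l \<in> admissible n g f \<and> mus \<in> partitions n \<and> good (heights l) (\<lambda>k. mus !\<^sub>1 k)}"

abbreviation pair_levels :: "nat list \<times> nat list \<Rightarrow> (nat set \<times> nat) set"
  where "pair_levels z \<equiv> levels g n (heights (fst z)) (\<lambda>k. snd z !\<^sub>1 k)"

abbreviation pair_mult :: "nat list \<times> nat list \<Rightarrow> nat set \<times> nat \<Rightarrow> nat"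
  where "pair_mult z \<equiv> level_mult g n (heights (fst z)) (\<lambda>k. snd z !\<^sub>1 k)"

lemma partition_antimono:
  assumes "mus \<in> partitions n" "1 \<le> i" "i \<le> j" "j \<le> n"
  shows "mus !\<^sub>1 j \<le> mus !\<^sub>1 i"
  using assms by (cases "i = j") (auto simp: partitions_def sorted_wrt_iff_nth_less)

text \<open>The inverse sends a weighted chain to \<open>chain_e\<close> and
  \<open>chain_mu\<close>. Multiplicities are restricted to the chain so that they are unique as
  extensional functions, which lets each be summed independently.\<close>

lemma bij_betw_good_pairs:
  "bij_betw (\<lambda>z. (pair_levels z, restrict (pair_mult z) (pair_levels z)))
     good_pairs (SIGMA Y:hook_chains. Y \<rightarrow>\<^sub>E {1..})"
proof (rule bij_betwI[where g = "\<lambda>(Y, m). (block_list g f (chain_e Y m), map (chain_mu Y m) [1..<n + 1])"])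
  show "(\<lambda>z. (pair_levels z, restrict (pair_mult z) (pair_levels z))) \<in> good_pairs \<rightarrow> (SIGMA Y:hook_chains. Y \<rightarrow>\<^sub>E {1..})"
  proof
    fix z assume "z \<in> good_pairs"
    hence z: "snd z \<in> partitions n" "good (heights (fst z)) (\<lambda>k. snd z !\<^sub>1 k)" by (auto simp: good_pairs_def)
    have "pair_levels z \<in> hook_chains"
      by (rule levels_hook_chain[OF z(2)]) (rule partition_antimono[OF z(1)])
    thus "(pair_levels z, restrict (pair_mult z) (pair_levels z)) \<in> (SIGMA Y:hook_chains. Y \<rightarrow>\<^sub>E {1..})"
      using level_mult_pos by auto
  qed
next
  fix z assume z: "z \<in> good_pairs"
  obtain l mus where zz: "z = (l, mus)" by (metis surj_pair)
  have l: "l \<in> admissible n g f" and mus: "mus \<in> partitions n" using z by (auto simp: zz good_pairs_def)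
  define Y where "Y = levels g n (heights l) (\<lambda>k. mus !\<^sub>1 k)"
  define m where "m = restrict (level_mult g n (heights l) (\<lambda>k. mus !\<^sub>1 k)) Y"
  have e: "chain_e Y m q = heights l q" if "q \<in> {1..g}" for q
    unfolding chain_e_def e_eq_sum_levels[OF that, where e = "heights l" and n = n and mu = "\<lambda>k. mus !\<^sub>1 k"] Y_def m_def
    by (intro sum.cong) auto
  have mu: "chain_mu Y m k = mus !\<^sub>1 k" if "k \<in> {1..n}" for k
  proof -
    have "mus !\<^sub>1 k = (\<Sum>s\<in>Y. if k \<le> snd s then level_mult g n (heights l) (\<lambda>k. mus !\<^sub>1 k) s else 0)"
      unfolding Y_def by (rule mu_eq_sum_levels[OF partition_antimono[OF mus] that])
    also have "\<dots> = chain_mu Y m k"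
      unfolding chain_mu_def m_def by (intro sum.cong) auto
    finally show ?thesis by (rule sym)
  qed
  have "block_list g f (chain_e Y m) = block_list g f (heights l)"
    unfolding block_list_def by (intro arg_cong[where f = concat] map_cong refl) (use e in auto)
  also have "\<dots> = l" using admissible_eq_block_list[OF f1 sum_f l] by (simp add: heights_def[abs_def])
  finally have 1: "block_list g f (chain_e Y m) = l" .
  have 2: "map (chain_mu Y m) [1..<n + 1] = mus"
  proof (rule nth_equalityI)
    show "length (map (chain_mu Y m) [1..<n + 1]) = length mus" using mus by (simp add: partitions_def)
    fix i assume "i < length (map (chain_mu Y m) [1..<n + 1])"
    hence "i < n" by (simp del: upt_Suc)
    thus "map (chain_mu Y m) [1..<n + 1] ! i = mus ! i" using mu[of "Suc i"] by (simp del: upt_Suc)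
  qed
  show "(case (pair_levels z, restrict (pair_mult z) (pair_levels z)) of
      (Y, m) \<Rightarrow> (block_list g f (chain_e Y m), map (chain_mu Y m) [1..<n + 1])) = z"
    using 1 2 unfolding Y_def m_def zz by simp
next
  have aux: "(block_list g f (chain_e Y m), map (chain_mu Y m) [1..<n + 1]) \<in> good_pairs \<and>
      levels g n (heights (block_list g f (chain_e Y m))) (\<lambda>k. map (chain_mu Y m) [1..<n + 1] !\<^sub>1 k) = Y \<and>
      restrict (level_mult g n (heights (block_list g f (chain_e Y m))) (\<lambda>k. map (chain_mu Y m) [1..<n + 1] !\<^sub>1 k)) Y = m"
    if Y: "Y \<in> hook_chains" and m: "m \<in> Y \<rightarrow>\<^sub>E {1..}" for Y m
  proof -
    have pos: "1 \<le> m s" if "s \<in> Y" for s using m that by auto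
    interpret weighted_chain g n Y m by (rule hook_chain_weighted[OF Y pos])
    define l where "l = block_list g f (chain_e Y m)"
    define mus where "mus = map (chain_mu Y m) [1..<n + 1]"
    have e: "heights l q = chain_e Y m q" if "q \<in> {1..g}" for q
      unfolding heights_def l_def by (rule nth_block_list_psum[OF f1 that])
    have mu: "mus !\<^sub>1 k = chain_mu Y m k" if "k \<in> {1..n}" for k
      using that unfolding mus_def by (auto simp del: upt_Suc)
    have st: "level_state g n (heights l) (\<lambda>k. mus !\<^sub>1 k) = level_state g n (chain_e Y m) (chain_mu Y m)"
      by (rule level_state_cong) (use e mu in auto)
    have lev: "levels g n (heights l) (\<lambda>k. mus !\<^sub>1 k) = Y"
      using levels_chain unfolding levels_def st .
    have mult: "level_mult g n (heights l) (\<lambda>k. mus !\<^sub>1 k) s = m s" if "s \<in> Y" for s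
      using level_mult_chain[OF that] unfolding level_mult_def st .
    have gc: "good (chain_e Y m) (chain_mu Y m)" by (rule good_chain[OF Y]) (rule pos)
    have "good (heights l) (\<lambda>k. mus !\<^sub>1 k)"
      unfolding good_def
    proof (intro ballI allI impI)
      fix i k assume i: "i \<in> {1..r}" and k: "M (i - 1) < k \<and> k \<le> M i"
      have kn: "k \<in> {1..n}" using k cuts_le_n[OF cM, of i] i by auto
      have "{q \<in> {1..g}. mus !\<^sub>1 k \<le> heights l q} = {q \<in> {1..g}. chain_mu Y m k \<le> chain_e Y m q}"
        using e mu[OF kn] by auto
      thus "{q \<in> {1..g}. mus !\<^sub>1 k \<le> heights l q} = P i"
        using gc i k unfolding good_def by blast
    qed
    moreover have "mus \<in> partitions n"
      unfolding partitions_def mus_def sorted_wrt_map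
      using chain_mu_antimono by (auto simp: sorted_wrt_iff_nth_less simp del: upt_Suc)
    moreover have "l \<in> admissible n g f" unfolding l_def by (rule block_list_admissible[OF f1 sum_f])
    ultimately have "(l, mus) \<in> good_pairs" by (simp add: good_pairs_def)
    moreover have "restrict (level_mult g n (heights l) (\<lambda>k. mus !\<^sub>1 k)) Y = m"
      using mult m by (auto simp: fun_eq_iff PiE_iff extensional_def)
    ultimately show ?thesis using lev unfolding l_def mus_def by blast
  qed
  show "(\<lambda>(Y, m). (block_list g f (chain_e Y m), map (chain_mu Y m) [1..<n + 1])) \<in> (SIGMA Y:hook_chains. Y \<rightarrow>\<^sub>E {1..}) \<rightarrow> good_pairs"
  proof
    fix z assume z: "z \<in> (SIGMA Y:hook_chains. Y \<rightarrow>\<^sub>E {1::nat..})"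
    obtain Y m where zz: "z = (Y, m)" by (metis surj_pair)
    have "Y \<in> hook_chains" "m \<in> Y \<rightarrow>\<^sub>E {1..}" using z unfolding zz mem_Sigma_iff by simp_all
    from conjunct1[OF aux[OF this]]
    show "(\<lambda>(Y, m). (block_list g f (chain_e Y m), map (chain_mu Y m) [1..<n + 1])) z \<in> good_pairs"
      unfolding zz prod.case .
  qed
  fix z assume "z \<in> (SIGMA Y:hook_chains. Y \<rightarrow>\<^sub>E {1::nat..})"
  moreover obtain Y m where zz: "z = (Y, m)" by (metis surj_pair)
  ultimately have z: "z = (Y, m)" "Y \<in> hook_chains" "m \<in> Y \<rightarrow>\<^sub>E {1..}"
    by (simp_all only: mem_Sigma_iff)
  show "(pair_levels ((\<lambda>(Y, m). (block_list g f (chain_e Y m), map (chain_mu Y m) [1..<n + 1])) z),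
      restrict (pair_mult ((\<lambda>(Y, m). (block_list g f (chain_e Y m), map (chain_mu Y m) [1..<n + 1])) z))
        (pair_levels ((\<lambda>(Y, m). (block_list g f (chain_e Y m), map (chain_mu Y m) [1..<n + 1])) z))) = z"
    using aux[OF z(2,3)] unfolding z(1) prod.case fst_conv snd_conv by simp
qed

end

section \<open>The generating function as a sum over chains\<close>

lemma sum_if_le:
  fixes b n c :: nat
  assumes "b \<le> n"
  shows "(\<Sum>k=1..n. if k \<le> b then c else 0) = c * b"
proof -
  have "(\<Sum>k=1..n. if k \<le> b then c else 0) = (\<Sum>k\<in>{k \<in> {1..n}. k \<le> b}. c)"
    by (rule sum.inter_filter[symmetric]) simp
  also have "{k \<in> {1..n}. k \<le> b} = {1..b}" using assms by auto
  finally show ?thesis by simp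
qed

lemma sum_if_mem:
  fixes f :: "nat \<Rightarrow> nat"
  assumes "S \<subseteq> {1..g}"
  shows "(\<Sum>q=1..g. f q * (if q \<in> S then c else 0)) = c * sum f S"
proof -
  have "(\<Sum>q=1..g. f q * (if q \<in> S then c else 0)) = (\<Sum>q=1..g. if q \<in> S then f q * c else 0)"
    by (intro sum.cong) auto
  also have "\<dots> = (\<Sum>q\<in>{q \<in> {1..g}. q \<in> S}. f q * c)"
    by (rule sum.inter_filter[symmetric]) simp
  also have "{q \<in> {1..g}. q \<in> S} = S" using assms by blast
  also have "(\<Sum>q\<in>S. f q * c) = c * sum f S" by (simp add: sum_distrib_left mult.commute)
  finally show ?thesis .
qed

lemma levels_bounds:
  assumes "s \<in> levels g n e mu"
  shows "fst s \<subseteq> {1..g}" "snd s \<le> n"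
proof -
  obtain j where j: "s = level_state g n e mu j" using assms by (auto simp: levels_def)
  show "fst s \<subseteq> {1..g}" by (auto simp: j level_state_def)
  have "card {k \<in> {1..n}. j \<le> mu k} \<le> card {1..n}" by (intro card_mono) auto
  thus "snd s \<le> n" by (simp add: j level_state_def)
qed

lemma sum_e_levels: "(\<Sum>q=1..g. f q * e q) = (\<Sum>s\<in>levels g n e mu. level_mult g n e mu s * sum f (fst s))"
  for f :: "nat \<Rightarrow> nat"
proof -
  have "(\<Sum>q=1..g. f q * e q) = (\<Sum>q=1..g. \<Sum>s\<in>levels g n e mu. f q * (if q \<in> fst s then level_mult g n e mu s else 0))"
    by (intro sum.cong refl) (simp only: e_eq_sum_levels[where n = n and mu = mu and e = e] sum_distrib_left)
  also have "\<dots> = (\<Sum>s\<in>levels g n e mu. \<Sum>q=1..g. f q * (if q \<in> fst s then level_mult g n e mu s else 0))" by (rule sum.swap)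
  also have "\<dots> = (\<Sum>s\<in>levels g n e mu. level_mult g n e mu s * sum f (fst s))"
    by (intro sum.cong refl sum_if_mem levels_bounds)
  finally show ?thesis .
qed

context
  fixes g n :: nat and f e mu :: "nat \<Rightarrow> nat"
  assumes anti: "\<And>i j. 1 \<le> i \<Longrightarrow> i \<le> j \<Longrightarrow> j \<le> n \<Longrightarrow> mu j \<le> mu i"
begin

private abbreviation (input) "Y \<equiv> levels g n e mu"
private abbreviation (input) "m \<equiv> level_mult g n e mu"

lemma sum_mu_levels: "(\<Sum>k=1..n. mu k) = (\<Sum>s\<in>Y. m s * snd s)"
proof -
  have "(\<Sum>k=1..n. mu k) = (\<Sum>k=1..n. \<Sum>s\<in>Y. if k \<le> snd s then m s else 0)"
    by (intro sum.cong refl mu_eq_sum_levels[OF anti])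
  also have "\<dots> = (\<Sum>s\<in>Y. \<Sum>k=1..n. if k \<le> snd s then m s else 0)" by (rule sum.swap)
  also have "\<dots> = (\<Sum>s\<in>Y. m s * snd s)"
    by (intro sum.cong refl sum_if_le levels_bounds)
  finally show ?thesis .
qed

text \<open>Exchanging summations, a state \<open>(S, b)\<close> is met once for each
  \<open>k \<le> b\<close> and each \<open>q \<in> S\<close> with weight \<open>f q\<close>, so once
  per level it contributes \<open>b * sum f S\<close>.\<close>

lemma sum_min_e_levels:
  "(\<Sum>k=1..n. \<Sum>q=1..g. f q * min (mu k) (e q)) = (\<Sum>s\<in>Y. m s * (snd s * sum f (fst s)))"
proof -
  have "(\<Sum>q=1..g. f q * min (mu k) (e q)) = (\<Sum>s\<in>Y. if k \<le> snd s then m s * sum f (fst s) else 0)"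
    if k: "k \<in> {1..n}" for k
  proof -
    have "(\<Sum>q=1..g. f q * min (mu k) (e q)) =
        (\<Sum>q=1..g. \<Sum>s\<in>Y. f q * (if q \<in> fst s then (if k \<le> snd s then m s else 0) else 0))"
    proof (intro sum.cong refl)
      fix q assume q: "q \<in> {1..g}"
      have "min (mu k) (e q) = (\<Sum>s\<in>Y. if k \<le> snd s \<and> q \<in> fst s then m s else 0)"
        by (rule min_mu_e_eq_sum_levels) (use anti k q in auto)
      also have "\<dots> = (\<Sum>s\<in>Y. if q \<in> fst s then (if k \<le> snd s then m s else 0) else 0)"
        by (intro sum.cong refl) simp
      finally show "f q * min (mu k) (e q) = (\<Sum>s\<in>Y. f q * (if q \<in> fst s then (if k \<le> snd s then m s else 0) else 0))"
        by (simp only: sum_distrib_left)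
    qed
    also have "\<dots> = (\<Sum>s\<in>Y. \<Sum>q=1..g. f q * (if q \<in> fst s then (if k \<le> snd s then m s else 0) else 0))"
      by (rule sum.swap)
    also have "\<dots> = (\<Sum>s\<in>Y. (if k \<le> snd s then m s else 0) * sum f (fst s))"
      by (intro sum.cong refl sum_if_mem levels_bounds)
    also have "\<dots> = (\<Sum>s\<in>Y. if k \<le> snd s then m s * sum f (fst s) else 0)"
      by (intro sum.cong refl) simp
    finally show ?thesis .
  qed
  hence "(\<Sum>k=1..n. \<Sum>q=1..g. f q * min (mu k) (e q)) =
      (\<Sum>k=1..n. \<Sum>s\<in>Y. if k \<le> snd s then m s * sum f (fst s) else 0)"
    by (intro sum.cong refl)
  also have "\<dots> = (\<Sum>s\<in>Y. \<Sum>k=1..n. if k \<le> snd s then m s * sum f (fst s) else 0)" by (rule sum.swap)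
  also have "\<dots> = (\<Sum>s\<in>Y. m s * sum f (fst s) * snd s)"
    by (intro sum.cong refl sum_if_le levels_bounds)
  finally show ?thesis by (simp only: mult.assoc mult.commute mult.left_commute)
qed

lemma sum_min_mu_levels:
  "(\<Sum>k=1..n. \<Sum>i=1..n. min (mu k) (mu i)) = (\<Sum>s\<in>Y. m s * (snd s * snd s))"
proof -
  have "(\<Sum>i=1..n. min (mu k) (mu i)) = (\<Sum>s\<in>Y. if k \<le> snd s then m s * snd s else 0)"
    if k: "k \<in> {1..n}" for k
  proof -
    have "(\<Sum>i=1..n. min (mu k) (mu i)) =
        (\<Sum>i=1..n. \<Sum>s\<in>Y. if i \<le> snd s then (if k \<le> snd s then m s else 0) else 0)"
    proof (intro sum.cong refl)
      fix i assume i: "i \<in> {1..n}"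
      have "min (mu k) (mu i) = (\<Sum>s\<in>Y. if k \<le> snd s \<and> i \<le> snd s then m s else 0)"
        by (rule min_mu_mu_eq_sum_levels) (use anti k i in auto)
      also have "\<dots> = (\<Sum>s\<in>Y. if i \<le> snd s then (if k \<le> snd s then m s else 0) else 0)"
        by (intro sum.cong refl) simp
      finally show "min (mu k) (mu i) = (\<Sum>s\<in>Y. if i \<le> snd s then (if k \<le> snd s then m s else 0) else 0)" .
    qed
    also have "\<dots> = (\<Sum>s\<in>Y. \<Sum>i=1..n. if i \<le> snd s then (if k \<le> snd s then m s else 0) else 0)"
      by (rule sum.swap)
    also have "\<dots> = (\<Sum>s\<in>Y. (if k \<le> snd s then m s else 0) * snd s)"
      by (intro sum.cong refl sum_if_le levels_bounds)
    also have "\<dots> = (\<Sum>s\<in>Y. if k \<le> snd s then m s * snd s else 0)"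
      by (intro sum.cong refl) simp
    finally show ?thesis .
  qed
  hence "(\<Sum>k=1..n. \<Sum>i=1..n. min (mu k) (mu i)) =
      (\<Sum>k=1..n. \<Sum>s\<in>Y. if k \<le> snd s then m s * snd s else 0)"
    by (intro sum.cong refl)
  also have "\<dots> = (\<Sum>s\<in>Y. \<Sum>k=1..n. if k \<le> snd s then m s * snd s else 0)" by (rule sum.swap)
  also have "\<dots> = (\<Sum>s\<in>Y. m s * snd s * snd s)"
    by (intro sum.cong refl sum_if_le levels_bounds)
  finally show ?thesis by (simp only: mult.assoc)
qed

text \<open>The level \<open>mu k\<close> itself has second component equal to the right-hand side.
  Any state with second component at least \<open>k\<close> sits at a level not above
  \<open>mu k\<close>, so its second component is at least as large. For \<open>mu k = 0\<close> no
  positive level is available; the value is then \<open>n\<close>, which is why \<open>n\<close> is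
  inserted.\<close>

lemma next_in_levels:
  assumes k: "k \<in> {1..n}"
  shows "next_in (insert n (snd ` Y)) k = card {k' \<in> {1..n}. mu k \<le> mu k'}"
proof -
  have le_iff: "k \<le> snd (level_state g n e mu j) \<longleftrightarrow> j \<le> mu k" for j
    by (rule le_snd_level_state_iff) (use anti k in auto)
  show ?thesis
    unfolding next_in_def
  proof (rule Min_eqI)
    show "finite {c \<in> insert n (snd ` Y). k \<le> c}" using finite_levels by simp
    define c where "c = card {k' \<in> {1..n}. mu k \<le> mu k'}"
    have c: "c = snd (level_state g n e mu (mu k))" by (simp add: c_def level_state_def)
    have kc: "k \<le> c" unfolding c using le_iff by simp
    have "c \<in> insert n (snd ` Y)"
    proof (cases "mu k = 0")
      case True
      hence "{k' \<in> {1..n}. mu k \<le> mu k'} = {1..n}" by auto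
      thus ?thesis by (simp add: c_def)
    next
      case False
      have "level_state g n e mu (mu k) \<noteq> ({}, 0)"
      proof
        assume "level_state g n e mu (mu k) = ({}, 0)"
        hence "c = 0" unfolding c by simp
        thus False using kc k by simp
      qed
      hence "level_state g n e mu (mu k) \<in> Y" using False by (simp add: levels_def)
      thus ?thesis unfolding c by (intro insertI2 imageI)
    qed
    thus "card {k' \<in> {1..n}. mu k \<le> mu k'} \<in> {c \<in> insert n (snd ` Y). k \<le> c}"
      using kc by (simp add: c_def)
  next
    fix b assume b: "b \<in> {c \<in> insert n (snd ` Y). k \<le> c}"
    show "card {k' \<in> {1..n}. mu k \<le> mu k'} \<le> b"
    proof (cases "b = n")
      case True
      have "card {k' \<in> {1..n}. mu k \<le> mu k'} \<le> card {1..n}" by (intro card_mono) auto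
      thus ?thesis using True by simp
    next
      case False
      then obtain s where s: "s \<in> Y" "b = snd s" using b by blast
      then obtain j where j: "s = level_state g n e mu j" by (auto simp: levels_def)
      have "k \<le> snd (level_state g n e mu j)" using b s j by simp
      hence "j \<le> mu k" using le_iff by blast
      hence "card {k' \<in> {1..n}. mu k \<le> mu k'} \<le> card {k' \<in> {1..n}. j \<le> mu k'}"
        by (intro card_mono) auto
      thus ?thesis using s j by (simp add: level_state_def)
    qed
  qed
qed

end

lemma count_ge_eq_card:
  assumes "length xs = n"
  shows "count_ge xs x = card {k \<in> {1..n}. x \<le> xs !\<^sub>1 k}"
proof -
  have "bij_betw Suc {i. i < length xs \<and> x \<le> xs ! i} {k \<in> {1..n}. x \<le> xs !\<^sub>1 k}"
    by (rule bij_betwI[where g = "\<lambda>k. k - 1"]) (use assms in auto)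
  from bij_betw_same_card[OF this] show ?thesis by (simp only: count_ge_def length_filter_conv_card)
qed

lemma sum_list_eq_sum_from_one:
  fixes h :: "'a \<Rightarrow> nat"
  assumes "length xs = n"
  shows "sum_list (map h xs) = (\<Sum>k=1..n. h (xs !\<^sub>1 k))"
proof -
  have "sum_list (map h xs) = (\<Sum>i<n. h (xs ! i))"
    using assms by (simp add: sum_list_sum_nth atLeast0LessThan)
  also have "\<dots> = (\<Sum>k=1..n. h (xs !\<^sub>1 k))"
    by (rule sum.reindex_bij_witness[of _ "\<lambda>k. k - 1" Suc]) auto
  finally show ?thesis .
qed

lemma prod_from_one: "(\<Prod>k<n. h k) = (\<Prod>k=1..n. h (k - 1))" for h :: "nat \<Rightarrow> 'a::comm_monoid_mult"
  by (rule prod.reindex_bij_witness[of _ "\<lambda>k. k - 1" Suc]) auto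

lemma prod_cuts:
  assumes "cuts n r M"
  shows "(\<Prod>k=1..n. h k) = (\<Prod>i=1..r. \<Prod>k=M (i - 1) + 1..M i. h k)"
proof -
  have "(\<Prod>k=1..M i. h k) = (\<Prod>i=1..i. \<Prod>k=M (i - 1) + 1..M i. h k)" if "i \<le> r" for i
    using that
  proof (induction i)
    case 0
    show ?case using assms by (simp add: cuts_def)
  next
    case (Suc i)
    have "M i \<le> M (Suc i)" using cuts_le[OF assms, of i "Suc i"] Suc.prems by simp
    from prod_split_at[OF this, of h] Suc show ?case by simp
  qed
  from this[of r] show ?thesis using assms by (simp add: cuts_def)
qed

section \<open>The summand of a pair in terms of its chain\<close>

context dyck_blocks
begin

definition state_weight :: "nat \<Rightarrow> nat set \<times> nat \<Rightarrow> rat fps"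
  where "state_weight p s = fps_const (of_nat p ^ (snd s * (2 * n + sum f (fst s) - snd s))) * fps_X ^ (2 * sum f (fst s) + snd s)"

text \<open>The part of the subgroup count that is not a power of \<open>p\<close>. In run
  \<open>i\<close> the count in the ambient group is constantly \<open>L i\<close>, and the count in
  the subgroup is the end of the run of equal parts, so only the second components of the chain
  enter.\<close>

definition chain_coeff :: "rat \<Rightarrow> nat set \<Rightarrow> rat"
  where "chain_coeff y B = (\<Prod>i=1..r. \<Prod>k=M (i - 1) + 1..M i.
    (1 - y ^ (L i + 1 - k)) / (1 - y ^ (next_in (insert n B) k + 1 - k)))"

definition pair_term :: "nat \<Rightarrow> nat list \<times> nat list \<Rightarrow> rat fps"
  where "pair_term p = (\<lambda>(l, mus). of_nat (num_subgroups (sort_desc l) mus p) *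
       (of_nat p ^ (2 * n) * fps_X) ^ (\<Sum>i=1..n. mus !\<^sub>1 i) *
       fps_X ^ (2 * (\<Sum>i=1..n. l !\<^sub>1 i)))"

text \<open>The exponents of \<open>p\<close> and \<open>t\<close> are sums over the entries of the
  pair; expanding each over the levels collects one power of \<open>state_weight\<close> per
  state.\<close>

lemma pair_term_eq:
  assumes p: "prime p" and z: "z \<in> good_pairs"
  shows "pair_term p z = fps_const (chain_coeff (1 / of_nat p) (snd ` pair_levels z)) *
    (\<Prod>s\<in>pair_levels z. state_weight p s ^ pair_mult z s)"
proof -
  obtain l mus where zz: "z = (l, mus)" by (metis surj_pair)
  have l: "l \<in> admissible n g f" and mus: "mus \<in> partitions n"
    and good: "good (heights l) (\<lambda>k. mus !\<^sub>1 k)" using z by (auto simp: zz good_pairs_def)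
  have lenl: "length l = n" using l by (simp add: admissible_def)
  have lenmu: "length mus = n" and smu: "sorted_wrt (\<ge>) mus" using mus by (auto simp: partitions_def)
  define la where "la = sort_desc l"
  have lenla: "length la = n" using lenl by (simp add: la_def sort_desc_def)
  define mu where "mu = (\<lambda>k. mus !\<^sub>1 k)"
  have anti: "mu j \<le> mu i" if "1 \<le> i" "i \<le> j" "j \<le> n" for i j
    unfolding mu_def by (rule partition_antimono[OF mus that])
  define Y where "Y = levels g n (heights l) mu"
  define m where "m = level_mult g n (heights l) mu"
  define P' where "P' = (of_nat p :: rat)"
  have P': "P' \<noteq> 0" using p by (auto simp: P'_def)
  have lbl: "block_list g f (heights l) = l"
    using admissible_eq_block_list[OF f1 sum_f l] by (simp add: heights_def[abs_def])
  have cnt: "count_ge la (mu k) = L i" if "i \<in> {1..r}" "M (i - 1) < k" "k \<le> M i" for i k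
  proof -
    have "{q \<in> {1..g}. mu k \<le> heights l q} = P i" using good that unfolding good_def mu_def by blast
    thus ?thesis using count_ge_heights[OF l] FP[of i] that by (simp add: la_def count_ge_sort_desc)
  qed
  have le: "k < count_ge la (mus ! k)" if "k < length mus" for k
  proof -
    have k1: "1 \<le> Suc k" "Suc k \<le> n" using that lenmu by auto
    obtain i where i: "i \<in> {1..r}" "M (i - 1) < Suc k" "Suc k \<le> M i"
      using cuts_block_exists[OF cM k1] .
    thus ?thesis using cnt[OF i] M_le_L[of i] by (simp add: mu_def)
  qed
  define a where "a = (\<Sum>k=1..n. sum_list (map (min (mu k)) la))"
  define c where "c = (\<Sum>k=1..n. sum_list (map (min (mu k)) mus))"
  have aY: "a = (\<Sum>s\<in>Y. m s * (snd s * sum f (fst s)))"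
  proof -
    have "sum_list (map (min x) la) = (\<Sum>q=1..g. f q * min x (heights l q))" for x
      unfolding la_def sum_list_map_sort_desc using sum_list_map_block_list[of "min x" g f "heights l"] lbl by simp
    hence "a = (\<Sum>k=1..n. \<Sum>q=1..g. f q * min (mu k) (heights l q))" by (simp only: a_def)
    also have "\<dots> = (\<Sum>s\<in>Y. m s * (snd s * sum f (fst s)))"
      unfolding Y_def m_def by (rule sum_min_e_levels) (rule anti)
    finally show ?thesis .
  qed
  have cY: "c = (\<Sum>s\<in>Y. m s * (snd s * snd s))"
  proof -
    have "c = (\<Sum>k=1..n. \<Sum>i=1..n. min (mu k) (mu i))"
      unfolding c_def sum_list_eq_sum_from_one[OF lenmu] mu_def ..
    also have "\<dots> = (\<Sum>s\<in>Y. m s * (snd s * snd s))"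
      unfolding Y_def m_def by (rule sum_min_mu_levels) (rule anti)
    finally show ?thesis .
  qed
  have muY: "(\<Sum>i=1..n. mus !\<^sub>1 i) = (\<Sum>s\<in>Y. m s * snd s)"
  proof -
    have "(\<Sum>k=1..n. mu k) = (\<Sum>s\<in>Y. m s * snd s)"
      unfolding Y_def m_def by (rule sum_mu_levels) (rule anti)
    thus ?thesis by (simp only: mu_def)
  qed
  have lY: "(\<Sum>i=1..n. l !\<^sub>1 i) = (\<Sum>s\<in>Y. m s * sum f (fst s))"
  proof -
    have "(\<Sum>i=1..n. l !\<^sub>1 i) = sum_list (map (\<lambda>x. x) l)"
      using sum_list_eq_sum_from_one[OF lenl, of "\<lambda>x. x"] by simp
    also have "\<dots> = (\<Sum>q=1..g. f q * heights l q)"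
      using sum_list_map_block_list[of "\<lambda>x. x" g f "heights l"] lbl by simp
    also have "\<dots> = (\<Sum>s\<in>Y. m s * sum f (fst s))"
      unfolding Y_def m_def by (rule sum_e_levels)
    finally show ?thesis .
  qed
  have coeff: "(\<Prod>k<length mus. (1 - (1 / P') ^ (count_ge la (mus ! k) - k)) / (1 - (1 / P') ^ (count_ge mus (mus ! k) - k)))
      = chain_coeff (1 / P') (snd ` Y)"
  proof -
    have "(\<Prod>k<length mus. (1 - (1 / P') ^ (count_ge la (mus ! k) - k)) / (1 - (1 / P') ^ (count_ge mus (mus ! k) - k)))
      = (\<Prod>k=1..n. (1 - (1 / P') ^ (count_ge la (mu k) + 1 - k)) / (1 - (1 / P') ^ (count_ge mus (mu k) + 1 - k)))"
      unfolding lenmu prod_from_one by (intro prod.cong refl) (simp add: mu_def)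
    also have "\<dots> = (\<Prod>i=1..r. \<Prod>k=M (i - 1) + 1..M i.
        (1 - (1 / P') ^ (count_ge la (mu k) + 1 - k)) / (1 - (1 / P') ^ (count_ge mus (mu k) + 1 - k)))"
      by (rule prod_cuts[OF cM])
    also have "\<dots> = chain_coeff (1 / P') (snd ` Y)"
      unfolding chain_coeff_def
    proof (intro prod.cong refl)
      fix i k assume i: "i \<in> {1..r}" and k: "k \<in> {M (i - 1) + 1..M i}"
      have kn: "k \<in> {1..n}" using k i cuts_le_n[OF cM, of i] by auto
      have "count_ge mus (mu k) = next_in (insert n (snd ` Y)) k"
      proof -
        have "next_in (insert n (snd ` Y)) k = card {k' \<in> {1..n}. mu k \<le> mu k'}"
          unfolding Y_def by (rule next_in_levels[OF _ kn]) (rule anti)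
        thus ?thesis unfolding count_ge_eq_card[OF lenmu] by (simp only: mu_def)
      qed
      moreover have "count_ge la (mu k) = L i" using k by (intro cnt[OF i]) auto
      ultimately show "(1 - (1 / P') ^ (count_ge la (mu k) + 1 - k)) / (1 - (1 / P') ^ (count_ge mus (mu k) + 1 - k)) =
        (1 - (1 / P') ^ (L i + 1 - k)) / (1 - (1 / P') ^ (next_in (insert n (snd ` Y)) k + 1 - k))" by simp
    qed
    finally show ?thesis .
  qed
  have "(\<Prod>k<length mus. P' ^ sum_list (map (min (mus ! k)) la) / P' ^ sum_list (map (min (mus ! k)) mus)) = P' ^ a / P' ^ c"
    unfolding lenmu prod_from_one prod_dividef a_def c_def power_sum by (simp add: mu_def)
  hence num: "of_nat (num_subgroups la mus p) = P' ^ a / P' ^ c * chain_coeff (1 / P') (snd ` Y)"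
    using num_subgroups_eq[OF p smu le] lenla lenmu coeff unfolding P'_def by simp
  define w where "w = (\<Sum>s\<in>Y. m s * (snd s * (2 * n + sum f (fst s) - snd s)))"
  \<comment> \<open>The balance of exponents is stated without a difference of totals; inside
    \<open>w\<close> the subtraction is genuine since \<open>snd s \<le> n\<close>.\<close>
  have exps: "a + 2 * n * (\<Sum>s\<in>Y. m s * snd s) = c + w"
  proof -
    have "m s * (snd s * sum f (fst s)) + 2 * n * (m s * snd s) = m s * (snd s * snd s) + m s * (snd s * (2 * n + sum f (fst s) - snd s))"
      if "s \<in> Y" for s
    proof -
      have "snd s \<le> n" using levels_bounds(2) that unfolding Y_def by blast
      then obtain d where d: "2 * n + sum f (fst s) = snd s + d" by (metis le_add1 le_Suc_ex mult_2 order.trans)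
      have "m s * (snd s * sum f (fst s)) + 2 * n * (m s * snd s) = m s * (snd s * (2 * n + sum f (fst s)))"
        by (simp add: algebra_simps)
      thus ?thesis unfolding d by (simp add: algebra_simps)
    qed
    thus ?thesis unfolding aY cY w_def sum_distrib_left sum.distrib[symmetric] by (intro sum.cong refl)
  qed
  have "P' ^ a * P' ^ (2 * n * (\<Sum>s\<in>Y. m s * snd s)) = P' ^ c * P' ^ w"
    unfolding power_add[symmetric] exps ..
  hence powers: "P' ^ a / P' ^ c * P' ^ (2 * n * (\<Sum>s\<in>Y. m s * snd s)) = P' ^ w"
    using P' by (simp add: field_simps)
  have "pair_term p z = fps_const (of_nat (num_subgroups la mus p)) *
      (fps_const (P' ^ (2 * n)) * fps_X) ^ (\<Sum>s\<in>Y. m s * snd s) * fps_X ^ (2 * (\<Sum>s\<in>Y. m s * sum f (fst s)))"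
    unfolding pair_term_def zz prod.case muY lY la_def P'_def
    by (simp only: fps_of_nat[symmetric] fps_const_power[symmetric])
  also have "\<dots> = fps_const (of_nat (num_subgroups la mus p) * P' ^ (2 * n * (\<Sum>s\<in>Y. m s * snd s))) *
      fps_X ^ ((\<Sum>s\<in>Y. m s * snd s) + 2 * (\<Sum>s\<in>Y. m s * sum f (fst s)))"
    by (simp only: power_mult_distrib fps_const_power fps_const_mult[symmetric] power_mult power_add mult.assoc)
  also have "of_nat (num_subgroups la mus p) * P' ^ (2 * n * (\<Sum>s\<in>Y. m s * snd s)) = chain_coeff (1 / P') (snd ` Y) * P' ^ w"
    unfolding num powers[symmetric] by (simp only: mult.assoc mult.commute mult.left_commute)
  also have "(\<Sum>s\<in>Y. m s * snd s) + 2 * (\<Sum>s\<in>Y. m s * sum f (fst s)) = (\<Sum>s\<in>Y. m s * (2 * sum f (fst s) + snd s))"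
    unfolding sum_distrib_left[of 2 "\<lambda>s. m s * sum f (fst s)" Y] sum.distrib[symmetric]
    by (intro sum.cong refl) (simp add: distrib_left mult.left_commute)
  finally have 1: "pair_term p z = fps_const (chain_coeff (1 / P') (snd ` Y)) *
      (fps_const (P' ^ w) * fps_X ^ (\<Sum>s\<in>Y. m s * (2 * sum f (fst s) + snd s)))"
    by (simp only: fps_const_mult[symmetric] mult.assoc)
  have "state_weight p s ^ m s = fps_const (P' ^ (m s * (snd s * (2 * n + sum f (fst s) - snd s)))) * fps_X ^ (m s * (2 * sum f (fst s) + snd s))" for s
    unfolding state_weight_def P'_def power_mult_distrib fps_const_power power_mult[symmetric] by (simp only: mult.commute)
  hence "(\<Prod>s\<in>Y. state_weight p s ^ m s) = (\<Prod>s\<in>Y. fps_const (P' ^ (m s * (snd s * (2 * n + sum f (fst s) - snd s))))) *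
      (\<Prod>s\<in>Y. fps_X ^ (m s * (2 * sum f (fst s) + snd s)))"
    by (simp only: prod.distrib)
  also have "(\<Prod>s\<in>Y. fps_const (P' ^ (m s * (snd s * (2 * n + sum f (fst s) - snd s))))) = fps_const (P' ^ w)"
    unfolding w_def power_sum by (induction Y rule: infinite_finite_induct) (simp_all flip: fps_const_mult)
  finally have "(\<Prod>s\<in>Y. state_weight p s ^ m s) = fps_const (P' ^ w) * fps_X ^ (\<Sum>s\<in>Y. m s * (2 * sum f (fst s) + snd s))"
    unfolding power_sum .
  thus ?thesis using 1 unfolding Y_def m_def P'_def mu_def zz by simp
qed

lemma state_weight_0: "s \<noteq> ({}, 0) \<Longrightarrow> fst s \<subseteq> {1..g} \<Longrightarrow> fps_nth (state_weight p s) 0 = 0"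
proof -
  assume s: "s \<noteq> ({}, 0)" "fst s \<subseteq> {1..g}"
  have "2 * sum f (fst s) + snd s \<noteq> 0"
  proof
    assume *: "2 * sum f (fst s) + snd s = 0"
    hence "sum f (fst s) = 0" "snd s = 0" by auto
    moreover have "fst s = {}" using sum_f_inj[of "{}" "fst s"] s(2) \<open>sum f (fst s) = 0\<close> by simp
    ultimately show False using s(1) by (metis prod.collapse)
  qed
  thus ?thesis by (simp add: state_weight_def fps_X_power_mult_right_nth)
qed

text \<open>For a fixed chain the coefficient is constant and the multiplicities run independently
  over the positive integers, so each state contributes a geometric series. It converges because no
  state in a hook is \<open>({}, 0)\<close>, so every weight has zero constant term.\<close>

lemma has_fsum_pair_term:
  assumes p: "prime p"
  shows "has_fsum (pair_term p)
    (\<Sum>Y\<in>hook_chains. fps_const (chain_coeff (1 / of_nat p) (snd ` Y)) * (\<Prod>s\<in>Y. state_weight p s / (1 - state_weight p s)))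
    good_pairs"
proof -
  let ?F = "\<lambda>Y m. fps_const (chain_coeff (1 / of_nat p) (snd ` Y)) * (\<Prod>s\<in>Y. state_weight p s ^ m s)"
  let ?h = "\<lambda>z. (pair_levels z, restrict (pair_mult z) (pair_levels z))"
  have "has_fsum (?F Y) (fps_const (chain_coeff (1 / of_nat p) (snd ` Y)) * (\<Prod>s\<in>Y. state_weight p s / (1 - state_weight p s)))
      (Y \<rightarrow>\<^sub>E {1..})" if Y: "Y \<in> hook_chains" for Y
  proof (rule has_fsum_cmult, rule has_fsum_PiE[OF finite_hook_chain[OF Y]])
    fix s assume "s \<in> Y"
    then obtain i where i: "i \<in> {1..r}" "s \<in> hook i" using Y unfolding hook_chains_def by blast
    show "has_fsum (\<lambda>k. state_weight p s ^ k) (state_weight p s / (1 - state_weight p s)) {1..}"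
      by (rule has_fsum_geometric, rule state_weight_0) (use hook_bounds[OF i] in blast)+
  qed
  from has_fsum_Sigma[OF finite_hook_chains this]
  have S: "has_fsum (\<lambda>(Y, m). ?F Y m)
    (\<Sum>Y\<in>hook_chains. fps_const (chain_coeff (1 / of_nat p) (snd ` Y)) * (\<Prod>s\<in>Y. state_weight p s / (1 - state_weight p s)))
    (SIGMA Y:hook_chains. Y \<rightarrow>\<^sub>E {1..})" .
  define h' where "h' = inv_into good_pairs ?h"
  have bij: "bij_betw h' (SIGMA Y:hook_chains. Y \<rightarrow>\<^sub>E {1..}) good_pairs"
    unfolding h'_def by (rule bij_betw_inv_into[OF bij_betw_good_pairs])
  have eq: "pair_term p (h' y) = (\<lambda>(Y, m). ?F Y m) y" if y: "y \<in> (SIGMA Y:hook_chains. Y \<rightarrow>\<^sub>E {1..})" for y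
  proof -
    have g: "h' y \<in> good_pairs" using bij y by (auto simp: bij_betw_def)
    have "y \<in> ?h ` good_pairs" using y bij_betw_good_pairs unfolding bij_betw_def by blast
    hence hy: "?h (h' y) = y" unfolding h'_def by (rule f_inv_into_f)
    have "(\<lambda>(Y, m). ?F Y m) y = (\<lambda>(Y, m). ?F Y m) (?h (h' y))" using hy by simp
    also have "\<dots> = pair_term p (h' y)"
      unfolding pair_term_eq[OF p g] prod.case by (intro arg_cong2[where f = "(*)"] prod.cong refl) simp
    finally show ?thesis by (rule sym)
  qed
  show ?thesis
  proof (rule has_fsum_reindex[OF bij])
    show "has_fsum (\<lambda>a. pair_term p (h' a))
      (\<Sum>Y\<in>hook_chains. fps_const (chain_coeff (1 / of_nat p) (snd ` Y)) * (\<Prod>s\<in>Y. state_weight p s / (1 - state_weight p s)))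
      (SIGMA Y:hook_chains. Y \<rightarrow>\<^sub>E {1..})"
      using S eq unfolding has_fsum_def by (simp cong: conj_cong) 
  qed
qed

end

section \<open>Factorisation over the blocks\<close>

lemma sum_times_sum:
  fixes u :: "'a \<Rightarrow> 'c::comm_semiring_0"
  shows "(\<Sum>z\<in>A \<times> B. u (fst z) * v (snd z)) = sum u A * sum v B"
  by (simp add: sum_product sum.cartesian_product case_prod_unfold)

lemma Min_eq_coinitial:
  fixes T :: "'a::linorder set"
  assumes "finite T'" "T \<subseteq> T'" "T \<noteq> {}" "\<And>c. c \<in> T' \<Longrightarrow> \<exists>d\<in>T. d \<le> c"
  shows "Min T' = Min T"
proof (rule Min_eqI[OF assms(1)])
  have fT: "finite T" using assms finite_subset by blast
  show "Min T \<in> T'" using Min_in[OF fT assms(3)] assms(2) by blast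
  fix c assume "c \<in> T'"
  then obtain d where "d \<in> T" "d \<le> c" using assms(4) by blast
  thus "Min T \<le> c" using Min_le[OF fT, of d] by simp
qed

lemma Min_plus_image:
  fixes B :: "nat set"
  assumes "finite B" "B \<noteq> {}"
  shows "Min ((\<lambda>j. c + j) ` B) = c + Min B"
  using assms by (intro Min_eqI) auto

lemma next_in_shift:
  assumes "finite B" "\<exists>b\<in>B. k \<le> b"
  shows "next_in ((\<lambda>j. c + j) ` B) (c + k) = c + next_in B k"
proof -
  have "{b \<in> (\<lambda>j. c + j) ` B. c + k \<le> b} = (\<lambda>j. c + j) ` {b \<in> B. k \<le> b}" by auto
  moreover have "Min ((\<lambda>j. c + j) ` {b \<in> B. k \<le> b}) = c + Min {b \<in> B. k \<le> b}"
    by (rule Min_plus_image) (use assms in auto)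
  ultimately show ?thesis by (simp only: next_in_def)
qed

lemma is_chain_subset: "is_chain Y \<Longrightarrow> Z \<subseteq> Y \<Longrightarrow> is_chain Z"
  unfolding is_chain_def by blast

lemma union_of_parts_Int:
  assumes "Z1 \<subseteq> A" "Z2 \<subseteq> {u}" "Z3 \<subseteq> B" "Z4 \<subseteq> {v}"
    and "u \<notin> A" "A \<inter> B = {}" "v \<notin> A" "u \<notin> B" "v \<notin> B" "u \<noteq> v"
  shows "(Z1 \<union> Z2 \<union> Z3 \<union> Z4) \<inter> A = Z1" "(Z1 \<union> Z2 \<union> Z3 \<union> Z4) \<inter> {u} = Z2"
    "(Z1 \<union> Z2 \<union> Z3 \<union> Z4) \<inter> B = Z3" "(Z1 \<union> Z2 \<union> Z3 \<union> Z4) \<inter> {v} = Z4"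
  using assms by auto

lemma is_chain_subset_singleton: "Z \<subseteq> {x} \<Longrightarrow> is_chain Z"
  unfolding is_chain_def by (metis order_refl singletonD subsetD)

lemma is_chain_Un:
  assumes "is_chain Y" "is_chain Z" "\<And>s s'. s \<in> Y \<Longrightarrow> s' \<in> Z \<Longrightarrow> s \<le> s'"
  shows "is_chain (Y \<union> Z)"
  using assms unfolding is_chain_def by blast

context dyck_blocks
begin

definition piece :: "nat \<Rightarrow> (nat set \<times> nat) set set"
  where "piece i = {Z. Z \<subseteq> hook i \<and> is_chain Z \<and> (i < r \<longrightarrow> (P i, M i) \<in> Z)}"

text \<open>Here \<open>M i\<close> replaces the \<open>n\<close> of \<open>chain_coeff\<close>:
  within a chain \<open>M i\<close> is attained for \<open>i < r\<close> by the forced point and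
  equals \<open>n\<close> for \<open>i = r\<close>, so the factor depends on the piece
  alone.\<close>

definition piece_coeff :: "rat \<Rightarrow> nat \<Rightarrow> nat set \<Rightarrow> rat"
  where "piece_coeff y i B = (\<Prod>k=M (i - 1) + 1..M i.
    (1 - y ^ (L i + 1 - k)) / (1 - y ^ (next_in (insert (M i) B) k + 1 - k)))"

lemma M_step: "i \<in> {1..r} \<Longrightarrow> M (i - 1) < M i"
  using cM unfolding cuts_def by blast

lemma end_in_hook: "i \<in> {1..r} \<Longrightarrow> (P i, M i) \<in> hook i"
  using M_step[of i] Pmono[of "i - 1" i] by (simp add: hook_def)

lemma finite_hook: "finite (hook i)" if "i \<in> {1..r}"
proof (rule finite_subset)
  show "hook i \<subseteq> Pow {1..g} \<times> {..n}"
    using hook_bounds(5,6)[OF that] by (auto simp: subset_eq)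
qed simp

lemma finite_piece: "i \<in> {1..r} \<Longrightarrow> finite (piece i)"
  using finite_hook[of i] by (auto simp: piece_def intro: finite_subset[of _ "Pow (hook i)"])

lemma hook_le:
  assumes "i \<in> {1..r}" "j \<in> {1..r}" "i < j" "s \<in> hook i" "s' \<in> hook j"
  shows "s \<le> s'"
proof -
  have "P i \<subseteq> P (j - 1)" using assms by (intro Pmono) auto
  moreover have "M i \<le> M (j - 1)" using assms by (intro cuts_le[OF cM]) auto
  ultimately show ?thesis
    using hook_bounds(2,4)[OF assms(1,4)] hook_bounds(1,3)[OF assms(2,5)]
    by (auto simp: less_eq_prod_def)
qed

text \<open>A common state would have to be \<open>(P (j - 1), M (j - 1))\<close>, the excluded
  start of the later hook.\<close>

lemma hook_disjoint_less:
  assumes "i \<in> {1..r}" "j \<in> {1..r}" "i < j"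
  shows "hook i \<inter> hook j = {}"
proof (rule ccontr)
  assume "hook i \<inter> hook j \<noteq> {}"
  then obtain s where s: "s \<in> hook i" "s \<in> hook j" by blast
  have "P i \<subseteq> P (j - 1)" using assms by (intro Pmono) auto
  moreover have "M i \<le> M (j - 1)" using assms by (intro cuts_le[OF cM]) auto
  ultimately have "fst s = P (j - 1)" "snd s = M (j - 1)"
    using hook_bounds(2,4)[OF assms(1) s(1)] hook_bounds(1,3)[OF assms(2) s(2)] by auto
  thus False using s(2) by (auto simp: hook_def)
qed

lemma hook_disjoint: "i \<in> {1..r} \<Longrightarrow> j \<in> {1..r} \<Longrightarrow> i \<noteq> j \<Longrightarrow> hook i \<inter> hook j = {}"
  using hook_disjoint_less[of i j] hook_disjoint_less[of j i] by (cases i j rule: linorder_cases) auto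

text \<open>Since \<open>M i\<close> is available, the next element is at most \<open>M i\<close>.
  Smaller candidates come from hook \<open>i\<close> only: earlier hooks stay at or below
  \<open>M (i - 1) < k\<close>, later ones start at or above \<open>M i\<close>.\<close>

lemma next_in_hook_chain:
  assumes Y: "Y \<in> hook_chains" and i: "i \<in> {1..r}" and k: "M (i - 1) < k" "k \<le> M i"
  shows "next_in (insert n (snd ` Y)) k = next_in (insert (M i) (snd ` (Y \<inter> hook i))) k"
  unfolding next_in_def
proof (rule Min_eq_coinitial)
  show "finite {c \<in> insert n (snd ` Y). k \<le> c}" using finite_hook_chain[OF Y] by simp
  have "M i \<in> insert n (snd ` Y)"
  proof (cases "i = r")
    case True
    thus ?thesis using cM by (simp add: cuts_def)
  next
    case False
    hence "(P i, M i) \<in> Y" using Y i by (simp add: hook_chains_def)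
    from imageI[OF this, of snd] show ?thesis by simp
  qed
  thus "{c \<in> insert (M i) (snd ` (Y \<inter> hook i)). k \<le> c} \<subseteq> {c \<in> insert n (snd ` Y). k \<le> c}" by blast
  show "{c \<in> insert (M i) (snd ` (Y \<inter> hook i)). k \<le> c} \<noteq> {}" using k by blast
  fix c assume c: "c \<in> {c \<in> insert n (snd ` Y). k \<le> c}"
  have Mi: "M i \<in> {c \<in> insert (M i) (snd ` (Y \<inter> hook i)). k \<le> c}" using k by simp
  show "\<exists>d\<in>{c \<in> insert (M i) (snd ` (Y \<inter> hook i)). k \<le> c}. d \<le> c"
  proof (cases "M i \<le> c")
    case True
    thus ?thesis using Mi by blast
  next
    case False
    have "c \<noteq> n" using False cuts_le_n[OF cM, of i] i by auto
    then obtain s where s: "s \<in> Y" "c = snd s" using c by blast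
    then obtain j where j: "j \<in> {1..r}" "s \<in> hook j" using Y unfolding hook_chains_def by blast
    have "\<not> j < i"
    proof
      assume "j < i"
      hence "M j \<le> M (i - 1)" using i by (intro cuts_le[OF cM]) auto
      thus False using hook_bounds(4)[OF j] s c k by simp
    qed
    moreover have "\<not> i < j"
    proof
      assume "i < j"
      hence "M i \<le> M (j - 1)" using j by (intro cuts_le[OF cM]) auto
      thus False using hook_bounds(3)[OF j] s False by simp
    qed
    ultimately have "s \<in> Y \<inter> hook i" using j s by simp
    hence "c \<in> {c \<in> insert (M i) (snd ` (Y \<inter> hook i)). k \<le> c}" using s c by blast
    thus ?thesis by blast
  qed
qed

lemma chain_coeff_eq_prod:
  assumes "Y \<in> hook_chains"
  shows "chain_coeff y (snd ` Y) = (\<Prod>i=1..r. piece_coeff y i (snd ` (Y \<inter> hook i)))"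
  unfolding chain_coeff_def piece_coeff_def
proof (intro prod.cong refl)
  fix i k assume i: "i \<in> {1..r}" and k: "k \<in> {M (i - 1) + 1..M i}"
  have "next_in (insert n (snd ` Y)) k = next_in (insert (M i) (snd ` (Y \<inter> hook i))) k"
    by (rule next_in_hook_chain[OF assms i]) (use k in auto)
  thus "(1 - y ^ (L i + 1 - k)) / (1 - y ^ (next_in (insert n (snd ` Y)) k + 1 - k)) =
    (1 - y ^ (L i + 1 - k)) / (1 - y ^ (next_in (insert (M i) (snd ` (Y \<inter> hook i))) k + 1 - k))" by simp
qed

text \<open>All states of a hook lie below all states of a later one, so the pieces can be chosen
  independently and their union is still a chain; disjointness of the hooks recovers the
  pieces.\<close>

lemma bij_betw_pieces:
  "bij_betw (\<lambda>Y. \<lambda>i\<in>{1..r}. Y \<inter> hook i) hook_chains (PiE {1..r} piece)"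
proof (rule bij_betwI[where g = "\<lambda>Z. \<Union>i\<in>{1..r}. Z i"])
  show "(\<lambda>Y. \<lambda>i\<in>{1..r}. Y \<inter> hook i) \<in> hook_chains \<rightarrow> PiE {1..r} piece"
  proof
    fix Y assume Y: "Y \<in> hook_chains"
    have "Y \<inter> hook i \<in> piece i" if i: "i \<in> {1..r}" for i
    proof -
      have "is_chain (Y \<inter> hook i)" using Y is_chain_subset[of Y "Y \<inter> hook i"] by (simp add: hook_chains_def)
      moreover have "(P i, M i) \<in> Y" if "i < r" using Y i that by (simp add: hook_chains_def)
      ultimately show ?thesis using end_in_hook[OF i] by (simp add: piece_def)
    qed
    thus "(\<lambda>i\<in>{1..r}. Y \<inter> hook i) \<in> PiE {1..r} piece" by simp
  qed
  show "(\<lambda>Z. \<Union>i\<in>{1..r}. Z i) \<in> PiE {1..r} piece \<rightarrow> hook_chains"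
  proof
    fix Z assume Z: "Z \<in> PiE {1..r} piece"
    have Zi: "Z i \<subseteq> hook i" "is_chain (Z i)" "i < r \<longrightarrow> (P i, M i) \<in> Z i" if "i \<in> {1..r}" for i
      using PiE_mem[OF Z that] by (auto simp: piece_def)
    have "is_chain (\<Union>i\<in>{1..r}. Z i)"
      unfolding is_chain_def
    proof (intro ballI)
      fix s s' assume "s \<in> (\<Union>i\<in>{1..r}. Z i)" "s' \<in> (\<Union>i\<in>{1..r}. Z i)"
      then obtain i j where ij: "i \<in> {1..r}" "s \<in> Z i" "j \<in> {1..r}" "s' \<in> Z j" by blast
      have h: "s \<in> hook i" "s' \<in> hook j" using Zi(1) ij by blast+
      consider "i = j" | "i < j" | "j < i" by linarith
      thus "s \<le> s' \<or> s' \<le> s"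
      proof cases
        case 1
        thus ?thesis using Zi(2)[OF ij(1)] ij unfolding is_chain_def by blast
      next
        case 2
        thus ?thesis using hook_le[OF ij(1,3) 2 h] by simp
      next
        case 3
        thus ?thesis using hook_le[OF ij(3,1) 3 h(2,1)] by simp
      qed
    qed
    moreover have "(P i, M i) \<in> (\<Union>i\<in>{1..r}. Z i)" if "i \<in> {1..<r}" for i
    proof -
      have "i \<in> {1..r}" "i < r" using that by auto
      thus ?thesis using Zi(3) by blast
    qed
    moreover have "(\<Union>i\<in>{1..r}. Z i) \<subseteq> (\<Union>i\<in>{1..r}. hook i)" using Zi(1) by blast
    ultimately show "(\<Union>i\<in>{1..r}. Z i) \<in> hook_chains" unfolding hook_chains_def by blast
  qed
  show "(\<Union>i\<in>{1..r}. (\<lambda>i\<in>{1..r}. Y \<inter> hook i) i) = Y" if "Y \<in> hook_chains" for Y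
    using that unfolding hook_chains_def by auto
  show "(\<lambda>i\<in>{1..r}. (\<Union>j\<in>{1..r}. Z j) \<inter> hook i) = Z" if Z: "Z \<in> PiE {1..r} piece" for Z
  proof
    fix i
    show "(\<lambda>i\<in>{1..r}. (\<Union>j\<in>{1..r}. Z j) \<inter> hook i) i = Z i"
    proof (cases "i \<in> {1..r}")
      case True
      have Zi: "Z j \<subseteq> hook j" if "j \<in> {1..r}" for j using PiE_mem[OF Z that] by (simp add: piece_def)
      have "(\<Union>j\<in>{1..r}. Z j) \<inter> hook i = Z i"
        using Zi hook_disjoint[OF True] True by blast
      thus ?thesis using True by simp
    next
      case False
      thus ?thesis using PiE_arb[OF Z False] by auto
    qed
  qed
qed

lemma sum_hook_chains_eq_prod:
  fixes V :: "nat set \<times> nat \<Rightarrow> rat fps"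
  shows "(\<Sum>Y\<in>hook_chains. fps_const (chain_coeff y (snd ` Y)) * (\<Prod>s\<in>Y. V s)) =
    (\<Prod>i=1..r. \<Sum>Z\<in>piece i. fps_const (piece_coeff y i (snd ` Z)) * (\<Prod>s\<in>Z. V s))"
proof -
  have const_prod: "fps_const (prod h A) = (\<Prod>i\<in>A. fps_const (h i))" for h :: "nat \<Rightarrow> rat" and A
    by (induction A rule: infinite_finite_induct) (simp_all flip: fps_const_mult)
  have "(\<Prod>i=1..r. \<Sum>Z\<in>piece i. fps_const (piece_coeff y i (snd ` Z)) * (\<Prod>s\<in>Z. V s)) =
    (\<Sum>Z\<in>PiE {1..r} piece. \<Prod>i=1..r. fps_const (piece_coeff y i (snd ` Z i)) * (\<Prod>s\<in>Z i. V s))"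
    by (rule prod_sum_PiE) (use finite_piece in auto)
  also have "\<dots> = (\<Sum>Y\<in>hook_chains. \<Prod>i=1..r. fps_const (piece_coeff y i (snd ` (\<lambda>i\<in>{1..r}. Y \<inter> hook i) i)) *
      (\<Prod>s\<in>(\<lambda>i\<in>{1..r}. Y \<inter> hook i) i. V s))"
    by (rule sum.reindex_bij_betw[OF bij_betw_pieces, symmetric])
  also have "\<dots> = (\<Sum>Y\<in>hook_chains. fps_const (chain_coeff y (snd ` Y)) * (\<Prod>s\<in>Y. V s))"
  proof (rule sum.cong[OF refl])
    fix Y assume Y: "Y \<in> hook_chains"
    have "(\<Prod>i=1..r. fps_const (piece_coeff y i (snd ` (\<lambda>i\<in>{1..r}. Y \<inter> hook i) i)) * (\<Prod>s\<in>(\<lambda>i\<in>{1..r}. Y \<inter> hook i) i. V s)) =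
      (\<Prod>i=1..r. fps_const (piece_coeff y i (snd ` (Y \<inter> hook i))) * (\<Prod>s\<in>Y \<inter> hook i. V s))"
      by (intro prod.cong refl) simp
    also have "\<dots> = fps_const (chain_coeff y (snd ` Y)) * (\<Prod>i=1..r. \<Prod>s\<in>Y \<inter> hook i. V s)"
      unfolding chain_coeff_eq_prod[OF Y] const_prod prod.distrib ..
    also have "(\<Prod>i=1..r. \<Prod>s\<in>Y \<inter> hook i. V s) = prod V (\<Union>i\<in>{1..r}. Y \<inter> hook i)"
    proof (rule prod.UNION_disjoint[symmetric])
      show "\<forall>i\<in>{1..r}. finite (Y \<inter> hook i)" using finite_hook_chain[OF Y] by simp
      show "\<forall>i\<in>{1..r}. \<forall>j\<in>{1..r}. i \<noteq> j \<longrightarrow> (Y \<inter> hook i) \<inter> (Y \<inter> hook j) = {}"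
        using hook_disjoint by blast
    qed simp
    also have "(\<Union>i\<in>{1..r}. Y \<inter> hook i) = Y" using Y unfolding hook_chains_def by blast
    finally show "(\<Prod>i=1..r. fps_const (piece_coeff y i (snd ` (\<lambda>i\<in>{1..r}. Y \<inter> hook i) i)) *
      (\<Prod>s\<in>(\<lambda>i\<in>{1..r}. Y \<inter> hook i) i. V s)) = fps_const (chain_coeff y (snd ` Y)) * (\<Prod>s\<in>Y. V s)" .
  qed
  finally show ?thesis by (rule sym)
qed

subsection \<open>A single hook\<close>

definition verticals :: "nat \<Rightarrow> (nat set \<times> nat) set"
  where "verticals i = (\<lambda>S. (S, M (i - 1))) ` {S. P (i - 1) \<subset> S \<and> S \<subset> P i}"

definition horizontals :: "nat \<Rightarrow> (nat set \<times> nat) set"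
  where "horizontals i = (\<lambda>b. (P i, b)) ` {M (i - 1)<..<M i}"

abbreviation corner :: "nat \<Rightarrow> nat set \<times> nat"
  where "corner i \<equiv> (P i, M (i - 1))"

lemma hook_decomposition:
  assumes "i \<in> {1..r}"
  shows "hook i = verticals i \<union> {corner i} \<union> horizontals i \<union> {(P i, M i)}"
  using Pstep[OF assms] M_step[OF assms]
  by (auto simp: hook_def verticals_def horizontals_def image_iff)

lemma hook_parts_disjoint:
  assumes "i \<in> {1..r}"
  shows "corner i \<notin> verticals i" "verticals i \<inter> horizontals i = {}" "(P i, M i) \<notin> verticals i"
    "corner i \<notin> horizontals i" "(P i, M i) \<notin> horizontals i" "corner i \<noteq> (P i, M i)"
  using M_step[OF assms] by (auto simp: verticals_def horizontals_def)

text \<open>The end is forced for \<open>i < r\<close> and optional for \<open>i = r\<close>. This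
  is the origin of \<open>igusa_circ\<close> against \<open>igusa\<close>.\<close>

definition hook_ends :: "nat \<Rightarrow> (nat set \<times> nat) set set"
  where "hook_ends i = (if i < r then {{(P i, M i)}} else Pow {(P i, M i)})"

text \<open>The four parts of a hook follow one another in the order of states, so no condition
  links them. Only the vertical part carries a chain condition; the horizontal part is totally
  ordered, whence arbitrary subsets.\<close>

lemma bij_betw_piece:
  assumes i: "i \<in> {1..r}"
  shows "bij_betw (\<lambda>z. fst z \<union> fst (snd z) \<union> fst (snd (snd z)) \<union> snd (snd (snd z)))
    ({Z. Z \<subseteq> verticals i \<and> is_chain Z} \<times> Pow {corner i} \<times> Pow (horizontals i) \<times> hook_ends i) (piece i)"
proof (rule bij_betwI[where g = "\<lambda>Z. (Z \<inter> verticals i, Z \<inter> {corner i}, Z \<inter> horizontals i, Z \<inter> {(P i, M i)})"])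
  note dj = hook_parts_disjoint[OF i]
  note dec = hook_decomposition[OF i]
  have ends: "Z4 \<subseteq> {(P i, M i)}" if "Z4 \<in> hook_ends i" for Z4
    using that by (auto simp: hook_ends_def split: if_splits)
  show "(\<lambda>z. fst z \<union> fst (snd z) \<union> fst (snd (snd z)) \<union> snd (snd (snd z))) \<in>
    {Z. Z \<subseteq> verticals i \<and> is_chain Z} \<times> Pow {corner i} \<times> Pow (horizontals i) \<times> hook_ends i \<rightarrow> piece i"
  proof
    fix z assume z: "z \<in> {Z. Z \<subseteq> verticals i \<and> is_chain Z} \<times> Pow {corner i} \<times> Pow (horizontals i) \<times> hook_ends i"
    obtain Z1 Z2 Z3 Z4 where zz: "z = (Z1, Z2, Z3, Z4)" by (metis surj_pair)
    have Z: "Z1 \<subseteq> verticals i" "is_chain Z1" "Z2 \<subseteq> {corner i}" "Z3 \<subseteq> horizontals i" "Z4 \<in> hook_ends i"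
      using z by (auto simp: zz)
    have Z4: "Z4 \<subseteq> {(P i, M i)}" using ends[OF Z(5)] .
    have lt: "M (i - 1) < M i" using M_step[OF i] .
    have v: "fst s \<subseteq> P i" "snd s = M (i - 1)" if "s \<in> Z1" for s
    proof -
      have "s \<in> verticals i" using Z(1) that by (rule subsetD)
      thus "fst s \<subseteq> P i" "snd s = M (i - 1)" by (auto simp: verticals_def)
    qed
    have c: "s = corner i" if "s \<in> Z2" for s using that Z(3) by blast
    have hz: "fst s = P i" "M (i - 1) < snd s" "snd s < M i" if "s \<in> Z3" for s
    proof -
      have "s \<in> horizontals i" using Z(4) that by (rule subsetD)
      thus "fst s = P i" "M (i - 1) < snd s" "snd s < M i" by (auto simp: horizontals_def)
    qed
    have e: "s = (P i, M i)" if "s \<in> Z4" for s using that Z4 by blast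
    have "is_chain (Z1 \<union> Z2)"
    proof (rule is_chain_Un[OF Z(2) is_chain_subset_singleton[OF Z(3)]])
      fix s s' assume "s \<in> Z1" "s' \<in> Z2"
      thus "s \<le> s'" using v[of s] c[of s'] by (simp add: less_eq_prod_def)
    qed
    moreover have "is_chain Z3"
      unfolding is_chain_def
    proof (intro ballI)
      fix s s' assume "s \<in> Z3" "s' \<in> Z3"
      thus "s \<le> s' \<or> s' \<le> s" using hz(1)[of s] hz(1)[of s'] by (simp add: less_eq_prod_def nat_le_linear)
    qed
    moreover have "s \<le> s'" if s: "s \<in> Z1 \<union> Z2" and s': "s' \<in> Z3" for s s'
    proof -
      have "fst s \<subseteq> P i" "snd s = M (i - 1)" using s v[of s] c[of s] by auto
      thus ?thesis using hz(1,2)[OF s'] by (simp add: less_eq_prod_def)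
    qed
    ultimately have "is_chain (Z1 \<union> Z2 \<union> Z3)" by (rule is_chain_Un)
    moreover have "is_chain Z4" by (rule is_chain_subset_singleton[OF Z4])
    moreover have "s \<le> s'" if s: "s \<in> Z1 \<union> Z2 \<union> Z3" and s': "s' \<in> Z4" for s s'
    proof -
      have "fst s \<subseteq> P i" "snd s \<le> M i" using s v[of s] c[of s] hz[of s] lt by auto
      thus ?thesis using e[OF s'] by (simp add: less_eq_prod_def)
    qed
    ultimately have "is_chain (Z1 \<union> Z2 \<union> Z3 \<union> Z4)" by (rule is_chain_Un)
    moreover have "Z1 \<union> Z2 \<union> Z3 \<union> Z4 \<subseteq> hook i" using Z Z4 unfolding dec by blast
    moreover have "(P i, M i) \<in> Z4" if "i < r" using Z(5) that by (simp add: hook_ends_def)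
    ultimately show "fst z \<union> fst (snd z) \<union> fst (snd (snd z)) \<union> snd (snd (snd z)) \<in> piece i"
      unfolding zz piece_def by simp
  qed
  show "(\<lambda>Z. (Z \<inter> verticals i, Z \<inter> {corner i}, Z \<inter> horizontals i, Z \<inter> {(P i, M i)})) \<in>
    piece i \<rightarrow> {Z. Z \<subseteq> verticals i \<and> is_chain Z} \<times> Pow {corner i} \<times> Pow (horizontals i) \<times> hook_ends i"
  proof
    fix Z assume Z: "Z \<in> piece i"
    have "is_chain (Z \<inter> verticals i)" using Z is_chain_subset[of Z "Z \<inter> verticals i"] by (simp add: piece_def)
    moreover have "Z \<inter> {(P i, M i)} \<in> hook_ends i" using Z by (auto simp: piece_def hook_ends_def)
    ultimately show "(Z \<inter> verticals i, Z \<inter> {corner i}, Z \<inter> horizontals i, Z \<inter> {(P i, M i)}) \<in>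
      {Z. Z \<subseteq> verticals i \<and> is_chain Z} \<times> Pow {corner i} \<times> Pow (horizontals i) \<times> hook_ends i" by blast
  qed
  show "(\<lambda>Z. (Z \<inter> verticals i, Z \<inter> {corner i}, Z \<inter> horizontals i, Z \<inter> {(P i, M i)}))
      (fst z \<union> fst (snd z) \<union> fst (snd (snd z)) \<union> snd (snd (snd z))) = z"
    if z: "z \<in> {Z. Z \<subseteq> verticals i \<and> is_chain Z} \<times> Pow {corner i} \<times> Pow (horizontals i) \<times> hook_ends i" for z
  proof -
    obtain Z1 Z2 Z3 Z4 where zz: "z = (Z1, Z2, Z3, Z4)" by (metis surj_pair)
    have Z: "Z1 \<subseteq> verticals i" "Z2 \<subseteq> {corner i}" "Z3 \<subseteq> horizontals i" "Z4 \<subseteq> {(P i, M i)}"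
      using z ends by (auto simp: zz)
    show ?thesis unfolding zz fst_conv snd_conv union_of_parts_Int[OF Z dj] ..
  qed
  show "(\<lambda>z. fst z \<union> fst (snd z) \<union> fst (snd (snd z)) \<union> snd (snd (snd z)))
      (Z \<inter> verticals i, Z \<inter> {corner i}, Z \<inter> horizontals i, Z \<inter> {(P i, M i)}) = Z" if "Z \<in> piece i" for Z
    using that unfolding piece_def dec by auto
qed

text \<open>The vertical states and the corner have second component \<open>M (i - 1) < k\<close>,
  and the end contributes \<open>M i\<close>, which is inserted anyway.\<close>

lemma piece_coeff_horizontals:
  assumes i: "i \<in> {1..r}" and Z: "Z1 \<subseteq> verticals i" "Z2 \<subseteq> {corner i}" "Z4 \<subseteq> {(P i, M i)}"
  shows "piece_coeff y i (snd ` (Z1 \<union> Z2 \<union> Z3 \<union> Z4)) = piece_coeff y i (snd ` Z3)"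
  unfolding piece_coeff_def
proof (intro prod.cong refl)
  fix k assume k: "k \<in> {M (i - 1) + 1..M i}"
  have "{c \<in> insert (M i) (snd ` (Z1 \<union> Z2 \<union> Z3 \<union> Z4)). k \<le> c} = {c \<in> insert (M i) (snd ` Z3). k \<le> c}"
    using Z k by (auto simp: verticals_def)
  thus "(1 - y ^ (L i + 1 - k)) / (1 - y ^ (next_in (insert (M i) (snd ` (Z1 \<union> Z2 \<union> Z3 \<union> Z4))) k + 1 - k)) =
    (1 - y ^ (L i + 1 - k)) / (1 - y ^ (next_in (insert (M i) (snd ` Z3)) k + 1 - k))"
    unfolding next_in_def by simp
qed

lemma sum_piece:
  fixes V :: "nat set \<times> nat \<Rightarrow> rat fps"
  assumes i: "i \<in> {1..r}"
  shows "(\<Sum>Z\<in>piece i. fps_const (piece_coeff y i (snd ` Z)) * prod V Z) =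
    (\<Sum>Z\<in>{Z. Z \<subseteq> verticals i \<and> is_chain Z}. prod V Z) * (1 + V (corner i)) *
    (\<Sum>Z\<in>Pow (horizontals i). fps_const (piece_coeff y i (snd ` Z)) * prod V Z) *
    (if i < r then V (P i, M i) else 1 + V (P i, M i))"
proof -
  note dj = hook_parts_disjoint[OF i]
  define C where "C = {Z. Z \<subseteq> verticals i \<and> is_chain Z}"
  define u where "u Z = fps_const (piece_coeff y i (snd ` Z)) * prod V Z" for Z
  let ?h = "\<lambda>z. fst z \<union> fst (snd z) \<union> fst (snd (snd z)) \<union> snd (snd (snd z))"
  have "sum u (piece i) = (\<Sum>z\<in>C \<times> Pow {corner i} \<times> Pow (horizontals i) \<times> hook_ends i. u (?h z))"
    unfolding C_def by (rule sum.reindex_bij_betw[OF bij_betw_piece[OF i], symmetric])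
  also have "\<dots> = (\<Sum>z\<in>C \<times> Pow {corner i} \<times> Pow (horizontals i) \<times> hook_ends i.
      prod V (fst z) * (prod V (fst (snd z)) * (u (fst (snd (snd z))) * prod V (snd (snd (snd z))))))"
  proof (rule sum.cong[OF refl])
    fix z assume z: "z \<in> C \<times> Pow {corner i} \<times> Pow (horizontals i) \<times> hook_ends i"
    obtain Z1 Z2 Z3 Z4 where zz: "z = (Z1, Z2, Z3, Z4)" by (metis surj_pair)
    have Z: "Z1 \<subseteq> verticals i" "Z2 \<subseteq> {corner i}" "Z3 \<subseteq> horizontals i" "Z4 \<subseteq> {(P i, M i)}"
      using z by (auto simp: zz C_def hook_ends_def split: if_splits)
    have fin: "finite (Z1 \<union> Z2 \<union> Z3 \<union> Z4)"
      by (rule finite_subset[OF _ finite_hook[OF i]]) (use Z hook_decomposition[OF i] in blast)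
    have "prod V (Z1 \<union> Z2 \<union> Z3 \<union> Z4) = prod V (Z1 \<union> Z2 \<union> Z3) * prod V Z4"
      by (rule prod.union_disjoint) (use fin Z dj in auto)
    also have "prod V (Z1 \<union> Z2 \<union> Z3) = prod V (Z1 \<union> Z2) * prod V Z3"
      by (rule prod.union_disjoint) (use fin Z dj in auto)
    also have "prod V (Z1 \<union> Z2) = prod V Z1 * prod V Z2"
      by (rule prod.union_disjoint) (use fin Z dj in auto)
    finally have "prod V (Z1 \<union> Z2 \<union> Z3 \<union> Z4) = prod V Z1 * prod V Z2 * prod V Z3 * prod V Z4" .
    thus "u (?h z) = prod V (fst z) * (prod V (fst (snd z)) * (u (fst (snd (snd z))) * prod V (snd (snd (snd z)))))"
      unfolding u_def zz fst_conv snd_conv piece_coeff_horizontals[OF i Z(1,2,4)]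
      by (simp only: mult.assoc mult.commute mult.left_commute)
  qed
  also have "\<dots> = sum (prod V) C * (sum (prod V) (Pow {corner i}) * (sum u (Pow (horizontals i)) * sum (prod V) (hook_ends i)))"
    by (simp only: sum_times_sum[symmetric])
  also have "sum (prod V) (Pow {corner i}) = 1 + V (corner i)" by (simp add: Pow_insert)
  also have "sum (prod V) (hook_ends i) = (if i < r then V (P i, M i) else 1 + V (P i, M i))"
    by (simp add: hook_ends_def Pow_insert)
  finally show ?thesis unfolding u_def C_def by (simp only: mult.assoc)
qed

text \<open>The enumeration \<open>a\<close> identifies sets strictly between
  \<open>P (i - 1)\<close> and \<open>P i\<close> with nonempty proper subsets of
  \<open>{1..d}\<close>. This preserves and reflects inclusion, so chains of states become the
  chains of \<open>igusa_wo\<close>.\<close>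

lemma sum_vertical_chains:
  fixes V :: "nat set \<times> nat \<Rightarrow> rat fps"
  assumes i: "i \<in> {1..r}" and a: "inj_on a {1..d}" "a ` {1..d} = P i - P (i - 1)"
  shows "(\<Sum>Z\<in>{Z. Z \<subseteq> verticals i \<and> is_chain Z}. prod V Z) =
    (\<Sum>y\<in>chains {I. I \<noteq> {} \<and> I \<subset> {1..d}}. \<Prod>I\<in>y. V (P (i - 1) \<union> a ` I, M (i - 1)))"
proof -
  define D where "D = {I. I \<noteq> {} \<and> I \<subset> {1..d}}"
  define \<phi> where "\<phi> I = (P (i - 1) \<union> a ` I, M (i - 1))" for I
  have D: "I \<subseteq> {1..d}" if "I \<in> D" for I using that by (auto simp: D_def)
  have disj: "a ` I \<inter> P (i - 1) = {}" if "I \<subseteq> {1..d}" for I using a(2) that by blast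
  have \<phi>_le: "\<phi> I \<le> \<phi> J \<longleftrightarrow> I \<subseteq> J" if "I \<subseteq> {1..d}" "J \<subseteq> {1..d}" for I J
  proof -
    have "a ` I \<subseteq> P (i - 1) \<union> a ` J \<longleftrightarrow> a ` I \<subseteq> a ` J" using disj[OF that(1)] by blast
    also have "\<dots> \<longleftrightarrow> I \<subseteq> J"
    proof
      assume sub: "a ` I \<subseteq> a ` J"
      show "I \<subseteq> J"
      proof
        fix x assume x: "x \<in> I"
        hence "a x \<in> a ` J" "x \<in> {1..d}" using sub that(1) by blast+
        thus "x \<in> J" using inj_on_image_mem_iff[OF a(1) _ that(2)] by blast
      qed
    qed blast
    finally show ?thesis by (simp add: \<phi>_def less_eq_prod_def)
  qed
  have inj: "inj_on \<phi> D"
  proof (rule inj_onI)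
    fix I J assume "I \<in> D" "J \<in> D" "\<phi> I = \<phi> J"
    thus "I = J" using \<phi>_le[of I J] \<phi>_le[of J I] D by auto
  qed
  have im: "\<phi> ` D = verticals i"
  proof (intro equalityI subsetI)
    fix s assume "s \<in> \<phi> ` D"
    then obtain I where I: "I \<in> D" "s = \<phi> I" by blast
    have sub: "I \<subseteq> {1..d}" "I \<noteq> {}" "I \<noteq> {1..d}" using I by (auto simp: D_def)
    have "a ` I \<noteq> a ` {1..d}" using inj_on_image_eq_iff[OF a(1) sub(1)] sub(3) by blast
    moreover have "a ` I \<subseteq> P i - P (i - 1)" using sub(1) a(2) by blast
    moreover have "a ` I \<noteq> {}" using sub by simp
    ultimately have "P (i - 1) \<subset> P (i - 1) \<union> a ` I" "P (i - 1) \<union> a ` I \<subset> P i"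
      using a(2) Pstep[OF i] by blast+
    thus "s \<in> verticals i" unfolding I(2) \<phi>_def verticals_def by blast
  next
    fix s assume "s \<in> verticals i"
    then obtain S where S: "P (i - 1) \<subset> S" "S \<subset> P i" "s = (S, M (i - 1))" by (auto simp: verticals_def)
    define I where "I = {j \<in> {1..d}. a j \<in> S}"
    have aI: "a ` I = S - P (i - 1)"
    proof (intro equalityI subsetI)
      fix q assume "q \<in> S - P (i - 1)"
      hence q: "q \<in> S" "q \<in> a ` {1..d}" using S(2) a(2) by blast+
      then obtain j where "j \<in> {1..d}" "q = a j" by blast
      thus "q \<in> a ` I" using q(1) by (auto simp: I_def)
    qed (use a(2) in \<open>auto simp: I_def\<close>)
    have "I \<noteq> {}" using aI S(1) by blast
    moreover have "I \<noteq> {1..d}"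
    proof
      assume "I = {1..d}"
      hence "S - P (i - 1) = P i - P (i - 1)" using aI a(2) by simp
      thus False using S by blast
    qed
    ultimately have "I \<in> D" by (auto simp: D_def I_def)
    moreover have "s = \<phi> I" unfolding \<phi>_def aI using S by auto
    ultimately show "s \<in> \<phi> ` D" by blast
  qed
  have bij: "bij_betw (image \<phi>) (chains D) {Z. Z \<subseteq> verticals i \<and> is_chain Z}"
    unfolding bij_betw_def
  proof
    show "inj_on (image \<phi>) (chains D)"
    proof (rule inj_onI)
      fix A B assume "A \<in> chains D" "B \<in> chains D" "\<phi> ` A = \<phi> ` B"
      thus "A = B" using inj_on_image_eq_iff[OF inj, of A B] by (simp add: chains_def)
    qed
    have chain_iff: "is_chain (\<phi> ` y) \<longleftrightarrow> y \<in> chains D" if "y \<subseteq> D" for y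
    proof -
      have "is_chain (\<phi> ` y) \<longleftrightarrow> (\<forall>I\<in>y. \<forall>J\<in>y. \<phi> I \<le> \<phi> J \<or> \<phi> J \<le> \<phi> I)"
        by (simp add: is_chain_def)
      also have "\<dots> \<longleftrightarrow> (\<forall>I\<in>y. \<forall>J\<in>y. I \<subseteq> J \<or> J \<subseteq> I)"
        using that D \<phi>_le by (intro ball_cong refl) (meson subsetD)
      finally show ?thesis using that by (simp add: chains_def chain_subset_def)
    qed
    show "image \<phi> ` chains D = {Z. Z \<subseteq> verticals i \<and> is_chain Z}"
    proof (intro equalityI subsetI)
      fix Z assume "Z \<in> image \<phi> ` chains D"
      then obtain y where y: "y \<in> chains D" "Z = \<phi> ` y" by blast
      have "y \<subseteq> D" using y(1) by (simp add: chains_def)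
      thus "Z \<in> {Z. Z \<subseteq> verticals i \<and> is_chain Z}" using y chain_iff im by blast
    next
      fix Z assume Z: "Z \<in> {Z. Z \<subseteq> verticals i \<and> is_chain Z}"
      then obtain y where y: "y \<subseteq> D" "Z = \<phi> ` y" unfolding im[symmetric] by (auto simp: subset_image_iff)
      thus "Z \<in> image \<phi> ` chains D" using Z chain_iff[OF y(1)] by blast
    qed
  qed
  have "(\<Sum>Z\<in>{Z. Z \<subseteq> verticals i \<and> is_chain Z}. prod V Z) = (\<Sum>y\<in>chains D. prod V (\<phi> ` y))"
    by (rule sum.reindex_bij_betw[OF bij, symmetric])
  also have "\<dots> = (\<Sum>y\<in>chains D. \<Prod>I\<in>y. V (\<phi> I))"
  proof (intro sum.cong refl)
    fix y assume "y \<in> chains D"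
    hence "inj_on \<phi> y" using inj_on_subset[OF inj] by (simp add: chains_def)
    from prod.reindex[OF this, of V] show "prod V (\<phi> ` y) = (\<Prod>I\<in>y. V (\<phi> I))" by simp
  qed
  finally show ?thesis unfolding D_def \<phi>_def .
qed

text \<open>Shift positions by \<open>M (i - 1)\<close> and put \<open>N = L i - M (i - 1)\<close>,
  \<open>h = M i - M (i - 1)\<close>. The numerators multiply to
  \<open>qfact N y / qfact (N - h) y\<close>, independently of the subset. Multiplying and dividing
  by \<open>qfact h y\<close> splits the coefficient into a binomial and, by
  \<open>gauss_multinomial_next\<close>, the multinomial of the subset.\<close>

lemma sum_horizontals:
  fixes V :: "nat set \<times> nat \<Rightarrow> rat fps"
  assumes i: "i \<in> {1..r}" and y: "\<And>k. k \<ge> 1 \<Longrightarrow> y ^ k \<noteq> 1"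
  shows "(\<Sum>Z\<in>Pow (horizontals i). fps_const (piece_coeff y i (snd ` Z)) * prod V Z) =
    fps_const (gauss_binomial (L i - M (i - 1)) (L i - M i) y) *
    (\<Sum>I\<in>Pow {1..M i - M (i - 1) - 1}. fps_const (gauss_multinomial (M i - M (i - 1)) I y) * (\<Prod>j\<in>I. V (P i, M (i - 1) + j)))"
proof -
  define c where "c = M (i - 1)"
  define h where "h = M i - c"
  define N where "N = L i - c"
  have lt: "c < M i" "M i \<le> L i" using M_step[OF i] M_le_L[of i] i by (auto simp: c_def)
  have Mi: "M i = c + h" and Li: "L i = c + N" and hN: "h \<le> N" and h1: "1 \<le> h"
    using lt by (auto simp: h_def N_def)
  define \<psi> where "\<psi> j = (P i, c + j)" for j
  have inj: "inj \<psi>" by (auto simp: \<psi>_def inj_on_def)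
  have im: "\<psi> ` {1..h - 1} = horizontals i"
  proof -
    have "{M (i - 1)<..<M i} = (\<lambda>j. c + j) ` {1..h - 1}"
    proof (intro equalityI subsetI)
      fix b assume "b \<in> {M (i - 1)<..<M i}"
      hence "c < b" "b < c + h" unfolding c_def[symmetric] Mi by simp_all
      hence "b = c + (b - c)" "b - c \<in> {1..h - 1}" by auto
      thus "b \<in> (\<lambda>j. c + j) ` {1..h - 1}" by (rule image_eqI)
    next
      fix b assume "b \<in> (\<lambda>j. c + j) ` {1..h - 1}"
      hence "c < b" "b < c + h" by auto
      thus "b \<in> {M (i - 1)<..<M i}" unfolding c_def[symmetric] Mi by simp
    qed
    thus ?thesis unfolding horizontals_def \<psi>_def by (simp only: image_image)
  qed
  have coeff: "piece_coeff y i ((\<lambda>j. c + j) ` I) = gauss_binomial N (N - h) y * gauss_multinomial h I y"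
    if I: "I \<subseteq> {1..h - 1}" for I
  proof -
    have finI: "finite I" using I finite_subset by blast
    have "piece_coeff y i ((\<lambda>j. c + j) ` I) =
      (\<Prod>k=c + 1..c + h. (1 - y ^ (c + N + 1 - k)) / (1 - y ^ (next_in (insert (c + h) ((\<lambda>j. c + j) ` I)) k + 1 - k)))"
      by (simp only: piece_coeff_def c_def[symmetric] Mi Li)
    also have "\<dots> = (\<Prod>k=1..h. (1 - y ^ (N + 1 - k)) / (1 - y ^ (next_in (insert h I) k + 1 - k)))"
    proof (rule prod.reindex_bij_witness[of _ "\<lambda>k. c + k" "\<lambda>k. k - c"])
      fix k assume k: "k \<in> {c + 1..c + h}"
      have "next_in ((\<lambda>j. c + j) ` insert h I) (c + (k - c)) = c + next_in (insert h I) (k - c)"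
        by (rule next_in_shift) (use finI k in auto)
      hence nx: "next_in (insert (c + h) ((\<lambda>j. c + j) ` I)) k = c + next_in (insert h I) (k - c)"
        using k by simp
      show "(1 - y ^ (N + 1 - (k - c))) / (1 - y ^ (next_in (insert h I) (k - c) + 1 - (k - c))) =
        (1 - y ^ (c + N + 1 - k)) / (1 - y ^ (next_in (insert (c + h) ((\<lambda>j. c + j) ` I)) k + 1 - k))"
      proof -
        have "N + 1 - (k - c) = c + N + 1 - k" "next_in (insert h I) (k - c) + 1 - (k - c) = c + next_in (insert h I) (k - c) + 1 - k"
          using k by auto
        thus ?thesis unfolding nx by simp
      qed
    qed auto
    also have "\<dots> = (\<Prod>k=1..h. 1 - y ^ (N + 1 - k)) / (\<Prod>k=1..h. 1 - y ^ (next_in (insert h I) k + 1 - k))"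
      by (rule prod_dividef)
    also have "(\<Prod>k=1..h. 1 - y ^ (N + 1 - k)) = qfact N y / qfact (N - h) y"
    proof -
      have "(\<Prod>k=1..h. 1 - y ^ (N + 1 - k)) = (\<Prod>k=N - h + 1..N. 1 - y ^ k)"
        by (rule prod.reindex_bij_witness[of _ "\<lambda>k. N + 1 - k" "\<lambda>k. N + 1 - k"]) (use hN in auto)
      moreover have "qfact N y = qfact (N - h) y * (\<Prod>k=N - h + 1..N. 1 - y ^ k)"
        by (rule qfact_split) simp
      moreover have "qfact (N - h) y \<noteq> 0" using qfact_nonzero[OF y] .
      ultimately show ?thesis by simp
    qed
    finally have "piece_coeff y i ((\<lambda>j. c + j) ` I) = qfact N y / qfact (N - h) y / (\<Prod>k=1..h. 1 - y ^ (next_in (insert h I) k + 1 - k))" .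
    moreover have "gauss_multinomial h I y = qfact h y / (\<Prod>k=1..h. 1 - y ^ (next_in (insert h I) k + 1 - k))"
    proof (rule gauss_multinomial_next[OF finI _ y])
      show "\<forall>i\<in>I. i < h" using I h1 by force
    qed
    moreover have "gauss_binomial N (N - h) y = qfact N y / (qfact (N - h) y * qfact (N - (N - h)) y)"
      by (rule gauss_binomial_qfact[OF _ y]) simp
    moreover have "N - (N - h) = h" using hN by simp
    moreover have "qfact h y \<noteq> 0" using qfact_nonzero[OF y] .
    ultimately show ?thesis by simp
  qed
  have bij: "bij_betw (image \<psi>) (Pow {1..h - 1}) (Pow (horizontals i))"
    unfolding im[symmetric] by (rule bij_betw_Pow) (simp add: bij_betw_def inj_on_subset[OF inj])
  have "(\<Sum>Z\<in>Pow (horizontals i). fps_const (piece_coeff y i (snd ` Z)) * prod V Z) =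
    (\<Sum>I\<in>Pow {1..h - 1}. fps_const (piece_coeff y i (snd ` \<psi> ` I)) * prod V (\<psi> ` I))"
    by (rule sum.reindex_bij_betw[OF bij, symmetric])
  also have "\<dots> = (\<Sum>I\<in>Pow {1..h - 1}. fps_const (gauss_binomial N (N - h) y) *
      (fps_const (gauss_multinomial h I y) * (\<Prod>j\<in>I. V (P i, c + j))))"
  proof (intro sum.cong refl)
    fix I assume I: "I \<in> Pow {1..h - 1}"
    have "snd ` \<psi> ` I = (\<lambda>j. c + j) ` I" unfolding image_image \<psi>_def snd_conv ..
    moreover have "prod V (\<psi> ` I) = (\<Prod>j\<in>I. V (P i, c + j))"
      using prod.reindex[of \<psi> I V] inj_on_subset[OF inj, of I] by (simp add: \<psi>_def)
    moreover have "piece_coeff y i ((\<lambda>j. c + j) ` I) = gauss_binomial N (N - h) y * gauss_multinomial h I y"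
      using I by (intro coeff) simp
    ultimately show "fps_const (piece_coeff y i (snd ` \<psi> ` I)) * prod V (\<psi> ` I) =
      fps_const (gauss_binomial N (N - h) y) * (fps_const (gauss_multinomial h I y) * (\<Prod>j\<in>I. V (P i, c + j)))"
      by (simp only: fps_const_mult[symmetric] mult.assoc)
  qed
  also have "\<dots> = fps_const (gauss_binomial N (N - h) y) *
      (\<Sum>I\<in>Pow {1..h - 1}. fps_const (gauss_multinomial h I y) * (\<Prod>j\<in>I. V (P i, c + j)))"
    by (rule sum_distrib_left[symmetric])
  finally show ?thesis using lt unfolding h_def N_def c_def by simp
qed

end

section \<open>Igusa functions of the hooks and the final product\<close>

text \<open>The first equation evaluates an optional state, the second a forced one.\<close>

lemma fps_one_plus_geometric:
  fixes W :: "'a::field fps"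
  assumes "fps_nth W 0 = 0"
  shows "1 + W / (1 - W) = 1 / (1 - W)" "W * (1 / (1 - W) * S) = W / (1 - W) * S"
proof -
  have nz: "fps_nth (1 - W) 0 \<noteq> 0" using assms by simp
  have "1 + W * inverse (1 - W) = (1 - W) * inverse (1 - W) + W * inverse (1 - W)"
    using inverse_mult_eq_1'[OF nz] by simp
  also have "\<dots> = inverse (1 - W)" by (simp add: left_diff_distrib)
  finally show "1 + W / (1 - W) = 1 / (1 - W)" using nz by (simp add: fps_divide_unit)
  show "W * (1 / (1 - W) * S) = W / (1 - W) * S" using nz by (simp add: fps_divide_unit mult.assoc)
qed

lemma inverse_prime_power_neq_1:
  assumes "prime (p::nat)" "k \<ge> 1"
  shows "(1 / of_nat p :: rat) ^ k \<noteq> 1"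
proof -
  have "(1 / of_nat p :: rat) < 1" using prime_gt_1_nat[OF assms(1)] by simp
  hence "(1 / of_nat p :: rat) ^ k < 1" using assms(2) by (intro power_less_one_iff[THEN iffD2]) auto
  thus ?thesis by simp
qed

context dyck_blocks
begin

text \<open>The optional corner is the full set \<open>{1..d}\<close> and gives the prefactor of
  \<open>igusa_wo\<close>. The end of the hook is the last variable \<open>X h\<close> and gives the
  prefactor of \<open>igusa\<close>, with the additional factor \<open>X h\<close> when it is
  forced.\<close>

lemma sum_piece_eq_igusa:
  assumes p: "prime p" and i: "i \<in> {1..r}" and a: "inj_on a {1..d}" "a ` {1..d} = P i - P (i - 1)"
    and Y: "\<And>I. I \<noteq> {} \<Longrightarrow> I \<subseteq> {1..d} \<Longrightarrow> Y I = state_weight p (P (i - 1) \<union> a ` I, M (i - 1))"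
    and X: "\<And>k. 1 \<le> k \<Longrightarrow> k \<le> M i - M (i - 1) \<Longrightarrow> X k = state_weight p (P i, M (i - 1) + k)"
  shows "(\<Sum>Z\<in>piece i. fps_const (piece_coeff (1 / of_nat p) i (snd ` Z)) *
      (\<Prod>s\<in>Z. state_weight p s / (1 - state_weight p s))) =
    fps_const (gauss_binomial (L i - M (i - 1)) (L i - M i) (1 / of_nat p)) * igusa_wo d Y *
    (if i < r then igusa_circ (M i - M (i - 1)) (1 / of_nat p) X else igusa (M i - M (i - 1)) (1 / of_nat p) X)"
proof -
  define W where "W = state_weight p"
  define V where "V s = W s / (1 - W s)" for s
  define y where "y = (1 / of_nat p :: rat)"
  define h where "h = M i - M (i - 1)"
  define c where "c = M (i - 1)"
  have h1: "1 \<le> h" and Mi: "M i = c + h" using M_step[OF i] by (auto simp: h_def c_def)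
  have d1: "{1..d} \<noteq> {}"
  proof
    assume "{1..d} = {}"
    hence "P i - P (i - 1) = {}" using a(2) by (metis image_empty)
    thus False using Pstep[OF i] by blast
  qed
  have Pi: "P i = P (i - 1) \<union> a ` {1..d}" using a(2) Pstep[OF i] by blast
  have y1: "y ^ k \<noteq> 1" if "k \<ge> 1" for k using inverse_prime_power_neq_1[OF p that] by (simp add: y_def)
  have W0: "fps_nth (W (P i, b)) 0 = 0" for b
  proof -
    have "P i \<subseteq> {1..g}" using i by (intro Psub) simp
    moreover have "(P i, b) \<noteq> ({}, 0)" using Pstep[OF i] by auto
    ultimately show ?thesis unfolding W_def by (intro state_weight_0) auto
  qed
  have vert: "(\<Sum>Z\<in>{Z. Z \<subseteq> verticals i \<and> is_chain Z}. prod V Z) * (1 + V (corner i)) = igusa_wo d Y"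
  proof -
    have "(\<Sum>Z\<in>{Z. Z \<subseteq> verticals i \<and> is_chain Z}. prod V Z) =
      (\<Sum>y\<in>chains {I. I \<noteq> {} \<and> I \<subset> {1..d}}. \<Prod>I\<in>y. Y I / (1 - Y I))"
      unfolding sum_vertical_chains[OF i a]
    proof (intro sum.cong prod.cong refl)
      fix y I assume "y \<in> chains {I. I \<noteq> {} \<and> I \<subset> {1..d}}" "I \<in> y"
      hence "I \<noteq> {}" "I \<subseteq> {1..d}" by (auto simp: chains_def)
      thus "V (P (i - 1) \<union> a ` I, M (i - 1)) = Y I / (1 - Y I)" using Y unfolding V_def W_def by simp
    qed
    moreover have "1 + V (corner i) = 1 / (1 - Y {1..d})"
    proof -
      have "Y {1..d} = W (corner i)" using Y[OF d1] Pi unfolding W_def by simp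
      thus ?thesis using fps_one_plus_geometric(1)[OF W0] unfolding V_def by simp
    qed
    ultimately show ?thesis unfolding igusa_wo_def by (simp only: mult.commute)
  qed
  define G where "G = (\<Sum>I\<in>Pow {1..h - 1}. fps_const (gauss_multinomial h I y) * (\<Prod>j\<in>I. X j / (1 - X j)))"
  have hor: "(\<Sum>Z\<in>Pow (horizontals i). fps_const (piece_coeff y i (snd ` Z)) * prod V Z) =
    fps_const (gauss_binomial (L i - M (i - 1)) (L i - M i) y) * G"
  proof -
    have "(\<Sum>I\<in>Pow {1..h - 1}. fps_const (gauss_multinomial h I y) * (\<Prod>j\<in>I. V (P i, M (i - 1) + j))) = G"
      unfolding G_def
    proof (intro sum.cong refl arg_cong2[where f = "(*)"] prod.cong)
      fix I j assume I: "I \<in> Pow {1..h - 1}" and j: "j \<in> I"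
      have "1 \<le> j" "j \<le> h" using I j h1 by fastforce+
      thus "V (P i, M (i - 1) + j) = X j / (1 - X j)" using X[of j] unfolding V_def W_def h_def by simp
    qed
    thus ?thesis using sum_horizontals[OF i y1, of V] unfolding h_def by simp
  qed
  have Xh: "X h = W (P i, M i)" using X[of h] h1 unfolding h_def[symmetric] Mi c_def[symmetric] W_def by simp
  have igu: "igusa h y X = 1 / (1 - X h) * G" unfolding igusa_def G_def ..
  have ends: "G * (if i < r then V (P i, M i) else 1 + V (P i, M i)) = (if i < r then igusa_circ h y X else igusa h y X)"
  proof (cases "i < r")
    case True
    have "X h * (1 / (1 - X h) * G) = X h / (1 - X h) * G"
      unfolding Xh by (rule fps_one_plus_geometric(2)[OF W0])
    hence "G * V (P i, M i) = igusa_circ h y X"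
      unfolding igusa_circ_def igu V_def Xh by (simp only: mult.commute)
    thus ?thesis using True by simp
  next
    case False
    have "1 + V (P i, M i) = 1 / (1 - X h)"
      unfolding V_def Xh by (rule fps_one_plus_geometric(1)[OF W0])
    thus ?thesis using False unfolding igu by (simp add: mult.commute)
  qed
  have "(\<Sum>Z\<in>piece i. fps_const (piece_coeff y i (snd ` Z)) * prod V Z) =
    igusa_wo d Y * (fps_const (gauss_binomial (L i - M (i - 1)) (L i - M i) y) * G) *
    (if i < r then V (P i, M i) else 1 + V (P i, M i))"
    unfolding sum_piece[OF i] vert hor ..
  also have "\<dots> = fps_const (gauss_binomial (L i - M (i - 1)) (L i - M i) y) * igusa_wo d Y *
      (G * (if i < r then V (P i, M i) else 1 + V (P i, M i)))"
    by (simp only: mult.assoc mult.commute mult.left_commute)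
  finally show ?thesis unfolding ends unfolding y_def h_def V_def W_def .
qed

lemma finite_partition_pairs:
  "finite {mu. mu \<in> partitions n \<and> (\<forall>i\<in>{1..n}. mu !\<^sub>1 i \<le> la !\<^sub>1 i) \<and> Q mu}"
proof (rule finite_subset)
  show "{mu. mu \<in> partitions n \<and> (\<forall>i\<in>{1..n}. mu !\<^sub>1 i \<le> la !\<^sub>1 i) \<and> Q mu} \<subseteq>
    {mu. set mu \<subseteq> {..\<Sum>i=1..n. la !\<^sub>1 i} \<and> length mu = n}"
  proof (intro subsetI CollectI conjI)
    fix mu assume mu: "mu \<in> {mu. mu \<in> partitions n \<and> (\<forall>i\<in>{1..n}. mu !\<^sub>1 i \<le> la !\<^sub>1 i) \<and> Q mu}"
    show len: "length mu = n" using mu by (simp add: partitions_def)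
    fix x assume "x \<in> set mu"
    then obtain j where j: "j < n" "x = mu ! j" using len by (auto simp: in_set_conv_nth)
    hence jn: "Suc j \<in> {1..n}" by simp
    have "x \<le> la !\<^sub>1 (Suc j)" using mu jn j by fastforce
    also have "\<dots> \<le> (\<Sum>i=1..n. la !\<^sub>1 i)" by (rule member_le_sum[OF jn]) auto
    finally show "x \<in> {..\<Sum>i=1..n. la !\<^sub>1 i}" by simp
  qed
qed (simp add: finite_lists_length_eq)

text \<open>The weak orderings that induce \<open>A\<close> split the tuples inducing
  \<open>A\<close> into fibres, so the outer finite sum and the inner infinite sums combine to one
  sum over those tuples. Summing over the partitions belonging to each tuple gives the sum over good
  pairs.\<close>

lemma D_wA_eq_sum_hook_chains:
  assumes p: "prime p" and A: "A \<in> compatible_partitions n g f (block_word r L M)" and len: "length A = r"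
    and AP: "\<And>i. i \<in> {1..r} \<Longrightarrow> A !\<^sub>1 i = P i - P (i - 1)"
  shows "D_wA n g f (block_word r L M) A p =
    (\<Sum>Y\<in>hook_chains. fps_const (chain_coeff (1 / of_nat p) (snd ` Y)) * (\<Prod>s\<in>Y. state_weight p s / (1 - state_weight p s)))"
proof -
  define w where "w = block_word r L M"
  define U where "U = {l \<in> admissible n g f. is_induced_partition n g f w (weak_ordering_of g f l) A}"
  define Mu where "Mu l = {mu. mu \<in> partitions n \<and> (\<forall>i\<in>{1..n}. mu !\<^sub>1 i \<le> sort_desc l !\<^sub>1 i) \<and> pair_word n mu (sort_desc l) = w}" for l
  define V where "V = {v. v \<in> weak_orderings g \<and> compatible_weak_ordering n g f w v \<and> induced_partition n g f w v = A}"
  define R where "R = (\<Sum>Y\<in>hook_chains. fps_const (chain_coeff (1 / of_nat p) (snd ` Y)) * (\<Prod>s\<in>Y. state_weight p s / (1 - state_weight p s)))"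
  have pairs: "good_pairs = Sigma U Mu"
  proof (rule Set.set_eqI)
    fix z :: "nat list \<times> nat list"
    obtain l mus where z: "z = (l, mus)" by (metis surj_pair)
    show "z \<in> good_pairs \<longleftrightarrow> z \<in> Sigma U Mu"
      unfolding z good_pairs_def U_def Mu_def w_def mem_Sigma_iff mem_Collect_eq prod.case
      using good_iff[OF _ _ A len AP, of l mus] by blast
  qed
  have fin: "finite (Mu l)" for l unfolding Mu_def by (rule finite_partition_pairs)
  have D_term: "D_term n w p l = (\<Sum>mu\<in>Mu l. pair_term p (l, mu))" for l
    unfolding D_term_def Mu_def pair_term_def prod.case ..
  have "has_fsum (\<lambda>(l, mu). pair_term p (l, mu)) R (Sigma U Mu)"
    using has_fsum_pair_term[OF p] unfolding R_def pairs by simp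
  from has_fsum_marginal[OF this fin] have sumU: "has_fsum (D_term n w p) R U"
    unfolding D_term[abs_def] .
  have uniq: "induced_partition n g f w v = A'" if "v \<in> weak_orderings g" "is_induced_partition n g f w v A'" for v A'
  proof -
    obtain \<sigma> J where v: "v = (\<sigma>, J)" by (metis surj_pair)
    have perm: "\<sigma> permutes {1..g}" using that(1) by (simp add: v weak_orderings_def)
    show ?thesis unfolding induced_partition_def
      using that(2) is_induced_partition_unique[OF f1 perm] unfolding v by (intro the_equality) auto
  qed
  \<comment> \<open>Uniqueness of the induced partition replaces the definite description by the
    defining relation.\<close>
  have V: "V = {v \<in> weak_orderings g. is_induced_partition n g f w v A}"
    unfolding V_def compatible_weak_ordering_def using uniq by blast
  have finV: "finite V"
  proof (rule finite_subset)
    show "V \<subseteq> {\<sigma>. \<sigma> permutes {1..g}} \<times> Pow {1..g-1}" unfolding V weak_orderings_def by auto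
    show "finite ({\<sigma>. \<sigma> permutes {1..g}} \<times> Pow {1..g-1})" by (simp add: finite_permutations)
  qed
  have wo: "weak_ordering_of g f l \<in> weak_orderings g" for l
    using weak_ordering_of_props(1) by (metis surj_pair)
  have "D_wA n g f w A p = (\<Sum>v\<in>V. infsum (D_term n w p) {l \<in> U. weak_ordering_of g f l = v})"
    unfolding D_wA_def D_wv_def V_def[symmetric]
  proof (intro sum.cong refl arg_cong2[where f = infsum])
    fix v assume "v \<in> V"
    thus "{l \<in> admissible n g f. weak_ordering_of g f l = v} = {l \<in> U. weak_ordering_of g f l = v}"
      unfolding U_def V by blast
  qed
  also have "\<dots> = R"
    by (rule sum_infsum_fibres[OF sumU finV]) (use wo in \<open>auto simp: U_def V\<close>)
  finally show ?thesis unfolding w_def R_def .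
qed

end

theorem theorem3p6:
  fixes n g p r :: nat and f L M t :: "nat \<Rightarrow> nat"
    and w :: "letter list" and A :: "nat set list"
    and a :: "nat \<Rightarrow> nat \<Rightarrow> nat" and \<epsilon> :: "nat \<Rightarrow> nat set \<Rightarrow> nat"
    and x :: "nat \<Rightarrow> rat fps" and y :: "nat \<Rightarrow> nat set \<Rightarrow> rat fps"
  assumes "n \<ge> 1" and "g \<ge> 1" and "\<forall>i\<in>{1..g}. f i \<ge> 1" and "(\<Sum>i=1..g. f i) = n"
    and "prime p"
    and "cuts n r L" and "cuts n r M" and "w = block_word r L M" and "w \<in> dyck_words n"
    and "A \<in> compatible_partitions n g f w"
    and "\<forall>i\<in>{0..r}. t i = (\<Sum>k=1..i. card (A !\<^sub>1 k))"
    and "\<forall>i\<in>{1..r}. strict_mono_on {1..t i - t (i - 1)} (a i) \<and>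
                    a i ` {1..t i - t (i - 1)} = A !\<^sub>1 i"
    and "\<forall>i\<in>{1..r}. \<forall>I. I \<noteq> {} \<and> I \<subseteq> {1..t i - t (i - 1)} \<longrightarrow>
           \<epsilon> i I = L (i - 1) + (\<Sum>j\<in>I. f (a i j))"
    and "\<forall>i\<in>{1..r}. \<forall>j. M (i - 1) < j \<and> j \<le> M i \<longrightarrow>
           x j = of_nat p ^ (j * (2 * n + L i - j)) * fps_X ^ (2 * L i + j)"
    and "\<forall>i\<in>{1..r}. \<forall>I. I \<noteq> {} \<and> I \<subseteq> {1..t i - t (i - 1)} \<longrightarrow>
           y i I = of_nat p ^ ((2 * n - M (i - 1) + \<epsilon> i I) * M (i - 1)) *
                   fps_X ^ (2 * \<epsilon> i I + M (i - 1))"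
  shows "D_wA n g f w A p =
    (\<Prod>i=1..r. fps_const (gauss_binomial (L i - M (i - 1)) (L i - M i) (1 / of_nat p))) *
    (\<Prod>i=1..r. igusa_wo (t i - t (i - 1)) (y i)) *
    (\<Prod>i=1..r-1. igusa_circ (M i - M (i - 1)) (1 / of_nat p) (\<lambda>k. x (M (i - 1) + k))) *
    igusa (n - M (r - 1)) (1 / of_nat p) (\<lambda>k. x (M (r - 1) + k))"
proof -
  define P where "P i = (\<Union>k\<in>{1..i}. A !\<^sub>1 k)" for i
  note cL = assms(6) and cM = assms(7) and w = assms(8) and p = assms(5)
  have part: "distinct A" "partition_on {1..g} (set A)"
    using assms(10) by (auto simp: compatible_partitions_def ordered_set_partitions_def)
  obtain r' L' M' where c': "cuts n r' L'" "cuts n r' M'" "w = block_word r' L' M'" "length A = r'"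
    and sums': "\<And>i. i \<in> {1..r'} \<Longrightarrow> (\<Sum>j\<in>A !\<^sub>1 i. f j) = L' i - L' (i - 1)"
    using assms(10) by (auto simp: compatible_partitions_def)
  \<comment> \<open>Compatibility of \<open>A\<close> comes with its own cut sequences; injectivity
    of \<open>block_word\<close> identifies them with the given ones.\<close>
  have eqw: "block_word r L M = block_word r' L' M'" using w c'(3) by simp
  have len: "length A = r" using block_word_inject(1)[OF cL cM c'(1,2) eqw] c'(4) by simp
  have LL: "L i = L' i" if "i \<le> r" for i by (rule block_word_inject(2)[OF cL cM c'(1,2) eqw that])
  have sums: "sum f (A !\<^sub>1 i) = L i - L (i - 1)" if "i \<in> {1..r}" for i
  proof -
    have "i \<le> r" "i - 1 \<le> r" "i \<in> {1..r'}" using that len c'(4) by auto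
    thus ?thesis using sums'[of i] LL by simp
  qed
  have memA: "A !\<^sub>1 i \<in> set A" if "i \<in> {1..r}" for i using that len by (intro nth_mem) auto
  have ne: "A !\<^sub>1 i \<noteq> {}" if "i \<in> {1..r}" for i
    using partition_onD3[OF part(2)] memA[OF that] by metis
  have disj: "A !\<^sub>1 i \<inter> A !\<^sub>1 j = {}" if ij: "i \<in> {1..r}" "j \<in> {1..r}" "i \<noteq> j" for i j
  proof -
    have "i - 1 < length A" "j - 1 < length A" "i - 1 \<noteq> j - 1" using ij len by auto
    hence "A !\<^sub>1 i \<noteq> A !\<^sub>1 j" using part(1) by (simp add: nth_eq_iff_index_eq)
    thus ?thesis using partition_onD2[OF part(2)] memA[OF ij(1)] memA[OF ij(2)] by (auto dest: disjointD)
  qed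
  have subA: "A !\<^sub>1 i \<subseteq> {1..g}" if "i \<in> {1..r}" for i
    using partition_onD1[OF part(2)] memA[OF that] by blast
  have PSuc: "P i = P (i - 1) \<union> A !\<^sub>1 i" if "i \<in> {1..r}" for i
  proof -
    have "{1..i} = insert i {1..i - 1}" using that by auto
    thus ?thesis unfolding P_def by auto
  qed
  have Pdisj: "P (i - 1) \<inter> A !\<^sub>1 i = {}" if i: "i \<in> {1..r}" for i
  proof -
    have "A !\<^sub>1 k \<inter> A !\<^sub>1 i = {}" if "k \<in> {1..i - 1}" for k using that i by (intro disj) auto
    thus ?thesis unfolding P_def by blast
  qed
  have AP: "A !\<^sub>1 i = P i - P (i - 1)" if "i \<in> {1..r}" for i
    using PSuc[OF that] Pdisj[OF that] by blast
  have Pr: "P r = {1..g}"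
  proof -
    have "set A = (\<lambda>k. A !\<^sub>1 k) ` {1..r}"
    proof (intro equalityI subsetI)
      fix X assume "X \<in> set A"
      then obtain j where "j < r" "X = A ! j" using len by (auto simp: in_set_conv_nth)
      thus "X \<in> (\<lambda>k. A !\<^sub>1 k) ` {1..r}" by (intro image_eqI[of _ _ "Suc j"]) auto
    qed (use memA in blast)
    thus ?thesis using partition_onD1[OF part(2)] unfolding P_def by simp
  qed
  have Psub: "P i \<subseteq> {1..g}" if "i \<le> r" for i
    using subA that unfolding P_def by fastforce
  have FP: "sum f (P i) = L i" if "i \<le> r" for i
    using that
  proof (induction i)
    case 0
    show ?case using cL by (simp add: P_def cuts_def)
  next
    case (Suc i)
    have S: "Suc i \<in> {1..r}" using Suc.prems by simp
    have "finite (P i)" "finite (A !\<^sub>1 (Suc i))"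
      using finite_subset[OF Psub[of i]] finite_subset[OF subA[OF S]] Suc.prems by auto
    hence "sum f (P (Suc i)) = sum f (P i) + sum f (A !\<^sub>1 (Suc i))"
      using PSuc[OF S] Pdisj[OF S] by (simp add: sum.union_disjoint)
    moreover have "L i \<le> L (Suc i)" using cuts_le[OF cL, of i "Suc i"] Suc.prems by simp
    ultimately show ?case using Suc sums[OF S] by simp
  qed
  interpret dyck_blocks n g r f L M P
  proof
    show "psum f g = n" using assms(4) by (simp add: psum_def)
    show "M i \<le> L i" if "i \<le> r" for i
      using block_word_dyck_le[OF cL cM _ that] assms(9) w by simp
    show "P 0 = {}" by (simp add: P_def)
    show "P (i - 1) \<subset> P i" if "i \<in> {1..r}" for i
      using PSuc[OF that] Pdisj[OF that] ne[OF that] by blast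
  qed (use assms(1,3) cL cM Pr FP in auto)
  define h where "h i = M i - M (i - 1)" for i
  define X where "X i k = x (M (i - 1) + k)" for i k
  define y' where "y' = (1 / of_nat p :: rat)"
  define ig where "ig i = (if i < r then igusa_circ (h i) y' (X i) else igusa (h i) y' (X i))" for i
  have block: "(\<Sum>Z\<in>piece i. fps_const (piece_coeff y' i (snd ` Z)) * (\<Prod>s\<in>Z. state_weight p s / (1 - state_weight p s))) =
    fps_const (gauss_binomial (L i - M (i - 1)) (L i - M i) y') * igusa_wo (t i - t (i - 1)) (y i) * ig i"
    if i: "i \<in> {1..r}" for i
    unfolding ig_def y'_def h_def
  proof (rule sum_piece_eq_igusa[OF p i])
    define d where "d = t i - t (i - 1)"
    have ai: "strict_mono_on {1..d} (a i)" "a i ` {1..d} = A !\<^sub>1 i"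
      using assms(12) i unfolding d_def by blast+
    show inj: "inj_on (a i) {1..t i - t (i - 1)}"
      using strict_mono_on_imp_inj_on[OF ai(1)] unfolding d_def .
    show "a i ` {1..t i - t (i - 1)} = P i - P (i - 1)" using ai(2) AP[OF i] unfolding d_def by simp
    have ri: "i - 1 \<le> r" using i by auto
    have Mn: "M (i - 1) \<le> n" by (rule cuts_le_n[OF cM ri])
    show "y i I = state_weight p (P (i - 1) \<union> a i ` I, M (i - 1))"
      if I: "I \<noteq> {}" "I \<subseteq> {1..t i - t (i - 1)}" for I
    proof -
      have sub: "a i ` I \<subseteq> A !\<^sub>1 i" using ai(2) I(2) unfolding d_def by blast
      have "finite (P (i - 1))" "finite (a i ` I)"
        using finite_subset[OF Psub[OF ri]] finite_subset[OF I(2)] by auto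
      hence "sum f (P (i - 1) \<union> a i ` I) = sum f (P (i - 1)) + sum f (a i ` I)"
        using sub Pdisj[OF i] by (intro sum.union_disjoint) auto
      also have "sum f (a i ` I) = (\<Sum>j\<in>I. f (a i j))"
        using sum.reindex[OF inj_on_subset[OF inj I(2)], of f] by simp
      finally have eps: "sum f (P (i - 1) \<union> a i ` I) = \<epsilon> i I"
        using FP[OF ri] assms(13) i I by simp
      \<comment> \<open>The two exponents place the truncated subtraction differently; they agree
        because \<open>M (i - 1) \<le> n\<close>.\<close>
      have "M (i - 1) * (2 * n + \<epsilon> i I - M (i - 1)) = (2 * n - M (i - 1) + \<epsilon> i I) * M (i - 1)"
        using Mn by (simp add: mult.commute)
      moreover have "y i I = of_nat p ^ ((2 * n - M (i - 1) + \<epsilon> i I) * M (i - 1)) * fps_X ^ (2 * \<epsilon> i I + M (i - 1))"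
        using assms(15) i I by blast
      ultimately show ?thesis unfolding state_weight_def fst_conv snd_conv eps
        by (simp only: fps_of_nat[symmetric] fps_const_power)
    qed
    show "X i k = state_weight p (P i, M (i - 1) + k)" if k: "1 \<le> k" "k \<le> M i - M (i - 1)" for k
    proof -
      have "M (i - 1) < M (i - 1) + k" "M (i - 1) + k \<le> M i" using k by auto
      hence "x (M (i - 1) + k) = of_nat p ^ ((M (i - 1) + k) * (2 * n + L i - (M (i - 1) + k))) * fps_X ^ (2 * L i + (M (i - 1) + k))"
        using assms(14) i by blast
      moreover have "sum f (P i) = L i" using FP[of i] i by simp
      ultimately show ?thesis unfolding X_def state_weight_def fst_conv snd_conv
        by (simp only: fps_of_nat[symmetric] fps_const_power)
    qed
  qed
  have igs: "(\<Prod>i=1..r. ig i) =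
    (\<Prod>i=1..r-1. igusa_circ (M i - M (i - 1)) y' (\<lambda>k. x (M (i - 1) + k))) * igusa (n - M (r - 1)) y' (\<lambda>k. x (M (r - 1) + k))"
  proof -
    have "{1..r} = insert r {1..r - 1}" using r1 by auto
    hence "(\<Prod>i=1..r. ig i) = ig r * (\<Prod>i=1..r-1. ig i)" using r1 by simp
    also have "(\<Prod>i=1..r-1. ig i) = (\<Prod>i=1..r-1. igusa_circ (M i - M (i - 1)) y' (\<lambda>k. x (M (i - 1) + k)))"
      by (intro prod.cong refl) (auto simp: ig_def h_def X_def[abs_def])
    also have "ig r = igusa (n - M (r - 1)) y' (\<lambda>k. x (M (r - 1) + k))"
      using cM by (simp add: ig_def h_def X_def[abs_def] cuts_def)
    finally show ?thesis by (simp only: mult.commute)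
  qed
  have "D_wA n g f w A p = (\<Prod>i=1..r. \<Sum>Z\<in>piece i. fps_const (piece_coeff y' i (snd ` Z)) *
      (\<Prod>s\<in>Z. state_weight p s / (1 - state_weight p s)))"
    unfolding w y'_def sum_hook_chains_eq_prod[symmetric]
    by (rule D_wA_eq_sum_hook_chains[OF p assms(10)[unfolded w] len]) (rule AP)
  also have "\<dots> = (\<Prod>i=1..r. fps_const (gauss_binomial (L i - M (i - 1)) (L i - M i) y') * igusa_wo (t i - t (i - 1)) (y i) * ig i)"
    by (intro prod.cong refl block)
  also have "\<dots> = (\<Prod>i=1..r. fps_const (gauss_binomial (L i - M (i - 1)) (L i - M i) y')) *
      (\<Prod>i=1..r. igusa_wo (t i - t (i - 1)) (y i)) * (\<Prod>i=1..r. ig i)"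
    by (simp only: prod.distrib)
  finally show ?thesis unfolding igs y'_def by (simp only: mult.assoc)
qed

end
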